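(* Let $\mathbb{M}\in\{\mathbb{R}^2,\mathbb{H}^2,\mathbb{S}^2\}$, let $\Gamma\subset\mathbb{M}$ be a circle of radius $r_0$, and let $0<\alpha<\frac{\pi}{6}$. The random circular billiard map $\overline{F}$ on $\Gamma$ with parameter $\alpha$ is mixing if and only if $\frac{\alpha}{\pi}$ is an irrational number.
   Context: Circular billiards. $\mathbb{M}$ is the Euclidean plane $\mathbb{R}^2$, the hyperbolic plane $\mathbb{H}^2$ (curvature $-1$) or the unit sphere $\mathbb{S}^2$ (curvature $1$). $\Gamma$ is a geodesic circle of radius $r_0>0$ (with $r_0<\pi/2$ in $\mathbb{S}^2$). Put $h=r_0$, $\sinh r_0$, $\sin r_0$ respectively; $\Gamma$ has length $L=2\pi h$ and is identified by arc length with $[0,L)$ taken mod $2\pi h$. For $\theta\in[0,\pi]$, $\gamma(\theta)\in[0,2\pi]$ is the central angle from a point of $\Gamma$ to the next collision point when a particle leaves along a geodesic making angle $\theta$ with the oriented tangent of $\Gamma$; it does not depend on the point. Equivalently $\gamma$ is the continuous increasing function with $\gamma(0)=0$, $\gamma(\pi/2)=\pi$, $\gamma(\pi)=2\pi$ and $\tan(\gamma(\theta)/2)=\tan(\theta)/c$ for $\theta\neq \pi/2$, where $c=1$, $\cosh r_0$, $\cos r_0$ respectively (so $\gamma(\theta)=2\theta$ in $\mathbb{R}^2$). Put $l(\gamma)=h\gamma$. The deterministic billiard map is $F(s,\theta)=(s+l(\gamma(\theta)) \bmod 2\pi h,\ \theta)$. Feres random map. $T_1(\theta)=\theta+2\alpha$,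 $T_2(\theta)=-\theta+2\pi-4\alpha$, $T_3(\theta)=\theta-2\alpha$, $T_4(\theta)=-\theta+4\alpha$. With $u_\beta(\theta)=\frac12\left(1+\frac{\tan\beta}{\tan\theta}\right)$, define on $[0,\pi]$: - $p_1=1$ on $[0,\alpha)$; $u_\alpha(\theta)$ on $[\alpha,\pi-3\alpha)$; $2\cos(2\alpha)u_{2\alpha}(\theta)$ on $[\pi-3\alpha,\pi-2\alpha)$; $0$ on $[\pi-2\alpha,\pi]$. - $p_2=0$ on $[0,\pi-3\alpha)$; $u_\alpha(\theta)-2\cos(2\alpha)u_{2\alpha}(\theta)$ on $[\pi-3\alpha,\pi-2\alpha)$; $u_\alpha(\theta)$ on $[\pi-2\alpha,\pi-\alpha)$; $0$ on $[\pi-\alpha,\pi]$. - $p_3=0$ on $[0,2\alpha)$; $2\cos(2\alpha)u_{2\alpha}(-\theta)$ on $[2\alpha,3\alpha)$; $u_\alpha(-\theta)$ on $[3\alpha,\pi-\alpha)$; $1$ on $[\pi-\alpha,\pi]$. - $p_4=0$ on $[0,\alpha)$; $u_\alpha(-\theta)$ on $[\alpha,2\alpha)$; $u_\alpha(-\theta)-2\cos(2\alpha)u_{2\alpha}(-\theta)$ on $[2\alpha,3\alpha)$; $0$ on $[3\alpha,\pi]$. The Feres random map is $T(\theta)=T_i(\theta)$ with probability $p_i(\theta)$. (One has $p_1+p_2+p_3+p_4=1$, and $T_i(\theta)\in[0,\pi]$ whenever $p_i(\theta)>0$.) Random circular billiard map. $\overline{F}(s,\theta)=\overline{F}_i(s,\theta):=(s+l(\gamma(T_i(\theta)))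 \bmod 2\pi h,\ T_i(\theta))$ with probability $p_i(\theta)$. Mixing. For $i=1,\dots,4$ let $J_i=\{(\theta,x)\in[0,\pi]\times[0,1] : \sum_{k<i}p_k(\theta)<x<\sum_{k\le i}p_k(\theta)\}$; these sets partition $[0,\pi]\times[0,1]$ up to null sets. On $J_i$ let $\varphi_i(\theta,x)=\frac{1}{p_i(\theta)}\left(x-\sum_{k=1}^{i-1}p_k(\theta)\right)$. The associated skew-product $S$ on $[0,1]\times[0,L]\times[0,\pi]$ is defined (almost everywhere) by $$S(x,s,\theta)=\left(\varphi_i(\theta,x),\ s+l(\gamma(T_i(\theta))) \bmod 2\pi h,\ T_i(\theta)\right)\quad\text{if }(\theta,x)\in J_i.$$ It preserves the probability measure $\eta\times\lambda\times\mu$, where $\eta$ and $\lambda$ are the normalized Lebesgue measures on $[0,1]$ and $[0,L]$ and $d\mu=\frac12\sin\theta\,d\theta$ on $[0,\pi]$. The random map $\overline{F}$ is called mixing if $S$ is (strongly) mixing with respect to $m=\eta\times\lambda\times\mu$, i.e. $m(S^{-n}A\cap B)\to m(A)m(B)$ for all measurable $A,B$. *)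

theory Defs
  imports "HOL-Analysis.Analysis" "HOL-Library.Real_Mod"
begin

section \<open>Geodesic circles in the three constant curvature surfaces\<close>

text \<open>
  All three surfaces are realised in three-space: the Euclidean plane as the affine plane
  \<open>z = 1\<close>, the hyperbolic plane as the upper sheet \<open>z\<^sup>2 - x\<^sup>2 - y\<^sup>2 = 1\<close>, \<open>z > 0\<close> of the hyperboloid
  with the Lorentz metric, and the unit sphere. In each model the unit speed geodesic from \<open>q\<close>
  with unit tangent vector \<open>v\<close> is \<open>t \<mapsto> cs t *\<^sub>R q + sn t *\<^sub>R v\<close>, with \<open>cs\<close> and \<open>sn\<close> as below.
\<close>

datatype surface = Euclidean | Hyperbolic | Spherical

type_synonym point = "real \<times> real \<times> real"

fun curvature :: "surface \<Rightarrow> real" where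
  "curvature Euclidean = 0"
| "curvature Hyperbolic = - 1"
| "curvature Spherical = 1"

fun sn :: "surface \<Rightarrow> real \<Rightarrow> real" where
  "sn Euclidean r = r"
| "sn Hyperbolic r = sinh r"
| "sn Spherical r = sin r"

fun cs :: "surface \<Rightarrow> real \<Rightarrow> real" where
  "cs Euclidean r = 1"
| "cs Hyperbolic r = cosh r"
| "cs Spherical r = cos r"

definition geodesic :: "surface \<Rightarrow> point \<Rightarrow> point \<Rightarrow> real \<Rightarrow> point" where
  "geodesic M q v t = cs M t *\<^sub>R q + sn M t *\<^sub>R v"

text \<open>
  By homogeneity of the surfaces the circle of radius \<open>r\<close> is centred at \<open>(0, 0, 1)\<close>. Its point with
  polar angle \<open>\<phi>\<close> is the end point of the geodesic of length \<open>r\<close> starting at the centre in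
  direction \<open>(cos \<phi>, sin \<phi>, 0)\<close>.
\<close>

definition circle_point :: "surface \<Rightarrow> real \<Rightarrow> real \<Rightarrow> point" where
  "circle_point M r \<phi> = geodesic M (0, 0, 1) (cos \<phi>, sin \<phi>, 0) r"

definition circle :: "surface \<Rightarrow> real \<Rightarrow> point set" where
  "circle M r = range (circle_point M r)"

definition circle_tangent :: "real \<Rightarrow> point" where
  "circle_tangent \<phi> = (- sin \<phi>, cos \<phi>, 0)"

text \<open>The inward unit normal is minus the derivative of \<^term>\<open>circle_point M r \<phi>\<close> in \<open>r\<close>.\<close>

definition circle_normal :: "surface \<Rightarrow> real \<Rightarrow> real \<Rightarrow> point" where
  "circle_normal M r \<phi> = (- cs M r * cos \<phi>, - cs M r * sin \<phi>, curvature M * sn M r)"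

definition trajectory :: "surface \<Rightarrow> real \<Rightarrow> real \<Rightarrow> real \<Rightarrow> real \<Rightarrow> point" where
  "trajectory M r \<phi> \<theta> =
     geodesic M (circle_point M r \<phi>)
       (cos \<theta> *\<^sub>R circle_tangent \<phi> + sin \<theta> *\<^sub>R circle_normal M r \<phi>)"

definition next_collision :: "surface \<Rightarrow> real \<Rightarrow> real \<Rightarrow> real \<Rightarrow> point \<Rightarrow> bool" where
  "next_collision M r \<phi> \<theta> q \<longleftrightarrow>
     q \<in> circle M r \<and>
     (\<exists>t>0. trajectory M r \<phi> \<theta> t = q \<and> (\<forall>t'\<in>{0<..<t}. trajectory M r \<phi> \<theta> t' \<notin> circle M r))"

text \<open>
  The central angle between consecutive collisions. For the tangential directions \<open>0\<close> and \<open>\<pi>\<close>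
  the values are the continuous extensions \<open>0\<close> and \<open>2\<pi>\<close>.
\<close>

definition central_angle :: "surface \<Rightarrow> real \<Rightarrow> real \<Rightarrow> real" where
  "central_angle M r \<theta> =
     (if \<theta> \<le> 0 then 0 else if \<theta> \<ge> pi then 2 * pi
      else (THE \<delta>. 0 < \<delta> \<and> \<delta> < 2 * pi \<and>
                   (\<forall>\<phi>. next_collision M r \<phi> \<theta> (circle_point M r (\<phi> + \<delta>)))))"

text \<open>
  The description above determines the central angle, and it satisfies \<open>tan (\<gamma>/2) = tan \<theta> / c\<close>
  with \<open>c = 1\<close>, \<open>cosh r\<close>, \<open>cos r\<close>, respectively (lemma \<open>central_angle_formula\<close>).
\<close>

lemma first_return:
  fixes r a :: real
  assumes r: "0 < r" "M = Spherical \<Longrightarrow> r < pi/2" and a: "0 < a" "a \<le> 1"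
  defines "C \<equiv> cs M r" and "S \<equiv> sn M r"
  shows "\<exists>t>0. cs M t = (C^2 - curvature M * S^2*a^2)/(C^2 + curvature M * S^2*a^2)
      \<and> sn M t = 2*C*S*a/(C^2 + curvature M * S^2*a^2)
      \<and> (\<forall>t'\<in>{0<..<t}. (if M = Euclidean then t' \<noteq> 2*r*a else C*(cs M t' - 1) \<noteq> - curvature M*S*a * sn M t'))"
proof (cases M)
  case Euclidean
  then show ?thesis using assms by (intro exI[of _ "2*r*a"]) auto
next
  case Hyperbolic
  have C: "C > 0" "S > 0" "S < C" "C^2 = S^2 + 1" using r Hyperbolic by (auto simp: C_def S_def cosh_square_eq sinh_less_cosh_real)
  let ?q = "a*S/C"
  have "a * S < C" using a C by (smt (verit) mult_left_le_one_le)
  then have q: "0 < ?q" "?q < 1" using C a by auto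
  let ?t = "2 * artanh ?q"
  have th: "tanh (artanh ?q) = ?q"
  proof -
    define y where "y = ?q"
    have y: "0 < y" "y < 1" using q y_def by auto
    have "exp (2 * artanh y) = (1+y)/(1-y)" using y by (simp add: artanh_def)
    then have "exp (-2 * artanh y) = (1-y)/(1+y)" by (simp add: exp_minus)
    then have "tanh (artanh y) = (1 - (1-y)/(1+y)) / (1 + (1-y)/(1+y))" unfolding tanh_real_altdef by (simp only:)
    then show ?thesis unfolding y_def[symmetric] using y by (simp add: divide_simps)
  qed
  have tpos: "?t > 0" using q th by (metis zero_less_mult_iff zero_less_numeral tanh_real_pos_iff)
  let ?u = "artanh ?q"
  have sc: "sinh ?u = ?q * cosh ?u" using th by (metis tanh_def cosh_real_nonzero nonzero_eq_divide_eq)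
  have c1: "cosh ?u^2 * (1 - ?q^2) = 1" using sc hyperbolic_pythagoras[of ?u] by algebra
  have den: "C^2 - S^2*a^2 > 0" using \<open>a*S<C\<close> C a by (smt (verit) power_mult_distrib mult.commute power_strict_mono zero_less_numeral mult_pos_pos)
  have c2: "cosh ?u^2 = C^2/(C^2 - S^2*a^2)"
  proof -
    have "C*?q = a*S" using C by simp
    then have "cosh ?u^2 * (C^2 - S^2*a^2) = C^2" using c1 by algebra
    then show ?thesis using den by (metis less_irrefl nonzero_eq_divide_eq)
  qed
  have "cosh ?t = cosh ?u^2 + sinh ?u^2" by (rule cosh_double)
  also have "... = cosh ?u^2 * (1 + ?q^2)" using sc by algebra
  also note c2
  also have "1 + ?q^2 = (C^2 + S^2*a^2)/C^2"
    using C(1) by (simp add: power_divide power_mult_distrib add_divide_distrib mult.commute)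
  also have "C^2/(C^2 - S^2*a^2) * ((C^2 + S^2*a^2)/C^2) = (C^2 + S^2*a^2)/(C^2 - S^2*a^2)"
    using C(1) by simp
  finally have c: "cosh ?t = (C^2 + S^2*a^2)/(C^2 - S^2*a^2)" .
  have "sinh ?t = 2 * ?q * cosh ?u^2" by (simp add: sinh_double sc power2_eq_square)
  also note c2
  also have "2 * ?q * (C^2/(C^2 - S^2*a^2)) = 2*C*S*a/(C^2 - S^2*a^2)"
    using C(1) by (simp add: power2_eq_square)
  finally have s: "sinh ?t = 2*C*S*a/(C^2 - S^2*a^2)" .
  have f: "C*(cosh t' - 1) \<noteq> S*a * sinh t'" if "0 < t'" "t' < ?t" for t'
  proof
    assume e: "C*(cosh t' - 1) = S*a * sinh t'"
    have d: "cosh t' = 2 * sinh (t'/2)^2 + 1" "sinh t' = 2 * sinh(t'/2)*cosh(t'/2)"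
      using cosh_double[of "t'/2"] sinh_double[of "t'/2"] by (simp_all add: cosh_square_eq)
    have "sinh (t'/2) > 0" using that by simp
    with e have "C * sinh (t'/2) = S*a*cosh(t'/2)" unfolding d by (simp add: power2_eq_square)
    then have "tanh (t'/2) = ?q" using C by (simp add: tanh_def field_simps)
    moreover have "tanh (t'/2) < tanh ?u" using that by simp
    ultimately show False using th by simp
  qed
  show ?thesis using Hyperbolic tpos c s f by (intro exI[of _ ?t]) auto
next
  case Spherical
  have C: "C > 0" "S > 0" "C^2 + S^2 = 1" using r Spherical by (auto simp: C_def S_def cos_gt_zero sin_gt_zero)
  let ?q = "a*S/C"
  have q: "0 < ?q" using C a by auto
  let ?u = "arctan ?q" let ?t = "2 * ?u"
  have tpos: "?t > 0" "?u < pi/2" using q arctan_ubound by auto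
  have den: "C^2 + S^2*a^2 > 0" using C by (simp add: add_pos_nonneg)
  have cu: "cos ?u > 0" using tpos by (intro cos_gt_zero_pi) linarith+
  have sc: "sin ?u = ?q * cos ?u" using tan_arctan[of ?q] cu by (simp add: tan_def field_simps)
  have "cos ?u^2 * (1 + ?q^2) = 1" using sc sin_cos_squared_add[of ?u] by algebra
  moreover have "C*?q = a*S" using C by simp
  ultimately have "cos ?u^2 * (C^2 + S^2*a^2) = C^2" by algebra
  then have c2: "cos ?u^2 = C^2/(C^2 + S^2*a^2)"
    using den by (metis less_irrefl nonzero_eq_divide_eq)
  have "cos ?t = cos ?u^2 - sin ?u^2" by (rule cos_double)
  also have "... = cos ?u^2 * (1 - ?q^2)" using sc by algebra
  also note c2
  also have "1 - ?q^2 = (C^2 - S^2*a^2)/C^2"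
    using C(1) by (simp add: power_divide power_mult_distrib diff_divide_distrib mult.commute)
  also have "C^2/(C^2 + S^2*a^2) * ((C^2 - S^2*a^2)/C^2) = (C^2 - S^2*a^2)/(C^2 + S^2*a^2)"
    using C(1) by simp
  finally have c: "cos ?t = (C^2 - S^2*a^2)/(C^2 + S^2*a^2)" .
  have "sin ?t = 2 * ?q * cos ?u^2" by (simp add: sin_double sc power2_eq_square)
  also note c2
  also have "2 * ?q * (C^2/(C^2 + S^2*a^2)) = 2*C*S*a/(C^2 + S^2*a^2)"
    using C(1) by (simp add: power2_eq_square)
  finally have s: "sin ?t = 2*C*S*a/(C^2 + S^2*a^2)" .
  have f: "C*(cos t' - 1) \<noteq> -(S*a * sin t')" if "0 < t'" "t' < ?t" for t'
  proof
    assume e: "C*(cos t' - 1) = -(S*a * sin t')"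
    have d: "cos t' = 1 - 2 * sin (t'/2)^2" "sin t' = 2 * sin(t'/2)*cos(t'/2)"
      using cos_double[of "t'/2"] sin_double[of "t'/2"] by (simp_all add: cos_squared_eq)
    have h: "t'/2 < pi/2" using that tpos by linarith
    have "sin (t'/2) > 0" "cos(t'/2) > 0" using that h by (auto intro: sin_gt_zero cos_gt_zero)
    with e have "C * sin (t'/2) = S*a*cos(t'/2)" unfolding d by (simp add: power2_eq_square)
    then have "tan (t'/2) = ?q" using C \<open>cos(t'/2) > 0\<close> by (simp add: tan_def field_simps)
    moreover have "tan (t'/2) < tan ?u" using that tpos by (intro tan_monotone) linarith+
    ultimately show False by (simp add: tan_arctan)
  qed
  show ?thesis using Spherical tpos c s f by (intro exI[of _ ?t]) auto
qed

lemma cs_sn_pythagoras: "cs M r^2 + curvature M * sn M r^2 = 1"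
  by (cases M) (auto simp: cosh_square_eq)

lemma trajectory_eq: "trajectory M r \<phi> \<theta> t =
  (let X = cs M t * sn M r - sn M t * sin \<theta> * cs M r; Y = sn M t * cos \<theta> in
    (X * cos \<phi> - Y * sin \<phi>, X * sin \<phi> + Y * cos \<phi>, cs M t * cs M r + sn M t * sin \<theta> * curvature M * sn M r))"
  by (simp add: trajectory_def geodesic_def circle_point_def circle_tangent_def circle_normal_def Let_def algebra_simps)

lemma circle_point_eq: "circle_point M r \<phi> = (sn M r * cos \<phi>, sn M r * sin \<phi>, cs M r)"
  by (simp add: geodesic_def circle_point_def)

lemma cs_sn_eq_unique:
  assumes "cos x = cos y" "sin x = sin y" "0 < x" "x < 2*pi" "0 < y" "y < 2*pi" shows "x = (y::real)"
proof -
  obtain n::int where n: "x = y + 2*pi*n" using assms sin_cos_eq_iff by (metis)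
  then have "\<bar>2*pi*n\<bar> < 2*pi" using assms by auto
  then have "n = 0" by (simp add: abs_mult)
  then show ?thesis using n by simp
qed

lemma central_angle_formula:
  assumes r: "0 < r" "M = Spherical \<Longrightarrow> r < pi/2" and th: "0 < \<theta>" "\<theta> < pi"
  shows "0 < central_angle M r \<theta> \<and> central_angle M r \<theta> < 2*pi
    \<and> (\<forall>\<phi>. next_collision M r \<phi> \<theta> (circle_point M r (\<phi> + central_angle M r \<theta>)))
    \<and> (if \<theta> = pi/2 then central_angle M r \<theta> = pi else tan (central_angle M r \<theta>/2) = tan \<theta> / cs M r)"
proof -
  define C S a b \<kappa> where d: "C = cs M r" "S = sn M r" "a = sin \<theta>" "b = cos \<theta>" "\<kappa> = curvature M"
  have a: "0 < a" "a \<le> 1" "a^2+b^2=1" using th by (auto simp: d sin_gt_zero)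
  have C: "C > 0" "S > 0" using r by (cases M; auto simp: d cos_gt_zero sin_gt_zero)+
  have P: "C^2 + \<kappa>*S^2 = 1" using cs_sn_pythagoras d by auto
  define N where "N = sqrt (a^2 + C^2*b^2)"
  have N2: "N^2 = a^2 + C^2*b^2" "N > 0" using a by (auto simp: N_def add_pos_nonneg)
  have "C^2 + \<kappa>*S^2*a^2 = C^2 + (1-C^2)*a^2" using P by algebra
  also have "... = N^2" unfolding N2 using a(3) by algebra
  finally have D: "C^2 + \<kappa>*S^2*a^2 = N^2" .
  obtain t where t: "t > 0" "cs M t = (C^2 - \<kappa> * S^2*a^2)/N^2" "sn M t = 2*C*S*a/N^2"
     and tm0: "\<forall>t'\<in>{0<..<t}. if M = Euclidean then t' \<noteq> 2*r*a else C*(cs M t' - 1) \<noteq> - \<kappa>*S*a * sn M t'"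
    using first_return[of r M a, OF r(1) _ a(1,2)] r(2) unfolding d[symmetric] D by blast
  note tm = bspec[OF tm0]
  define \<delta> where "\<delta> = 2 * arccos (C*b/N)"
  have le: "(C*b/N)^2 + (a/N)^2 = 1"
  proof -
    have "(C*b/N)^2 + (a/N)^2 = N^2/N^2" unfolding power_divide add_divide_distrib[symmetric] power_mult_distrib by (simp only: N2(1) add.commute)
    then show ?thesis using N2(2) by simp
  qed
  then have ab: "\<bar>C*b/N\<bar> \<le> 1"
    using abs_square_le_1[of "C*b/N"] zero_le_power2[of "a/N"] by linarith
  then have cd: "cos (\<delta>/2) = C*b/N" unfolding \<delta>_def by (simp add: cos_arccos_abs)
  have "C*b/N \<noteq> 1" "C*b/N \<noteq> -1"
  proof -
    have "(a/N)^2 > 0" using a N2 by simp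
    then have "(C*b/N)^2 < 1" using le by linarith
    then show "C*b/N \<noteq> 1" "C*b/N \<noteq> -1" by (metis less_irrefl one_power2, metis less_irrefl power2_minus one_power2)
  qed
  then have ab': "\<bar>C*b/N\<bar> < 1" using ab by linarith
  have dr: "0 < \<delta>" "\<delta> < 2*pi" unfolding \<delta>_def using arccos_lt_bounded[of "C*b/N"] ab' unfolding abs_less_iff by linarith+
  have sp: "sin (\<delta>/2) > 0" using dr by (intro sin_gt_zero) auto
  have "sin (\<delta>/2)^2 = (a/N)^2" using le cd by (simp add: sin_squared_eq)
  then have sd: "sin (\<delta>/2) = a/N" using sp a N2 by (simp add: power2_eq_iff_nonneg)
  have cosd: "cos \<delta> = (C^2*b^2 - a^2)/N^2" using cos_double[of "\<delta>/2"] cd sd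
    by (simp add: power_divide diff_divide_distrib power_mult_distrib)
  have sind: "sin \<delta> = 2*a*b*C/N^2" using sin_double[of "\<delta>/2"] cd sd by (simp add: power2_eq_square)
  have X: "cs M t * S - sn M t * a * C = S * cos \<delta>"
  proof -
    have "C^2 - \<kappa>*S^2*a^2 - 2*C*a*a*C = C^2*b^2 - a^2" using P a(3) by algebra
    then show ?thesis unfolding t cosd using N2(2) by (simp add: field_simps) algebra
  qed
  have Y: "sn M t * b = S * sin \<delta>" unfolding t sind by simp
  have Z: "cs M t * C + sn M t * a * \<kappa> * S = C"
    unfolding t using N2(2) D by (simp add: field_simps) algebra
  have hit: "trajectory M r \<phi> \<theta> t = circle_point M r (\<phi> + \<delta>)" for \<phi>
    unfolding trajectory_eq circle_point_eq Let_def d[symmetric] X Y Z by (simp add: cos_add sin_add algebra_simps)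
  have nohit: "trajectory M r \<phi> \<theta> t' \<notin> circle M r" if t': "t' \<in> {0<..<t}" for t' \<phi>
  proof
    assume "trajectory M r \<phi> \<theta> t' \<in> circle M r"
    then obtain \<psi> where e: "trajectory M r \<phi> \<theta> t' = circle_point M r \<psi>" by (auto simp: circle_def)
    define X' Y' where xy: "X' = cs M t' * S - sn M t' * a * C" "Y' = sn M t' * b"
    have e3: "X' * cos \<phi> - Y' * sin \<phi> = S * cos \<psi>" "X' * sin \<phi> + Y' * cos \<phi> = S * sin \<psi>"
       "cs M t' * C + sn M t' * a * \<kappa> * S = C"
      using e unfolding trajectory_eq circle_point_eq Let_def d[symmetric] xy by auto
    have sq: "X'^2+Y'^2 = S^2" using e3(1,2) sin_cos_squared_add[of \<phi>] sin_cos_squared_add[of \<psi>] by algebra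
    show False
    proof (cases "M = Euclidean")
      case True
      then have "X' = r - t'*a" "Y' = t'*b" "S = r" using xy d by auto
      then have "t' * (t' - 2*r*a) = 0" using sq a(3) by algebra
      then show False using tm[OF t'] t' True by auto
    next
      case False
      then show False using tm[OF t'] e3(3) by (simp add: algebra_simps)
    qed
  qed
  have nc: "next_collision M r \<phi> \<theta> (circle_point M r (\<phi> + \<delta>))" for \<phi>
    unfolding next_collision_def using hit[of \<phi>] nohit t(1) by (metis circle_def rangeI)
  have uniq: "\<delta>' = \<delta>" if dp: "0 < \<delta>'" "\<delta>' < 2*pi" "\<forall>\<phi>. next_collision M r \<phi> \<theta> (circle_point M r (\<phi> + \<delta>'))" for \<delta>'
  proof -
    obtain t2 where t2: "t2 > 0" "trajectory M r 0 \<theta> t2 = circle_point M r \<delta>'"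
       "\<forall>t'\<in>{0<..<t2}. trajectory M r 0 \<theta> t' \<notin> circle M r"
      using dp(3)[rule_format, of 0] unfolding next_collision_def by auto
    have "t2 = t"
    proof (rule ccontr)
      assume "t2 \<noteq> t"
      then consider "t2 < t" | "t < t2" by linarith
      then show False
      proof cases
        case 1 then show ?thesis using nohit[of t2 0] t2 by (auto simp: circle_def)
      next
        case 2 then show ?thesis using bspec[OF t2(3), of t] t(1) hit[of 0] by (auto simp: circle_def)
      qed
    qed
    then have "circle_point M r \<delta>' = circle_point M r \<delta>" using hit[of 0] t2 by simp
    then have "cos \<delta>' = cos \<delta>" "sin \<delta>' = sin \<delta>" using C by (auto simp: circle_point_eq d)
    then show ?thesis using cs_sn_eq_unique dp dr by blast
  qed
  have "(THE \<delta>. 0 < \<delta> \<and> \<delta> < 2 * pi \<and>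
          (\<forall>\<phi>. next_collision M r \<phi> \<theta> (circle_point M r (\<phi> + \<delta>)))) = \<delta>"
    using nc dr uniq by (intro the_equality) blast+
  then have ca: "central_angle M r \<theta> = \<delta>"
    unfolding central_angle_def using th by simp
  have fin: "if \<theta> = pi/2 then \<delta> = pi else tan (\<delta>/2) = tan \<theta> / C"
  proof (cases "\<theta> = pi/2")
    case True
    then have "b = 0" unfolding d(4) by (simp only: cos_pi_half)
    then show ?thesis using True by (simp add: \<delta>_def)
  next
    case False
    then show ?thesis using N2(2) C by (simp add: tan_def cd sd d(3,4)[symmetric])
  qed
  show ?thesis unfolding ca d(1)[symmetric] using dr nc fin by auto
qed

section \<open>The circular billiard map and the Feres random map\<close>

text \<open>\<^term>\<open>sn M r\<close> is the quantity \<open>h\<close>, so that the circle has length \<open>2 \<pi> h\<close>.\<close>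

definition circle_length :: "surface \<Rightarrow> real \<Rightarrow> real" where
  "circle_length M r = 2 * pi * sn M r"

definition circular_billiard :: "surface \<Rightarrow> real \<Rightarrow> real \<times> real \<Rightarrow> real \<times> real" where
  "circular_billiard M r = (\<lambda>(s, \<theta>).
     ((s + sn M r * central_angle M r \<theta>) rmod circle_length M r, \<theta>))"

definition feres_map :: "real \<Rightarrow> nat \<Rightarrow> real \<Rightarrow> real" where
  "feres_map \<alpha> i \<theta> =
     (if i = 1 then \<theta> + 2 * \<alpha>
      else if i = 2 then - \<theta> + 2 * pi - 4 * \<alpha>
      else if i = 3 then \<theta> - 2 * \<alpha>
      else - \<theta> + 4 * \<alpha>)"

text \<open>
  At \<open>\<theta> = \<pi>/2\<close> the quotient below is \<open>0\<close>, since \<open>tan (\<pi>/2) = 0\<close> and division by \<open>0\<close> gives \<open>0\<close>;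
  this agrees with \<open>tan \<beta> * cot \<theta>\<close>.
\<close>

definition feres_u :: "real \<Rightarrow> real \<Rightarrow> real" where
  "feres_u \<beta> \<theta> = (1 + tan \<beta> / tan \<theta>) / 2"

definition feres_p1 :: "real \<Rightarrow> real \<Rightarrow> real" where
  "feres_p1 \<alpha> \<theta> =
     (if \<theta> < \<alpha> then 1
      else if \<theta> < pi - 3 * \<alpha> then feres_u \<alpha> \<theta>
      else if \<theta> < pi - 2 * \<alpha> then 2 * cos (2 * \<alpha>) * feres_u (2 * \<alpha>) \<theta>
      else 0)"

definition feres_p2 :: "real \<Rightarrow> real \<Rightarrow> real" where
  "feres_p2 \<alpha> \<theta> =
     (if \<theta> < pi - 3 * \<alpha> then 0
      else if \<theta> < pi - 2 * \<alpha> then feres_u \<alpha> \<theta> - 2 * cos (2 * \<alpha>) * feres_u (2 * \<alpha>) \<theta>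
      else if \<theta> < pi - \<alpha> then feres_u \<alpha> \<theta>
      else 0)"

definition feres_p3 :: "real \<Rightarrow> real \<Rightarrow> real" where
  "feres_p3 \<alpha> \<theta> =
     (if \<theta> < 2 * \<alpha> then 0
      else if \<theta> < 3 * \<alpha> then 2 * cos (2 * \<alpha>) * feres_u (2 * \<alpha>) (- \<theta>)
      else if \<theta> < pi - \<alpha> then feres_u \<alpha> (- \<theta>)
      else 1)"

definition feres_p4 :: "real \<Rightarrow> real \<Rightarrow> real" where
  "feres_p4 \<alpha> \<theta> =
     (if \<theta> < \<alpha> then 0
      else if \<theta> < 2 * \<alpha> then feres_u \<alpha> (- \<theta>)
      else if \<theta> < 3 * \<alpha> then feres_u \<alpha> (- \<theta>) - 2 * cos (2 * \<alpha>) * feres_u (2 * \<alpha>) (- \<theta>)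
      else 0)"

definition feres_prob :: "real \<Rightarrow> nat \<Rightarrow> real \<Rightarrow> real" where
  "feres_prob \<alpha> i =
     (if i = 1 then feres_p1 \<alpha>
      else if i = 2 then feres_p2 \<alpha>
      else if i = 3 then feres_p3 \<alpha>
      else feres_p4 \<alpha>)"

text \<open>
  The random circular billiard map consists of the following four maps, the \<open>i\<close>-th one being
  applied at \<open>(s, \<theta>)\<close> with probability \<^term>\<open>feres_prob \<alpha> i \<theta>\<close>.
\<close>

definition random_billiard :: "surface \<Rightarrow> real \<Rightarrow> real \<Rightarrow> nat \<Rightarrow> real \<times> real \<Rightarrow> real \<times> real" where
  "random_billiard M r \<alpha> i = (\<lambda>(s, \<theta>). circular_billiard M r (s, feres_map \<alpha> i \<theta>))"

section \<open>The associated skew-product and mixing\<close>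

definition skew_domain :: "real \<Rightarrow> nat \<Rightarrow> (real \<times> real) set" where
  "skew_domain \<alpha> i =
     {(\<theta>, x). \<theta> \<in> {0..pi} \<and> x \<in> {0..1} \<and>
        (\<Sum>k\<in>{1..<i}. feres_prob \<alpha> k \<theta>) < x \<and> x < (\<Sum>k\<in>{1..i}. feres_prob \<alpha> k \<theta>)}"

definition skew_fibre :: "real \<Rightarrow> nat \<Rightarrow> real \<Rightarrow> real \<Rightarrow> real" where
  "skew_fibre \<alpha> i \<theta> x = 1 / feres_prob \<alpha> i \<theta> * (x - (\<Sum>k\<in>{1..<i}. feres_prob \<alpha> k \<theta>))"

text \<open>
  The sets \<^term>\<open>skew_domain \<alpha> i\<close>, \<open>i \<in> {1..4}\<close>, are pairwise disjoint. On the null set they leave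
  uncovered the skew-product is extended by the identity.
\<close>

definition skew_product ::
    "surface \<Rightarrow> real \<Rightarrow> real \<Rightarrow> real \<times> real \<times> real \<Rightarrow> real \<times> real \<times> real" where
  "skew_product M r \<alpha> = (\<lambda>(x, s, \<theta>).
     if \<exists>i\<in>{1..4}. (\<theta>, x) \<in> skew_domain \<alpha> i
     then let i = (THE i. i \<in> {1..4} \<and> (\<theta>, x) \<in> skew_domain \<alpha> i)
          in (skew_fibre \<alpha> i \<theta> x, random_billiard M r \<alpha> i (s, \<theta>))
     else (x, s, \<theta>))"

definition interval_measure :: "real \<Rightarrow> real measure" where
  "interval_measure a = uniform_measure (restrict_space lborel {0..a}) {0..a}"

definition angle_measure :: "real measure" where
  "angle_measure = density (restrict_space lborel {0..pi}) (\<lambda>\<theta>. ennreal (sin \<theta> / 2))"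

definition skew_measure :: "surface \<Rightarrow> real \<Rightarrow> (real \<times> real \<times> real) measure" where
  "skew_measure M r =
     interval_measure 1 \<Otimes>\<^sub>M (interval_measure (circle_length M r) \<Otimes>\<^sub>M angle_measure)"

definition strongly_mixing :: "'a measure \<Rightarrow> ('a \<Rightarrow> 'a) \<Rightarrow> bool" where
  "strongly_mixing m S \<longleftrightarrow>
     (\<forall>A\<in>sets m. \<forall>B\<in>sets m.
        (\<lambda>n. measure m ((S ^^ n) -` A \<inter> B)) \<longlonglongrightarrow> measure m A * measure m B)"

definition random_billiard_mixing :: "surface \<Rightarrow> real \<Rightarrow> real \<Rightarrow> bool" where
  "random_billiard_mixing M r \<alpha> \<longleftrightarrow> strongly_mixing (skew_measure M r) (skew_product M r \<alpha>)"

end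

(* Integrating the indicator of a set along the skew-product over the coordinate x gives functions on
   (s, \<theta>) that evolve by the reversible Markov operator Q of the Feres map composed with the billiard map
   B, which is measure preserving. The energy (the squared L2 norm) decreases, and its decrements control
   p_i p_j (h(s, T_i \<theta>) - h(s, T_j \<theta>))^2. So, after integration over any set of s, the functions are
   asymptotically invariant under the translation T_1 o T_3^-1 by 4 \<alpha> and under the reflections in
   3 \<alpha> and \<pi> - 3 \<alpha>, hence under translations modulo 4 \<alpha> by multiples of 2 \<pi>; for irrational
   \<alpha> / \<pi> this leaves only functions independent of \<theta> in the weak limit. As B turns a function of s
   alone into one that varies with \<theta>, testing against the density that B pushes to the uniform law on
   the circle shows that the limit is constant. The coordinate x is handled by the transfer operator of
   the skew-product, which makes every Lipschitz function of x asymptotically independent of x.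
   If \<alpha> / \<pi> has denominator n, then cos (n \<theta>) is invariant. *)

theory Submission
  imports Defs
begin

section \<open>Weak convergence of bounded functions\<close>

text \<open>The operator Q is self-adjoint, but composed with B it is not, so the argument rests on
  the monotone energy and not on a spectral decomposition. The energy controls differences between
  branches only in the mean, with weights that vanish at ends of intervals. Hence everything is
  phrased by null sequences, in L1 or weakly, and no limit point is extracted: the centring
  constants depend on n. Weak convergence is tested against all of L1, since the density
  \<open>\<phi>0\<close> is unbounded near 0 and \<pi>. The branches leave s fixed, so the dihedral
  argument works over each set of positions and leaves an unknown function of s. The product of the
  two reflections is translation by 2 (\<pi> - 6 \<alpha>), which is 2 \<pi> modulo 4 \<alpha>. In
  the coordinate x, \<open>R\<close> multiplies Lipschitz constants by probabilities, but near the
  tangential directions one branch has probability 1 and nothing is gained there. The contraction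
  holds only in the mean, and it is recovered one step later, because that branch leads into the
  middle region.\<close>

definition weakly_null :: "'a measure \<Rightarrow> (nat \<Rightarrow> 'a \<Rightarrow> real) \<Rightarrow> bool" where
  "weakly_null M k \<longleftrightarrow> (\<forall>\<psi>. integrable M \<psi> \<longrightarrow> (\<lambda>n. \<integral>x. k n x * \<psi> x \<partial>M) \<longlonglongrightarrow> 0)"

lemma weakly_nullD: "weakly_null M k \<Longrightarrow> integrable M \<psi> \<Longrightarrow> (\<lambda>n. \<integral>x. k n x * \<psi> x \<partial>M) \<longlonglongrightarrow> 0"
  by (simp add: weakly_null_def)

lemma integrable_bounded_mult:
  fixes k \<psi> :: "'a \<Rightarrow> real"
  assumes "k \<in> borel_measurable M" "\<And>x. x \<in> space M \<Longrightarrow> \<bar>k x\<bar> \<le> C" "integrable M \<psi>"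
  shows "integrable M (\<lambda>x. k x * \<psi> x)" "integrable M (\<lambda>x. \<psi> x * k x)"
proof -
  have m: "\<psi> \<in> borel_measurable M" using assms(3) by auto
  show 1: "integrable M (\<lambda>x. k x * \<psi> x)"
  proof (rule Bochner_Integration.integrable_bound)
    show "integrable M (\<lambda>x. C * \<psi> x)" using assms by simp
    show "AE x in M. norm (k x * \<psi> x) \<le> norm (C * \<psi> x)"
    proof (rule AE_I2)
      fix x assume "x \<in> space M"
      then have "\<bar>k x\<bar> \<le> \<bar>C\<bar>" using assms(2)[of x] by linarith
      then show "norm (k x * \<psi> x) \<le> norm (C * \<psi> x)" by (simp add: abs_mult mult_right_mono)
    qed
  qed (use assms(1) m in measurable)
  then show "integrable M (\<lambda>x. \<psi> x * k x)" by (simp add: mult.commute)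
qed

text \<open>The bound on \<open>k\<close> makes the pairing with a test Lipschitz for the L1 norm,
  with constant |C| for all n. A test that is a dominated limit of tests therefore inherits the
  limit 0.\<close>

lemma weak_limit_in_L1:
  fixes k :: "nat \<Rightarrow> 'a \<Rightarrow> real"
  assumes k: "\<And>n. k n \<in> borel_measurable M" "\<And>n x. x \<in> space M \<Longrightarrow> \<bar>k n x\<bar> \<le> C"
    and s: "\<And>i. integrable M (s i)" "\<And>i. (\<lambda>n. \<integral>x. k n x * s i x \<partial>M) \<longlonglongrightarrow> 0"
    and lim: "\<And>x. x \<in> space M \<Longrightarrow> (\<lambda>i. s i x) \<longlonglongrightarrow> \<psi> x"
      "\<And>i x. x \<in> space M \<Longrightarrow> \<bar>s i x\<bar> \<le> g x" "integrable M g" "integrable M \<psi>"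
  shows "(\<lambda>n. \<integral>x. k n x * \<psi> x \<partial>M) \<longlonglongrightarrow> 0"
proof (rule LIMSEQ_I)
  fix e :: real assume e: "e > 0"
  have "(\<lambda>i. \<integral>x. \<bar>s i x - \<psi> x\<bar> \<partial>M) \<longlonglongrightarrow> (\<integral>x. 0 \<partial>M)"
  proof (rule integral_dominated_convergence)
    show "integrable M (\<lambda>x. g x + \<bar>\<psi> x\<bar>)" using lim by auto
    show "AE x in M. (\<lambda>i. \<bar>s i x - \<psi> x\<bar>) \<longlonglongrightarrow> 0"
      using lim(1) by (intro AE_I2 tendsto_rabs_zero) (simp add: LIM_zero)
    show "AE x in M. norm \<bar>s i x - \<psi> x\<bar> \<le> g x + \<bar>\<psi> x\<bar>" for i
    proof (rule AE_I2)
      fix x assume "x \<in> space M"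
      from lim(2)[OF this, of i] show "norm \<bar>s i x - \<psi> x\<bar> \<le> g x + \<bar>\<psi> x\<bar>" by simp
    qed
  qed (use lim s in \<open>auto intro!: borel_measurable_abs borel_measurable_diff\<close>)
  then have "(\<lambda>i. \<bar>C\<bar> * (\<integral>x. \<bar>s i x - \<psi> x\<bar> \<partial>M)) \<longlonglongrightarrow> 0"
    by (auto intro: tendsto_mult_right_zero)
  from LIMSEQ_D[OF this, of "e/2"] e obtain i where i: "\<bar>C\<bar> * (\<integral>x. \<bar>s i x - \<psi> x\<bar> \<partial>M) < e/2"
    by (auto simp: abs_mult dest: spec)
  from LIMSEQ_D[OF s(2), of "e/2" i] e obtain N where N: "\<And>n. n \<ge> N \<Longrightarrow> \<bar>\<integral>x. k n x * s i x \<partial>M\<bar> < e/2"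
    by auto
  show "\<exists>N. \<forall>n\<ge>N. norm ((\<integral>x. k n x * \<psi> x \<partial>M) - 0) < e"
  proof (intro exI allI impI)
    fix n assume n: "n \<ge> N"
    have i1: "integrable M (\<lambda>x. k n x * s i x)" and i2: "integrable M (\<lambda>x. k n x * \<psi> x)"
      using integrable_bounded_mult[OF k s(1)] integrable_bounded_mult[OF k lim(4)] by auto
    have "\<bar>(\<integral>x. k n x * \<psi> x \<partial>M) - (\<integral>x. k n x * s i x \<partial>M)\<bar> = \<bar>\<integral>x. k n x * \<psi> x - k n x * s i x \<partial>M\<bar>"
      by (simp only: Bochner_Integration.integral_diff[OF i2 i1])
    also have "\<dots> \<le> (\<integral>x. \<bar>k n x * \<psi> x - k n x * s i x\<bar> \<partial>M)"
      by (rule integral_abs_bound)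
    also have "\<dots> \<le> (\<integral>x. \<bar>C\<bar> * \<bar>s i x - \<psi> x\<bar> \<partial>M)"
    proof (rule integral_mono)
      show "integrable M (\<lambda>x. \<bar>C\<bar> * \<bar>s i x - \<psi> x\<bar>)" using s(1)[of i] lim(4) by auto
      show "integrable M (\<lambda>x. \<bar>k n x * \<psi> x - k n x * s i x\<bar>)" using i1 i2 by auto
      fix x assume "x \<in> space M"
      then have "\<bar>k n x\<bar> \<le> \<bar>C\<bar>" using k(2)[of x n] by linarith
      then have "\<bar>k n x\<bar> * \<bar>s i x - \<psi> x\<bar> \<le> \<bar>C\<bar> * \<bar>s i x - \<psi> x\<bar>" by (rule mult_right_mono) simp
      then show "\<bar>k n x * \<psi> x - k n x * s i x\<bar> \<le> \<bar>C\<bar> * \<bar>s i x - \<psi> x\<bar>"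
        by (simp add: abs_mult[symmetric] right_diff_distrib abs_minus_commute)
    qed
    also have "\<dots> = \<bar>C\<bar> * (\<integral>x. \<bar>s i x - \<psi> x\<bar> \<partial>M)" by simp
    finally show "norm ((\<integral>x. k n x * \<psi> x \<partial>M) - 0) < e" using i N[OF n] by simp
  qed
qed

text \<open>Linear combinations and dominated limits of indicators give all of L1, and the pairing
  respects both.\<close>

lemma weakly_null_sets:
  fixes k :: "nat \<Rightarrow> 'a \<Rightarrow> real"
  assumes fin: "finite_measure M"
    and k: "\<And>n. k n \<in> borel_measurable M" "\<And>n x. x \<in> space M \<Longrightarrow> \<bar>k n x\<bar> \<le> C"
    and E: "\<And>E. E \<in> sets M \<Longrightarrow> (\<lambda>n. \<integral>x. k n x * indicator E x \<partial>M) \<longlonglongrightarrow> 0"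
  shows "weakly_null M k"
  unfolding weakly_null_def
proof (intro allI impI)
  fix \<psi> :: "'a \<Rightarrow> real" assume "integrable M \<psi>"
  then show "(\<lambda>n. \<integral>x. k n x * \<psi> x \<partial>M) \<longlonglongrightarrow> 0"
  proof (induction rule: integrable_induct)
    case (base A c)
    from tendsto_mult_left_zero[OF E[OF base(1)], of c] show ?case by (simp add: mult.assoc[symmetric])
  next
    case (add f g)
    have "(\<integral>x. k n x * (f x + g x) \<partial>M) = (\<integral>x. k n x * f x \<partial>M) + (\<integral>x. k n x * g x \<partial>M)" for n
      using integrable_bounded_mult(1)[OF k add.hyps(1)] integrable_bounded_mult(1)[OF k add.hyps(2)]
      by (simp add: distrib_left)
    with tendsto_add[OF add.IH] show ?case by simp
  next
    case (lim f s)
    show ?case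
      by (rule weak_limit_in_L1[OF k lim.hyps(1) lim.IH lim.hyps(2), where g = "\<lambda>x. 2 * \<bar>f x\<bar>"]) (use lim in auto)
  qed
qed

text \<open>Dynkin's argument. Complements call for the total integral, hence \<open>U\<close>
  beside \<open>E\<close>. A countable disjoint union is an L1 limit of finite ones, so the limit in
  n survives although it is not uniform in the set.\<close>

lemma weakly_null_generator:
  fixes k :: "nat \<Rightarrow> 'a \<Rightarrow> real"
  assumes fin: "finite_measure M"
    and k: "\<And>n. k n \<in> borel_measurable M" "\<And>n x. x \<in> space M \<Longrightarrow> \<bar>k n x\<bar> \<le> C"
    and G: "Int_stable G" "G \<subseteq> Pow (space M)" "sets M = sigma_sets (space M) G"
    and E: "\<And>E. E \<in> G \<Longrightarrow> (\<lambda>n. \<integral>x. k n x * indicator E x \<partial>M) \<longlonglongrightarrow> 0"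
    and U: "(\<lambda>n. \<integral>x. k n x \<partial>M) \<longlonglongrightarrow> 0"
  shows "weakly_null M k"
proof (rule weakly_null_sets[OF fin k])
  interpret finite_measure M by fact
  have ik: "integrable M (\<lambda>x. k n x * indicator E x)" if "E \<in> sets M" for E n
    using that by (intro integrable_bounded_mult(1)[OF k]) (auto simp: emeasure_finite less_top[symmetric])
  fix E assume "E \<in> sets M"
  with G(3) have "E \<in> sigma_sets (space M) G" by simp
  from G(1,2) this show "(\<lambda>n. \<integral>x. k n x * indicator E x \<partial>M) \<longlonglongrightarrow> 0"
  proof (induction rule: sigma_sets_induct_disjoint)
    case (basic A) then show ?case by (rule E)
  next
    case empty show ?case by simp
  next
    case (compl A)
    have A: "A \<in> sets M" using compl(1) G(3) by simp
    have "(\<integral>x. k n x * indicator (space M - A) x \<partial>M) = (\<integral>x. k n x * indicator (space M) x - k n x * indicator A x \<partial>M)" for n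
      by (intro Bochner_Integration.integral_cong) (auto simp: indicator_def)
    moreover have "(\<integral>x. k n x * indicator (space M) x - k n x * indicator A x \<partial>M)
        = (\<integral>x. k n x * indicator (space M) x \<partial>M) - (\<integral>x. k n x * indicator A x \<partial>M)" for n
      using ik A by (intro Bochner_Integration.integral_diff) auto
    moreover have "(\<integral>x. k n x * indicator (space M) x \<partial>M) = (\<integral>x. k n x \<partial>M)" for n
      by (intro Bochner_Integration.integral_cong) auto
    ultimately show ?case using tendsto_diff[OF U compl(2)] by simp
  next
    case (union A)
    have A: "A i \<in> sets M" for i using union(2) G(3) by auto
    let ?B = "\<lambda>m. \<Union>i<m. A i"
    have B: "?B m \<in> sets M" for m using A by auto
    have UA: "(\<Union>i. A i) \<in> sets M" using A by auto
    have ind: "indicator (?B m) x = (\<Sum>i<m. indicator (A i) x :: real)" for m x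
      by (rule indicator_UN_disjoint) (use union(1) in \<open>auto simp: disjoint_family_on_def\<close>)
    show ?case
    proof (rule weak_limit_in_L1[OF k, where s = "\<lambda>m. indicator (?B m)" and g = "\<lambda>_. 1"])
      show "integrable M (indicator (?B m) :: 'a \<Rightarrow> real)" for m
        using B by (auto simp: emeasure_finite less_top[symmetric])
      show "integrable M (indicator (\<Union>i. A i) :: 'a \<Rightarrow> real)"
        using UA by (auto simp: emeasure_finite less_top[symmetric])
      show "(\<lambda>n. \<integral>x. k n x * indicator (?B m) x \<partial>M) \<longlonglongrightarrow> 0" for m
      proof -
        have "(\<integral>x. k n x * indicator (?B m) x \<partial>M) = (\<Sum>i<m. \<integral>x. k n x * indicator (A i) x \<partial>M)" for n
          unfolding ind sum_distrib_left using ik[OF A] by (rule Bochner_Integration.integral_sum)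
        then show ?thesis using union(3) by (simp add: tendsto_null_sum)
      qed
      show "(\<lambda>m. indicator (?B m) x :: real) \<longlonglongrightarrow> indicator (\<Union>i. A i) x" for x
        by (rule LIMSEQ_indicator_UN)
    qed (auto simp: indicator_def)
  qed
qed

section \<open>The uniform law and periodic functions\<close>

text \<open>A law on the whole Borel line, so that translations and reflections need no domain.
  \<open>distr_interval_measure\<close> links it to the law on the restricted space that occurs in
  the definition of mixing.\<close>

abbreviation unif :: "real \<Rightarrow> real measure" where
  "unif p \<equiv> uniform_measure lborel {0..p}"

lemma emeasure_unif_UNIV: "0 < p \<Longrightarrow> emeasure (unif p) UNIV = 1"
  by (simp add: emeasure_uniform_measure_1 flip: ennreal_1 space_lborel)

lemma finite_measure_unif: "0 < p \<Longrightarrow> finite_measure (unif p)"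
  using emeasure_unif_UNIV[of p] by (intro finite_measureI) simp

lemma nn_integral_unif:
  assumes "0 < p" "f \<in> borel_measurable borel"
  shows "(\<integral>\<^sup>+x. f x \<partial>unif p) = (\<integral>\<^sup>+x. f x * indicator {0..p} x \<partial>lborel) / ennreal p"
  using assms by (simp add: nn_integral_uniform_measure)

lemma unif_eq_density:
  assumes "0 < p" shows "unif p = density lborel (\<lambda>x. ennreal (indicator {0..p} x / p))"
  unfolding uniform_measure_def using assms
  by (intro density_cong AE_I2) (auto simp: indicator_def ennreal_1 divide_ennreal[symmetric])

lemma integral_unif:
  fixes f :: "real \<Rightarrow> real"
  assumes "0 < p" "f \<in> borel_measurable borel"
  shows "(\<integral>x. f x \<partial>unif p) = (\<integral>x. f x * indicator {0..p} x \<partial>lborel) / p"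
proof -
  have "(\<integral>x. f x \<partial>unif p) = (\<integral>x. (indicator {0..p} x / p) *\<^sub>R f x \<partial>lborel)"
    unfolding unif_eq_density[OF assms(1)] using assms by (intro integral_density) auto
  also have "\<dots> = (\<integral>x. f x * indicator {0..p} x / p \<partial>lborel)"
    by (simp add: mult_ac)
  finally show ?thesis by simp
qed

lemma rmod_add_int: "((x::real) + of_int m * p) rmod p = x rmod p"
proof -
  have "(x + of_int m * p) rmod p = (x rmod p + (of_int m * p) rmod p) rmod p"
    by (simp only: rmod_add)
  then show ?thesis by simp
qed

lemma rmod_add_left: "((x::real) rmod p + y) rmod p = (x + y) rmod p"
  by (metis rmod_add rmod_rmod)

lemma rmod_diff_right: "((y::real) - x rmod p) rmod p = (y - x) rmod p"
  by (metis rmod_diff rmod_rmod)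

lemma borel_measurable_rmod [measurable]:
  "f \<in> borel_measurable M \<Longrightarrow> (\<lambda>x. (f x :: real) rmod p) \<in> borel_measurable M"
  unfolding rmod_def
  by (intro borel_measurable_diff borel_measurable_times borel_measurable_const
      measurable_compose[OF _ borel_measurable_real_floor] borel_measurable_divide)

lemma nn_integral_shift:
  assumes "f \<in> borel_measurable borel"
  shows "(\<integral>\<^sup>+x. f (x + t :: real) \<partial>lborel) = (\<integral>\<^sup>+x. f x \<partial>lborel)"
  using nn_integral_real_affine[OF assms, of 1 t] by (simp add: add.commute)

lemma nn_integral_flip:
  assumes "f \<in> borel_measurable borel"
  shows "(\<integral>\<^sup>+x. f (t - x :: real) \<partial>lborel) = (\<integral>\<^sup>+x. f x \<partial>lborel)"
  using nn_integral_real_affine[OF assms, of "-1" t] by simp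

context
  fixes p :: real and g :: "real \<Rightarrow> ennreal"
  assumes p: "0 < p" and g [measurable]: "g \<in> borel_measurable borel" and per: "\<And>x. g (x rmod p) = g x"
begin

lemma periodic_int: "g (x + of_int m * p) = g x"
  by (metis per rmod_add_int)

lemma nn_integral_period:
  "(\<integral>\<^sup>+x. g x * indicator {t..<t+p} x \<partial>lborel) = (\<integral>\<^sup>+x. g x * indicator {0..<p} x \<partial>lborel)"
proof -
  have shift: "(\<integral>\<^sup>+x. g x * indicator {a + of_int m * p..<b + of_int m * p} x \<partial>lborel)
      = (\<integral>\<^sup>+x. g x * indicator {a..<b} x \<partial>lborel)" for a b m
    by (subst nn_integral_shift[where t = "of_int m * p", symmetric])
       (auto intro!: nn_integral_cong simp: periodic_int indicator_def)
  define t0 where "t0 = t rmod p"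
  have t0: "0 \<le> t0" "t0 < p" using p by (auto simp: t0_def rmod_nonneg rmod_less)
  have t: "t = t0 + of_int \<lfloor>t / p\<rfloor> * p" using p by (simp add: t0_def rmod_def)
  have "(\<integral>\<^sup>+x. g x * indicator {t..<t+p} x \<partial>lborel) = (\<integral>\<^sup>+x. g x * indicator {t0..<t0+p} x \<partial>lborel)"
    using shift[of t0 "\<lfloor>t / p\<rfloor>" "t0 + p"] t by (simp add: add_ac)
  \<comment> \<open>Only the piece \<open>[p, t0 + p)\<close> sticks out of the period; moved back
    by p it fills \<open>[0, t0)\<close>.\<close>
  also have "\<dots> = (\<integral>\<^sup>+x. g x * indicator {t0..<p} x + g x * indicator {0 + of_int 1 * p..<t0 + of_int 1 * p} x \<partial>lborel)"
    using t0 by (intro nn_integral_cong) (auto simp: indicator_def)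
  also have "\<dots> = (\<integral>\<^sup>+x. g x * indicator {t0..<p} x \<partial>lborel) + (\<integral>\<^sup>+x. g x * indicator {0..<t0} x \<partial>lborel)"
    by (subst nn_integral_add) (auto simp only: shift, measurable)
  also have "\<dots> = (\<integral>\<^sup>+x. g x * indicator {t0..<p} x + g x * indicator {0..<t0} x \<partial>lborel)"
    by (subst nn_integral_add) auto
  also have "\<dots> = (\<integral>\<^sup>+x. g x * indicator {0..<p} x \<partial>lborel)"
    using t0 by (intro nn_integral_cong) (auto simp: indicator_def)
  finally show ?thesis .
qed

lemma nn_integral_unif_period:
  "(\<integral>\<^sup>+x. g x \<partial>unif p) = (\<integral>\<^sup>+x. g x * indicator {t..t+p} x \<partial>lborel) / ennreal p"
proof -
  have ae: "(\<integral>\<^sup>+x. g x * indicator {s..s+p} x \<partial>lborel) = (\<integral>\<^sup>+x. g x * indicator {s..<s+p} x \<partial>lborel)" for s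
    using AE_lborel_singleton[of "s + p"]
    by (intro nn_integral_cong_AE) (auto elim!: eventually_mono simp: indicator_def)
  show ?thesis using p ae[of 0] by (simp add: nn_integral_unif ae nn_integral_period)
qed

lemma nn_integral_unif_shift: "(\<integral>\<^sup>+x. g (x + t) \<partial>unif p) = (\<integral>\<^sup>+x. g x \<partial>unif p)"
proof -
  have "(\<integral>\<^sup>+x. g (x + t) \<partial>unif p) = (\<integral>\<^sup>+x. g (x + t) * indicator {0..p} x \<partial>lborel) / ennreal p"
    using p by (intro nn_integral_unif) auto
  also have "(\<integral>\<^sup>+x. g (x + t) * indicator {0..p} x \<partial>lborel) = (\<integral>\<^sup>+x. g (x + t) * indicator {t..t+p} (x + t) \<partial>lborel)"
    by (intro nn_integral_cong) (auto simp: indicator_def)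
  also have "\<dots> = (\<integral>\<^sup>+x. g x * indicator {t..t+p} x \<partial>lborel)"
    by (rule nn_integral_shift) auto
  finally show ?thesis by (simp only: nn_integral_unif_period[of t])
qed

lemma nn_integral_unif_flip: "(\<integral>\<^sup>+x. g (t - x) \<partial>unif p) = (\<integral>\<^sup>+x. g x \<partial>unif p)"
proof -
  have "(\<integral>\<^sup>+x. g (t - x) \<partial>unif p) = (\<integral>\<^sup>+x. g (t - x) * indicator {0..p} x \<partial>lborel) / ennreal p"
    using p by (intro nn_integral_unif) auto
  also have "(\<integral>\<^sup>+x. g (t - x) * indicator {0..p} x \<partial>lborel) = (\<integral>\<^sup>+x. g (t - x) * indicator {t-p..t-p+p} (t - x) \<partial>lborel)"
    by (intro nn_integral_cong) (auto simp: indicator_def)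
  also have "\<dots> = (\<integral>\<^sup>+x. g x * indicator {t-p..t-p+p} x \<partial>lborel)"
    by (rule nn_integral_flip) auto
  finally show ?thesis by (simp only: nn_integral_unif_period[of "t - p"])
qed

end

lemma distr_unif_rotation:
  assumes p: "0 < p"
  shows "distr (unif p) borel (\<lambda>x. (x + t) rmod p) = unif p"
proof (rule measure_eqI)
  fix A assume "A \<in> sets (distr (unif p) borel (\<lambda>x. (x + t) rmod p))"
  then have [measurable]: "A \<in> sets borel" by simp
  let ?g = "\<lambda>x. indicator A (x rmod p) :: ennreal"
  have "emeasure (distr (unif p) borel (\<lambda>x. (x + t) rmod p)) A = (\<integral>\<^sup>+x. ?g (x + t) \<partial>unif p)"
    by (subst nn_integral_indicator[symmetric]) (auto simp: nn_integral_distr simp del: nn_integral_indicator)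
  also have "\<dots> = (\<integral>\<^sup>+x. ?g x \<partial>unif p)"
    using p by (intro nn_integral_unif_shift) auto
  also have "\<dots> = (\<integral>\<^sup>+x. indicator A x \<partial>unif p)"
  proof (rule nn_integral_cong_AE)
    \<comment> \<open>On \<open>[0, p]\<close> the reduction modulo p moves only the endpoint
      p.\<close>
    show "AE x in unif p. ?g x = indicator A x"
      using p AE_lborel_singleton[of p]
      by (subst AE_uniform_measure) (auto elim!: eventually_mono)
  qed
  finally show "emeasure (distr (unif p) borel (\<lambda>x. (x + t) rmod p)) A = emeasure (unif p) A"
    by simp
qed simp

lemma integral_unif_rotation:
  fixes w :: "real \<Rightarrow> real"
  assumes p: "0 < p" and [measurable]: "w \<in> borel_measurable borel"
  shows "(\<integral>x. w ((x + t) rmod p) \<partial>unif p) = (\<integral>x. w x \<partial>unif p)"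
  by (subst (2) distr_unif_rotation[OF p, of t, symmetric], subst integral_distr) auto

lemma Fubini_bounded:
  fixes f :: "'a \<times> 'b \<Rightarrow> real"
  assumes "finite_measure M" "finite_measure N"
    and f: "f \<in> borel_measurable (M \<Otimes>\<^sub>M N)" "\<And>z. z \<in> space (M \<Otimes>\<^sub>M N) \<Longrightarrow> \<bar>f z\<bar> \<le> C"
  shows "integrable (M \<Otimes>\<^sub>M N) f"
    and "(\<integral>z. f z \<partial>(M \<Otimes>\<^sub>M N)) = (\<integral>x. \<integral>y. f (x, y) \<partial>N \<partial>M)"
    and "(\<integral>z. f z \<partial>(M \<Otimes>\<^sub>M N)) = (\<integral>y. \<integral>x. f (x, y) \<partial>M \<partial>N)"
proof -
  interpret M: finite_measure M by fact
  interpret N: finite_measure N by fact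
  interpret P: pair_sigma_finite M N ..
  interpret MN: finite_measure "M \<Otimes>\<^sub>M N" by (rule finite_measure_pair_measure) fact+
  show i: "integrable (M \<Otimes>\<^sub>M N) f"
    using f by (intro MN.integrable_const_bound[of _ C] AE_I2) auto
  show "(\<integral>z. f z \<partial>(M \<Otimes>\<^sub>M N)) = (\<integral>x. \<integral>y. f (x, y) \<partial>N \<partial>M)"
    using P.integral_fst'[OF i] by simp
  show "(\<integral>z. f z \<partial>(M \<Otimes>\<^sub>M N)) = (\<integral>y. \<integral>x. f (x, y) \<partial>M \<partial>N)"
    using P.integral_snd[of "\<lambda>x y. f (x, y)"] i by simp
qed

section \<open>Null sequences of nonnegative integrals\<close>

lemma ennreal_null_le:
  fixes f g :: "nat \<Rightarrow> ennreal"
  assumes "g \<longlonglongrightarrow> 0" "\<And>n. f n \<le> g n" shows "f \<longlonglongrightarrow> 0"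
  by (rule tendsto_sandwich[of "\<lambda>_. 0" f sequentially g]) (use assms in auto)

lemma ennreal_null_add:
  fixes f g :: "nat \<Rightarrow> ennreal"
  assumes "f \<longlonglongrightarrow> 0" "g \<longlonglongrightarrow> 0" shows "(\<lambda>n. f n + g n) \<longlonglongrightarrow> 0"
  using tendsto_add[OF assms] by simp

lemma ennreal_null_cmult:
  fixes f :: "nat \<Rightarrow> ennreal"
  assumes "f \<longlonglongrightarrow> 0" "c < \<infinity>" shows "(\<lambda>n. c * f n) \<longlonglongrightarrow> 0"
  using ennreal_tendsto_cmult[of c f 0 sequentially] assms by simp

lemma null_of_nn_integral_null:
  fixes f :: "nat \<Rightarrow> 'a \<Rightarrow> real"
  assumes f: "\<And>n. integrable M (f n)" and null: "(\<lambda>n. \<integral>\<^sup>+x. ennreal \<bar>f n x\<bar> \<partial>M) \<longlonglongrightarrow> 0"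
  shows "(\<lambda>n. \<integral>x. f n x \<partial>M) \<longlonglongrightarrow> 0"
proof (rule tendsto_rabs_zero_cancel, rule tendsto_sandwich[of "\<lambda>_. 0"])
  have eq: "(\<integral>\<^sup>+x. ennreal \<bar>f n x\<bar> \<partial>M) = ennreal (\<integral>x. \<bar>f n x\<bar> \<partial>M)" for n
    using f by (intro nn_integral_eq_integral) auto
  show "(\<lambda>n. \<integral>x. \<bar>f n x\<bar> \<partial>M) \<longlonglongrightarrow> 0"
    using null unfolding eq ennreal_0[symmetric] by (subst (asm) tendsto_ennreal_iff) auto
qed (auto intro!: always_eventually integral_abs_bound)

lemma ennreal_abs_triangle: "ennreal \<bar>a - c\<bar> \<le> ennreal \<bar>a - b\<bar> + ennreal \<bar>b - c\<bar>"
proof -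
  have "ennreal \<bar>a - c\<bar> \<le> ennreal (\<bar>a - b\<bar> + \<bar>b - c\<bar>)" by (intro ennreal_leI) linarith
  then show ?thesis by (simp add: ennreal_plus)
qed

lemma ennreal_abs_triangle3:
  "ennreal \<bar>a - d\<bar> \<le> ennreal \<bar>a - b\<bar> + (ennreal \<bar>b - c\<bar> + ennreal \<bar>c - d\<bar>)"
  by (rule order_trans[OF ennreal_abs_triangle[of a d b] add_left_mono[OF ennreal_abs_triangle]])

section \<open>Asymptotic invariance under an infinite dihedral group\<close>

text \<open>The translation by p and the reflections in u and v act on the line, while H is
  controlled on \<open>[0, l]\<close> only; invariance is asked in L1 where both points stay inside.
  The window of length p about a centre of reflection is one full period, which suffices once
  everything is wrapped modulo p. The last assumption says that the product of the reflections is
  incommensurable with p.\<close>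

locale asymptotically_dihedral =
  fixes H :: "nat \<Rightarrow> real \<Rightarrow> real" and C p l u v :: real
  assumes meas [measurable]: "\<And>n. H n \<in> borel_measurable borel"
    and bound: "\<And>n x. \<bar>H n x\<bar> \<le> C"
    and p: "0 < p" "p \<le> l"
    and transl: "(\<lambda>n. \<integral>\<^sup>+x\<in>{0..l-p}. ennreal \<bar>H n (x + p) - H n x\<bar> \<partial>lborel) \<longlonglongrightarrow> 0"
    and refl_u: "(\<lambda>n. \<integral>\<^sup>+x\<in>{u-p/2..u+p/2}. ennreal \<bar>H n (2 * u - x) - H n x\<bar> \<partial>lborel) \<longlonglongrightarrow> 0"
    and refl_v: "(\<lambda>n. \<integral>\<^sup>+x\<in>{v-p/2..v+p/2}. ennreal \<bar>H n (2 * v - x) - H n x\<bar> \<partial>lborel) \<longlonglongrightarrow> 0"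
    and u: "p/2 \<le> u" "u + p/2 \<le> l" and v: "p/2 \<le> v" "v + p/2 \<le> l"
    and irrational: "2 * (v - u) / p \<notin> \<rat>"
begin

text \<open>Built from the values of H on \<open>[0, p)\<close> alone and exactly periodic: the
  translations become exact, and reflections can be composed on the circle without leaving the
  domain.\<close>

definition K :: "nat \<Rightarrow> real \<Rightarrow> real" where "K n x = H n (x rmod p)"

lemma K_measurable [measurable]: "K n \<in> borel_measurable borel"
  unfolding K_def by measurable

lemma K_bound: "\<bar>K n x\<bar> \<le> C" by (simp add: K_def bound)

lemma K_rmod: "K n (x rmod p + t) = K n (x + t)" "K n (t + x rmod p) = K n (t + x)"
  "K n (t - x rmod p) = K n (t - x)" "K n (x rmod p) = K n x"
  by (simp_all add: K_def rmod_add_left rmod_diff_right add.commute[of t])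

text \<open>Induction on the number j of periods: on the next period H is replaced by its translate,
  at the price of one translation defect, and the translate is covered by the previous stage because
  K is periodic. Finitely many stages reach l.\<close>

lemma K_near_H: "(\<lambda>n. \<integral>\<^sup>+x\<in>{0..l}. ennreal \<bar>H n x - K n x\<bar> \<partial>lborel) \<longlonglongrightarrow> 0"
proof -
  have *: "(\<lambda>n. \<integral>\<^sup>+x\<in>{x\<in>{0..l}. x < real j * p}. ennreal \<bar>H n x - K n x\<bar> \<partial>lborel) \<longlonglongrightarrow> 0" for j
  proof (induction j)
    case 0
    have "{x\<in>{0..l}. x < real 0 * p} = {}" by auto
    then show ?case by (simp only:) simp
  next
    case (Suc j)
    let ?A = "{x\<in>{0..l}. x < real j * p}" and ?B = "{x\<in>{0..l}. x < real (Suc j) * p}"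
    let ?f = "\<lambda>n x. ennreal \<bar>H n (x + p) - H n x\<bar> * indicator {0..l-p} x + ennreal \<bar>H n x - K n x\<bar> * indicator ?A x"
    have [measurable]: "?A \<in> sets borel" "?B \<in> sets borel" by simp_all
    show ?case
    proof (rule ennreal_null_le)
      show "(\<lambda>n. (\<integral>\<^sup>+x\<in>{0..l-p}. ennreal \<bar>H n (x + p) - H n x\<bar> \<partial>lborel) + (\<integral>\<^sup>+x\<in>?A. ennreal \<bar>H n x - K n x\<bar> \<partial>lborel)) \<longlonglongrightarrow> 0"
        by (rule ennreal_null_add[OF transl Suc])
      fix n
      have "(\<integral>\<^sup>+x\<in>?B. ennreal \<bar>H n x - K n x\<bar> \<partial>lborel) \<le> (\<integral>\<^sup>+x. ?f n (x + (-p)) \<partial>lborel)"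
      proof (rule nn_integral_mono)
        fix x :: real
        show "ennreal \<bar>H n x - K n x\<bar> * indicator ?B x \<le> ?f n (x + (-p))"
        proof (cases "x \<in> ?B \<and> p \<le> x")
          case True
          have "K n (x - p) = K n x" using rmod_add_int[of x "-1" p] by (simp add: K_def)
          then have "ennreal \<bar>H n x - K n x\<bar> \<le> ennreal \<bar>H n x - H n (x - p)\<bar> + ennreal \<bar>H n (x - p) - K n (x - p)\<bar>"
            by (simp only: ennreal_abs_triangle)
          moreover have "x - p \<in> ?A" "x - p \<in> {0..l-p}" using True p by (auto simp: distrib_right)
          moreover have "x \<in> ?B" "x + - p = x - p" "x - p + p = x" using True by auto
          ultimately show ?thesis by (simp only: indicator_simps mult_1_right)
        next
          case False
          have "H n x = K n x" if "x \<in> ?B"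
          proof -
            have "x \<in> {0..<\<bar>p\<bar>}" using that False p(1) by auto
            then show ?thesis unfolding K_def by (simp only: rmod_idem)
          qed
          then show ?thesis by (cases "x \<in> ?B") (simp_all del: mem_Collect_eq)
        qed
      qed
      also have "\<dots> = (\<integral>\<^sup>+x. ?f n x \<partial>lborel)" by (rule nn_integral_shift[of "?f n" "-p"]) measurable
      also have "\<dots> = (\<integral>\<^sup>+x\<in>{0..l-p}. ennreal \<bar>H n (x + p) - H n x\<bar> \<partial>lborel) + (\<integral>\<^sup>+x\<in>?A. ennreal \<bar>H n x - K n x\<bar> \<partial>lborel)"
        by (rule nn_integral_add; measurable)
      finally show "(\<integral>\<^sup>+x\<in>?B. ennreal \<bar>H n x - K n x\<bar> \<partial>lborel) \<le> \<dots>" .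
    qed
  qed
  obtain j :: nat where "l / p < real j" using reals_Archimedean2 by blast
  then have "l < real j * p" using p(1) by (simp add: divide_less_eq)
  then have "{x\<in>{0..l}. x < real j * p} = {0..l}" by auto
  with *[of j] show ?thesis by (simp only:)
qed

text \<open>The window about r is a full period, so integrating over it is integrating over the
  circle. On it both x and its mirror image lie in \<open>[0, l]\<close>, where H and K agree up to
  a null sequence.\<close>

lemma K_reflection:
  assumes r: "(\<lambda>n. \<integral>\<^sup>+x\<in>{r-p/2..r+p/2}. ennreal \<bar>H n (2 * r - x) - H n x\<bar> \<partial>lborel) \<longlonglongrightarrow> 0"
    "p/2 \<le> r" "r + p/2 \<le> l"
  shows "(\<lambda>n. \<integral>\<^sup>+x. ennreal \<bar>K n (2 * r - x) - K n x\<bar> \<partial>unif p) \<longlonglongrightarrow> 0"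
proof (rule ennreal_null_le)
  let ?I = "{r-p/2..r+p/2}"
  let ?HK = "\<lambda>n. \<integral>\<^sup>+x\<in>{0..l}. ennreal \<bar>H n x - K n x\<bar> \<partial>lborel"
  let ?R = "\<lambda>n. \<integral>\<^sup>+x\<in>?I. ennreal \<bar>H n (2 * r - x) - H n x\<bar> \<partial>lborel"
  show "(\<lambda>n. ennreal (1/p) * (?HK n + (?R n + ?HK n))) \<longlonglongrightarrow> 0"
    by (intro ennreal_null_cmult ennreal_null_add K_near_H r) auto
  fix n
  define h where "h x = ennreal \<bar>H n x - K n x\<bar> * indicator {0..l} x" for x
  define q where "q x = ennreal \<bar>H n (2 * r - x) - H n x\<bar> * indicator ?I x" for x
  have [measurable]: "h \<in> borel_measurable borel" "q \<in> borel_measurable borel"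
    unfolding h_def q_def by measurable
  have I: "{r-p/2..r-p/2+p} = ?I" by simp
  have "(\<integral>\<^sup>+x. ennreal \<bar>K n (2 * r - x) - K n x\<bar> \<partial>unif p)
      = (\<integral>\<^sup>+x\<in>{r-p/2..r-p/2+p}. ennreal \<bar>K n (2 * r - x) - K n x\<bar> \<partial>lborel) / ennreal p"
    using p by (intro nn_integral_unif_period[where g = "\<lambda>x. ennreal \<bar>K n (2 * r - x) - K n x\<bar>"]) (auto simp: K_rmod)
  note 1 = this[unfolded I]
  have "(\<integral>\<^sup>+x\<in>?I. ennreal \<bar>K n (2 * r - x) - K n x\<bar> \<partial>lborel)
      \<le> (\<integral>\<^sup>+x. h (2 * r - x) + (q x + h x) \<partial>lborel)"
  proof (rule nn_integral_mono)
    fix x :: real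
    have "ennreal \<bar>K n (2 * r - x) - K n x\<bar> \<le> ennreal \<bar>K n (2 * r - x) - H n (2 * r - x)\<bar>
      + (ennreal \<bar>H n (2 * r - x) - H n x\<bar> + ennreal \<bar>H n x - K n x\<bar>)"
      by (rule ennreal_abs_triangle3)
    moreover have "2 * r - x \<in> {0..l}" "x \<in> {0..l}" if "x \<in> ?I" using that r p by auto
    ultimately show "ennreal \<bar>K n (2 * r - x) - K n x\<bar> * indicator ?I x \<le> h (2 * r - x) + (q x + h x)"
      unfolding h_def q_def by (cases "x \<in> ?I") (simp_all add: abs_minus_commute)
  qed
  also have "\<dots> = (\<integral>\<^sup>+x. h (2 * r - x) \<partial>lborel) + ((\<integral>\<^sup>+x. q x \<partial>lborel) + (\<integral>\<^sup>+x. h x \<partial>lborel))"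
  proof -
    have "(\<lambda>x. h (2 * r - x)) \<in> borel_measurable lborel" "(\<lambda>x. q x + h x) \<in> borel_measurable lborel"
      "q \<in> borel_measurable lborel" "h \<in> borel_measurable lborel" by measurable
    then show ?thesis by (simp only: nn_integral_add)
  qed
  also have "(\<integral>\<^sup>+x. h (2 * r - x) \<partial>lborel) = (\<integral>\<^sup>+x. h x \<partial>lborel)"
    by (rule nn_integral_flip) measurable
  finally have 2: "(\<integral>\<^sup>+x\<in>?I. ennreal \<bar>K n (2 * r - x) - K n x\<bar> \<partial>lborel) \<le> ?HK n + (?R n + ?HK n)"
    unfolding h_def q_def .
  show "(\<integral>\<^sup>+x. ennreal \<bar>K n (2 * r - x) - K n x\<bar> \<partial>unif p) \<le> ennreal (1/p) * (?HK n + (?R n + ?HK n))"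
  proof -
    have "x / ennreal p = ennreal (1/p) * x" for x
      using p by (simp add: divide_ennreal_def mult.commute inverse_ennreal inverse_eq_divide)
    then show ?thesis unfolding 1 by (simp only:) (rule mult_left_mono[OF 2], simp)
  qed
qed

text \<open>Reflecting in u and then in v is translation by 2 (v - u). Each reflection preserves the
  uniform law of the circle, so the defects just add up over j.\<close>

lemma K_translation:
  "(\<lambda>n. \<integral>\<^sup>+x. ennreal \<bar>K n (x + real j * (2 * (v - u))) - K n x\<bar> \<partial>unif p) \<longlonglongrightarrow> 0"
proof (induction j)
  case 0 then show ?case by simp
next
  case (Suc j)
  let ?d = "2 * (v - u)"
  let ?N = "\<lambda>r n. \<integral>\<^sup>+x. ennreal \<bar>K n (2 * r - x) - K n x\<bar> \<partial>unif p"
  let ?J = "\<lambda>n. \<integral>\<^sup>+x. ennreal \<bar>K n (x + real j * ?d) - K n x\<bar> \<partial>unif p"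
  show ?case
  proof (rule ennreal_null_le)
    show "(\<lambda>n. ?J n + (?N v n + ?N u n)) \<longlonglongrightarrow> 0"
      by (intro ennreal_null_add K_reflection Suc refl_u refl_v u v)
    fix n
    have "(\<integral>\<^sup>+x. ennreal \<bar>K n (x + real (Suc j) * ?d) - K n x\<bar> \<partial>unif p)
       \<le> (\<integral>\<^sup>+x. ennreal \<bar>K n ((x + ?d) + real j * ?d) - K n (x + ?d)\<bar>
          + (ennreal \<bar>K n (2 * v - (2 * u - x)) - K n (2 * u - x)\<bar> + ennreal \<bar>K n (2 * u - x) - K n x\<bar>) \<partial>unif p)"
    proof (rule nn_integral_mono)
      fix x
      have e: "x + real (Suc j) * ?d = (x + ?d) + real j * ?d" "2 * v - (2 * u - x) = x + ?d"
        by (simp_all add: algebra_simps)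
      show "ennreal \<bar>K n (x + real (Suc j) * ?d) - K n x\<bar> \<le> ennreal \<bar>K n ((x + ?d) + real j * ?d) - K n (x + ?d)\<bar>
          + (ennreal \<bar>K n (2 * v - (2 * u - x)) - K n (2 * u - x)\<bar> + ennreal \<bar>K n (2 * u - x) - K n x\<bar>)"
        unfolding e by (rule ennreal_abs_triangle3)
    qed
    also have "\<dots> = (\<integral>\<^sup>+x. ennreal \<bar>K n ((x + ?d) + real j * ?d) - K n (x + ?d)\<bar> \<partial>unif p)
       + ((\<integral>\<^sup>+x. ennreal \<bar>K n (2 * v - (2 * u - x)) - K n (2 * u - x)\<bar> \<partial>unif p) + ?N u n)"
    proof -
      have "(\<lambda>x. ennreal \<bar>K n ((x + ?d) + real j * ?d) - K n (x + ?d)\<bar>) \<in> borel_measurable (unif p)"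
        "(\<lambda>x. ennreal \<bar>K n (2 * v - (2 * u - x)) - K n (2 * u - x)\<bar>) \<in> borel_measurable (unif p)"
        "(\<lambda>x. ennreal \<bar>K n (2 * u - x) - K n x\<bar>) \<in> borel_measurable (unif p)"
        by measurable
      then show ?thesis by (simp only: nn_integral_add borel_measurable_add)
    qed
    also have "(\<integral>\<^sup>+x. ennreal \<bar>K n ((x + ?d) + real j * ?d) - K n (x + ?d)\<bar> \<partial>unif p) = ?J n"
      using p by (intro nn_integral_unif_shift[where g = "\<lambda>x. ennreal \<bar>K n (x + real j * ?d) - K n x\<bar>"]) (auto simp: K_rmod)
    also have "(\<integral>\<^sup>+x. ennreal \<bar>K n (2 * v - (2 * u - x)) - K n (2 * u - x)\<bar> \<partial>unif p) = ?N v n"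
      using p by (intro nn_integral_unif_flip[where g = "\<lambda>x. ennreal \<bar>K n (2 * v - x) - K n x\<bar>"]) (auto simp: K_rmod)
    finally show "(\<integral>\<^sup>+x. ennreal \<bar>K n (x + real (Suc j) * ?d) - K n x\<bar> \<partial>unif p) \<le> ?J n + (?N v n + ?N u n)" .
  qed
qed

end

text \<open>Covering \<open>[0, a]\<close> by m whole periods carries null sequences on the circle
  over to windows of any length.\<close>

lemma nn_integral_unif_le:
  assumes p: "0 < p" "0 < a" "a \<le> real m * p" and [measurable]: "g \<in> borel_measurable borel"
    and per: "\<And>x. g (x rmod p) = g x"
  shows "(\<integral>\<^sup>+x. g x \<partial>unif a) \<le> ennreal (real m * p / a) * (\<integral>\<^sup>+x. g x \<partial>unif p)"
proof -
  let ?I = "\<integral>\<^sup>+x. g x * indicator {0..<p} x \<partial>lborel"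
  have 1: "(\<integral>\<^sup>+x. g x * indicator {0..<real m * p} x \<partial>lborel) = of_nat m * ?I"
  proof (induction m)
    case 0 then show ?case by simp
  next
    case (Suc m)
    have "(\<integral>\<^sup>+x. g x * indicator {0..<real (Suc m) * p} x \<partial>lborel)
      = (\<integral>\<^sup>+x. g x * indicator {0..<real m * p} x + g x * indicator {real m * p..<real m * p + p} x \<partial>lborel)"
    proof -
      have "{0..<real (Suc m) * p} = {0..<real m * p} \<union> {real m * p..<real m * p + p}"
        using p(1) by (simp add: ivl_disj_un distrib_right add.commute)
      moreover have "{0..<real m * p} \<inter> {real m * p..<real m * p + p} = {}" by (rule ivl_disj_int)
      ultimately show ?thesis by (simp only: indicator_add[symmetric] distrib_left)
    qed
    also have "\<dots> = (\<integral>\<^sup>+x. g x * indicator {0..<real m * p} x \<partial>lborel)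
       + (\<integral>\<^sup>+x. g x * indicator {real m * p..<real m * p + p} x \<partial>lborel)"
      by (rule nn_integral_add; measurable)
    also have "\<dots> = of_nat (Suc m) * ?I"
      using p(1) per by (simp only: Suc nn_integral_period[of p g] assms(4)) (simp add: algebra_simps)
    finally show ?case .
  qed
  have ae: "AE x in lborel. g x * indicator {0..b} x = g x * indicator {0..<b} x" for b
    using AE_lborel_singleton[of b] by (auto elim!: eventually_mono simp: indicator_def)
  have 2: "(\<integral>\<^sup>+x. g x \<partial>unif b) = (\<integral>\<^sup>+x. g x * indicator {0..<b} x \<partial>lborel) / ennreal b" if "0 < b" for b
    using that by (simp only: nn_integral_unif assms(4) nn_integral_cong_AE[OF ae])
  have "(\<integral>\<^sup>+x. g x * indicator {0..<a} x \<partial>lborel) \<le> of_nat m * ?I"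
    unfolding 1[symmetric] using p by (intro nn_integral_mono mult_left_mono) (auto simp: indicator_def)
  then have "(\<integral>\<^sup>+x. g x \<partial>unif a) \<le> (of_nat m * ?I) / ennreal a"
    unfolding 2[OF p(2)] by (rule divide_right_mono_ennreal)
  also have "\<dots> = ennreal (real m * p / a) * (?I / ennreal p)"
  proof -
    have d: "x / ennreal b = ennreal (1 / b) * x" if "0 < b" for x b
      using that by (simp add: divide_ennreal_def mult.commute inverse_ennreal inverse_eq_divide)
    have "ennreal (real m * p / a) * ennreal (1 / p) = ennreal (1 / a) * of_nat m"
      using p by (simp add: ennreal_of_nat_eq_real_of_nat flip: ennreal_mult)
    then show ?thesis by (simp only: d p mult.assoc[symmetric])
  qed
  finally show ?thesis unfolding 2[OF p(1)] .
qed

text \<open>The windows \<open>[s, s + a]\<close> and \<open>[t, t + a]\<close> differ only within e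
  of their two ends, that is in two intervals of length 2 e.\<close>

lemma integral_indicator_shift_Lipschitz:
  fixes f :: "real \<Rightarrow> real"
  assumes [measurable]: "f \<in> borel_measurable borel" and C: "\<And>x. \<bar>f x\<bar> \<le> C"
    and t: "\<bar>s - t\<bar> \<le> e"
  shows "\<bar>(\<integral>x. f (x + s) * indicator {0..a} x \<partial>lborel) - (\<integral>x. f (x + t) * indicator {0..a} x \<partial>lborel)\<bar> \<le> 4 * C * e"
proof -
  have C0: "0 \<le> C" using C[of 0] by linarith
  have e: "0 \<le> e" using t by linarith
  have shift: "(\<integral>x. f (x + s) * indicator {0..a} x \<partial>lborel) = (\<integral>x. f x * indicator {s..s+a} x \<partial>lborel)" for s
    by (subst (2) lborel_integral_real_affine[of 1 _ s])
       (auto intro!: Bochner_Integration.integral_cong simp: indicator_def add.commute)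
  have int: "integrable lborel (\<lambda>x. f x * indicator {s..s+a} x)" for s
    using C by (intro integrable_bounded_mult(1)[where C = C]) (auto simp: emeasure_lborel_Icc_eq)
  have "\<bar>(\<integral>x. f x * indicator {s..s+a} x \<partial>lborel) - (\<integral>x. f x * indicator {t..t+a} x \<partial>lborel)\<bar>
    = \<bar>\<integral>x. f x * indicator {s..s+a} x - f x * indicator {t..t+a} x \<partial>lborel\<bar>"
    using int by simp
  also have "\<dots> \<le> (\<integral>x. \<bar>f x * indicator {s..s+a} x - f x * indicator {t..t+a} x\<bar> \<partial>lborel)"
    by (rule integral_abs_bound)
  also have "\<dots> \<le> (\<integral>x. C * indicator {t-e..t+e} x + C * indicator {t+a-e..t+a+e} x \<partial>lborel)"
  proof (rule integral_mono)
    show "integrable lborel (\<lambda>x. \<bar>f x * indicator {s..s+a} x - f x * indicator {t..t+a} x\<bar>)"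
      using int by auto
    show "integrable lborel (\<lambda>x. C * indicator {t-e..t+e} x + C * indicator {t+a-e..t+a+e} x)"
      by (auto simp: emeasure_lborel_Icc_eq)
    fix x
    show "\<bar>f x * indicator {s..s+a} x - f x * indicator {t..t+a} x\<bar>
        \<le> C * indicator {t-e..t+e} x + C * indicator {t+a-e..t+a+e} x"
      using C[of x] C0 t by (auto simp: indicator_def)
  qed
  also have "\<dots> = 4 * C * e"
    using e by (simp add: algebra_simps)
  finally show ?thesis unfolding shift .
qed

context asymptotically_dihedral
begin

lemma C_nonneg: "0 \<le> C" using bound[of 0 0] by linarith

text \<open>Sliding mean over the window \<open>[t, t + a]\<close>. Unlike K it is Lipschitz in t
  uniformly in n, so invariance under a dense set of translations extends to all of them.\<close>

definition G :: "real \<Rightarrow> nat \<Rightarrow> real \<Rightarrow> real" where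
  "G a n t = (\<integral>x. K n (x + t) \<partial>unif a)"

lemma G_multiples:
  assumes a: "0 < a"
  shows "(\<lambda>n. G a n (real j * (2 * (v - u))) - G a n 0) \<longlonglongrightarrow> 0"
proof -
  let ?s = "real j * (2 * (v - u))"
  obtain m :: nat where "a / p < real m" using reals_Archimedean2 by blast
  then have m: "a \<le> real m * p" using p(1) by (simp add: divide_less_eq)
  interpret finite_measure "unif a" using a by (rule finite_measure_unif)
  have int: "integrable (unif a) (\<lambda>x. K n (x + t))" for n t
    by (intro integrable_const_bound[of _ C] AE_I2) (auto simp: K_bound)
  have "(\<lambda>n. \<integral>x. K n (x + ?s) - K n x \<partial>unif a) \<longlonglongrightarrow> 0"
  proof (rule null_of_nn_integral_null)
    show "integrable (unif a) (\<lambda>x. K n (x + ?s) - K n x)" for n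
      using int[of n ?s] int[of n 0] by simp
    show "(\<lambda>n. \<integral>\<^sup>+x. ennreal \<bar>K n (x + ?s) - K n x\<bar> \<partial>unif a) \<longlonglongrightarrow> 0"
    proof (rule ennreal_null_le)
      show "(\<lambda>n. ennreal (real m * p / a) * (\<integral>\<^sup>+x. ennreal \<bar>K n (x + ?s) - K n x\<bar> \<partial>unif p)) \<longlonglongrightarrow> 0"
        by (intro ennreal_null_cmult K_translation) simp
      show "(\<integral>\<^sup>+x. ennreal \<bar>K n (x + ?s) - K n x\<bar> \<partial>unif a)
          \<le> ennreal (real m * p / a) * (\<integral>\<^sup>+x. ennreal \<bar>K n (x + ?s) - K n x\<bar> \<partial>unif p)" for n
        using p a m by (intro nn_integral_unif_le) (auto simp: K_rmod)
    qed
  qed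
  moreover have "(\<integral>x. K n (x + ?s) - K n x \<partial>unif a) = G a n ?s - G a n 0" for n
    using int[of n ?s] int[of n 0] by (simp add: G_def)
  ultimately show ?thesis by (simp only:)
qed

lemma G_Lipschitz:
  assumes a: "0 < a" and t: "\<bar>s - t\<bar> \<le> e"
  shows "\<bar>G a n s - G a n t\<bar> \<le> 4 * C * e / a"
proof -
  have "G a n s - G a n t = ((\<integral>x. K n (x + s) * indicator {0..a} x \<partial>lborel) - (\<integral>x. K n (x + t) * indicator {0..a} x \<partial>lborel)) / a"
    using a by (simp add: G_def integral_unif diff_divide_distrib)
  then show ?thesis
    using integral_indicator_shift_Lipschitz[of "K n" C s t e a] K_bound t a
    by (simp add: divide_right_mono)
qed

text \<open>The multiples of 2 (v - u) are dense modulo p by irrationality; \<open>G\<close> is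
  asymptotically invariant under each of them, and equicontinuity fills the gaps.\<close>

lemma G_const:
  assumes a: "0 < a"
  shows "(\<lambda>n. G a n t - G a n 0) \<longlonglongrightarrow> 0"
proof (rule LIMSEQ_I)
  fix r :: real assume r: "r > 0"
  have C0: "0 \<le> C" using K_bound[of 0 0] by linarith
  let ?d = "2 * (v - u)"
  \<comment> \<open>Chosen so that the Lipschitz error 4 C e / a is at most r / 2; the summand 1
    covers C = 0.\<close>
  define e where "e = r * a / (8 * (C + 1))"
  have e: "0 < e" using r a C0 by (simp add: e_def)
  \<comment> \<open>The sign of k matters: \<open>G_multiples\<close> speaks of natural multiples
    only. The integer h disappears by periodicity.\<close>
  obtain h k :: int where k: "k > 0" and hk: "\<bar>of_int k * (?d / p) - of_int h - t / p\<bar> < e / p"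
    using sequence_of_fractional_parts_is_dense[OF irrational divide_pos_pos[OF e p(1)], of "t / p"] by blast
  have "\<bar>of_int k * ?d - of_int h * p - t\<bar> = p * \<bar>of_int k * (?d / p) - of_int h - t / p\<bar>"
  proof -
    have "of_int k * ?d - of_int h * p - t = p * (of_int k * (?d / p) - of_int h - t / p)"
      using p(1) by (simp add: field_simps)
    then show ?thesis using p(1) by (simp only: abs_mult abs_of_pos)
  qed
  also have "\<dots> \<le> e" using hk p(1) by (simp add: field_simps)
  finally have near: "\<bar>(of_int k * ?d + of_int (-h) * p) - t\<bar> \<le> e" by simp
  have kn: "real (nat k) = of_int k" using k by simp
  have per: "G a n (of_int k * ?d + of_int (-h) * p) = G a n (real (nat k) * ?d)" for n
    unfolding G_def K_def kn by (simp only: add.assoc[symmetric] rmod_add_int)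
  have close: "\<bar>G a n (real (nat k) * ?d) - G a n t\<bar> \<le> r / 2" for n
  proof -
    have "\<bar>G a n (real (nat k) * ?d) - G a n t\<bar> \<le> 4 * C * e / a"
      unfolding per[symmetric] by (rule G_Lipschitz[OF a near])
    also have "\<dots> \<le> r / 2" proof -
      have "4 * C * e / a = r / 2 * (C / (C + 1))" using a C0 by (simp add: e_def add_nonneg_pos divide_simps)
      also have "\<dots> \<le> r / 2 * 1" using r C0 by (intro mult_left_mono) auto
      finally show ?thesis by simp
    qed
    finally show ?thesis .
  qed
  from LIMSEQ_D[OF G_multiples[OF a, of "nat k"], of "r/2"] r obtain N
    where N: "\<And>n. n \<ge> N \<Longrightarrow> \<bar>G a n (real (nat k) * ?d) - G a n 0\<bar> < r / 2" by auto
  show "\<exists>N. \<forall>n\<ge>N. norm (G a n t - G a n 0 - 0) < r"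
  proof (intro exI allI impI)
    fix n assume "n \<ge> N"
    have tri: "\<bar>y - z\<bar> < r" if "\<bar>x - y\<bar> \<le> r / 2" "\<bar>x - z\<bar> < r / 2" for x y z
      using that by linarith
    from tri[OF close[of n] N[OF \<open>n \<ge> N\<close>]] show "norm (G a n t - G a n 0 - 0) < r" by simp
  qed
qed

text \<open>Averaging \<open>G a n t\<close> over t in one period gives the mean of K, by Fubini and
  rotation invariance, while all these values are asymptotically equal to \<open>G a n 0\<close>. So
  the mean over a window approaches the mean over a period.\<close>

lemma G_average:
  assumes a: "0 < a"
  shows "(\<lambda>n. G a n 0 - (\<integral>x. K n x \<partial>unif p)) \<longlonglongrightarrow> 0"
proof -
  interpret A: finite_measure "unif a" using a by (rule finite_measure_unif)
  interpret P: finite_measure "unif p" using p(1) by (rule finite_measure_unif)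
  have G_meas [measurable]: "G a n \<in> borel_measurable borel" for n unfolding G_def by measurable
  have G_bound: "\<bar>G a n t\<bar> \<le> C" for n t
  proof -
    have "\<bar>G a n t\<bar> \<le> (\<integral>x. \<bar>K n (x + t)\<bar> \<partial>unif a)" unfolding G_def by (rule integral_abs_bound)
    also have "\<dots> \<le> (\<integral>x. C \<partial>unif a)"
      by (intro integral_mono A.integrable_const_bound[of _ C] AE_I2) (auto simp: K_bound C_nonneg)
    also have "\<dots> = C" using emeasure_unif_UNIV[OF a] by (simp add: measure_def)
    finally show ?thesis .
  qed
  have m1: "measure (unif a) UNIV = 1" "measure (unif p) UNIV = 1"
    using emeasure_unif_UNIV[OF a] emeasure_unif_UNIV[OF p(1)] by (simp_all add: measure_def)
  have Gint: "integrable (unif p) (\<lambda>t. G a n t)" for n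
    by (intro P.integrable_const_bound[of _ C] AE_I2) (auto simp: G_bound)
  have "(\<lambda>n. \<integral>t. G a n t - G a n 0 \<partial>unif p) \<longlonglongrightarrow> (\<integral>t. 0 \<partial>unif p)"
  proof (rule integral_dominated_convergence)
    show "AE t in unif p. norm (G a n t - G a n 0) \<le> 2 * C" for n
    proof (rule AE_I2)
      fix t show "norm (G a n t - G a n 0) \<le> 2 * C"
        using G_bound[of n t] G_bound[of n 0] by simp
    qed
    show "AE t in unif p. (\<lambda>n. G a n t - G a n 0) \<longlonglongrightarrow> 0" using G_const[OF a] by simp
  qed auto
  moreover have "(\<integral>t. G a n t - G a n 0 \<partial>unif p) = (\<integral>x. K n x \<partial>unif p) - G a n 0" for n
  proof -
    have "(\<integral>t. G a n t \<partial>unif p) = (\<integral>t. \<integral>x. K n (x + t) \<partial>unif a \<partial>unif p)"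
      by (simp add: G_def)
    also have "\<dots> = (\<integral>x. \<integral>t. K n (x + t) \<partial>unif p \<partial>unif a)"
      using Fubini_bounded(2,3)[of "unif p" "unif a" "\<lambda>(t, x). K n (x + t)" C] A.finite_measure_axioms P.finite_measure_axioms
      by (simp add: K_bound split: prod.splits)
    also have "\<dots> = (\<integral>x. \<integral>t. K n t \<partial>unif p \<partial>unif a)"
    proof (rule Bochner_Integration.integral_cong[OF refl])
      fix x
      have "(\<integral>t. K n (x + t) \<partial>unif p) = (\<integral>t. H n ((t + x) rmod p) \<partial>unif p)"
        by (simp add: K_def add.commute)
      also have "\<dots> = (\<integral>t. H n t \<partial>unif p)" by (rule integral_unif_rotation[OF p(1) meas])
      also have "\<dots> = (\<integral>t. H n ((t + 0) rmod p) \<partial>unif p)"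
        by (rule integral_unif_rotation[OF p(1) meas, symmetric])
      finally show "(\<integral>t. K n (x + t) \<partial>unif p) = (\<integral>t. K n t \<partial>unif p)" by (simp add: K_def)
    qed
    also have "\<dots> = (\<integral>t. K n t \<partial>unif p)" using m1 by simp
    finally show ?thesis using Gint m1 by (simp add: Bochner_Integration.integral_diff)
  qed
  ultimately have "(\<lambda>n. - ((\<integral>x. K n x \<partial>unif p) - G a n 0)) \<longlonglongrightarrow> - 0"
    by (intro tendsto_minus) simp
  then show ?thesis by simp
qed

text \<open>The centring constant is the mean of K over one period. Means over windows starting at 0
  decide the tests \<open>{..a}\<close>, and these half-lines generate the Borel sets.\<close>

lemma equidistributed:
  "\<exists>c. weakly_null (unif l) (\<lambda>n x. H n x - c n)"
proof -
  define c where "c n = (\<integral>x. K n x \<partial>unif p)" for n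
  have l: "0 < l" using p by simp
  interpret L: finite_measure "unif l" using l by (rule finite_measure_unif)
  interpret P: finite_measure "unif p" using p(1) by (rule finite_measure_unif)
  have c: "\<bar>c n\<bar> \<le> C" for n
  proof -
    have "\<bar>c n\<bar> \<le> (\<integral>x. \<bar>K n x\<bar> \<partial>unif p)" unfolding c_def by (rule integral_abs_bound)
    also have "\<dots> \<le> (\<integral>x. C \<partial>unif p)"
      by (intro integral_mono P.integrable_const_bound[of _ C] AE_I2) (auto simp: K_bound C_nonneg)
    also have "\<dots> = C" using emeasure_unif_UNIV[OF p(1)] by (simp add: measure_def)
    finally show ?thesis .
  qed
  have bd: "\<bar>K n x - c n\<bar> \<le> 2 * C" "\<bar>H n x - K n x\<bar> \<le> 2 * C" for n x
    using c[of n] K_bound[of n x] bound[of n x] by linarith+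
  have main: "(\<lambda>n. \<integral>x. (K n x - c n) * indicator {..a} x \<partial>unif l) \<longlonglongrightarrow> 0" for a
  proof (cases "0 < a")
    case True
    \<comment> \<open>The half-line cuts the window \<open>[0, b]\<close> out of
      \<open>[0, l]\<close>, with relative length b / l.\<close>
    define b where "b = min a l"
    have b: "0 < b" "b \<le> l" using True l by (auto simp: b_def)
    interpret B: finite_measure "unif b" using b(1) by (rule finite_measure_unif)
    have "(\<integral>x. (K n x - c n) * indicator {..a} x \<partial>unif l) = b / l * (G b n 0 - c n)" for n
    proof -
      have "(\<integral>x. (K n x - c n) * indicator {..a} x \<partial>unif l) = (\<integral>x. (K n x - c n) * indicator {0..b} x \<partial>lborel) / l"
        using l by (subst integral_unif)
          (auto intro!: Bochner_Integration.integral_cong simp: b_def indicator_def)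
      also have "(\<integral>x. (K n x - c n) * indicator {0..b} x \<partial>lborel) = b * (\<integral>x. K n x - c n \<partial>unif b)"
        using b by (subst integral_unif) auto
      also have "(\<integral>x. K n x - c n \<partial>unif b) = G b n 0 - c n"
      proof -
        have "integrable (unif b) (K n)"
          by (intro B.integrable_const_bound[of _ C] AE_I2) (auto simp: K_bound)
        then show ?thesis using emeasure_unif_UNIV[OF b(1)] by (simp add: G_def measure_def Bochner_Integration.integral_diff)
      qed
      finally show ?thesis by simp
    qed
    then show ?thesis using tendsto_mult_right_zero[OF G_average[OF b(1)], of "b / l"] unfolding c_def by (simp only:)
  next
    case False
    have ae: "AE x in lborel. ((K n x - c n) * indicator {..a} x) * indicator {0..l} x = 0" for n
      using AE_lborel_singleton[of 0] False by (auto elim!: eventually_mono simp: indicator_def)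
    have "(\<integral>x. (K n x - c n) * indicator {..a} x \<partial>unif l) = 0" for n
      using l by (subst integral_unif) (auto simp: integral_eq_zero_AE[OF ae])
    then show ?thesis by simp
  qed
  have wK: "weakly_null (unif l) (\<lambda>n x. K n x - c n)"
  proof (rule weakly_null_generator[OF L.finite_measure_axioms, where G = "range (\<lambda>a::real. {..a})" and C = "2 * C"])
    show "Int_stable (range (\<lambda>a::real. {..a}))" by (auto simp: Int_stable_def)
    show "sets (unif l) = sigma_sets (space (unif l)) (range (\<lambda>a::real. {..a}))"
      by (simp add: borel_eq_atMost)
    show "(\<lambda>n. \<integral>x. K n x - c n \<partial>unif l) \<longlonglongrightarrow> 0"
    proof -
      have "(\<integral>x. K n x - c n \<partial>unif l) = (\<integral>x. (K n x - c n) * indicator {..l} x \<partial>unif l)" for n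
        using l by (subst (1 2) integral_unif) (auto intro!: Bochner_Integration.integral_cong simp: indicator_def)
      then show ?thesis using main[of l] by simp
    qed
  qed (use bd main in auto)
  have wH: "weakly_null (unif l) (\<lambda>n x. H n x - K n x)"
  proof (rule weakly_null_sets[OF L.finite_measure_axioms, where C = "2 * C"])
    fix E assume [measurable]: "E \<in> sets (unif l)"
    then have [measurable]: "E \<in> sets borel" by simp
    show "(\<lambda>n. \<integral>x. (H n x - K n x) * indicator E x \<partial>unif l) \<longlonglongrightarrow> 0"
    proof (rule null_of_nn_integral_null)
      show "integrable (unif l) (\<lambda>x. (H n x - K n x) * indicator E x)" for n
        using bd(2) by (intro L.integrable_const_bound[of _ "2 * C"] AE_I2) (auto simp: indicator_def C_nonneg)
      show "(\<lambda>n. \<integral>\<^sup>+x. ennreal \<bar>(H n x - K n x) * indicator E x\<bar> \<partial>unif l) \<longlonglongrightarrow> 0"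
      proof (rule ennreal_null_le)
        show "(\<lambda>n. ennreal (1 / l) * (\<integral>\<^sup>+x\<in>{0..l}. ennreal \<bar>H n x - K n x\<bar> \<partial>lborel)) \<longlonglongrightarrow> 0"
          by (intro ennreal_null_cmult K_near_H) simp
        fix n
        have "(\<integral>\<^sup>+x. ennreal \<bar>(H n x - K n x) * indicator E x\<bar> \<partial>unif l) \<le> (\<integral>\<^sup>+x. ennreal \<bar>H n x - K n x\<bar> \<partial>unif l)"
          by (intro nn_integral_mono ennreal_leI) (auto simp: indicator_def)
        also have "\<dots> = ennreal (1 / l) * (\<integral>\<^sup>+x\<in>{0..l}. ennreal \<bar>H n x - K n x\<bar> \<partial>lborel)"
          using l by (subst nn_integral_unif) (auto simp: divide_ennreal_def mult.commute inverse_ennreal inverse_eq_divide)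
        finally show "(\<integral>\<^sup>+x. ennreal \<bar>(H n x - K n x) * indicator E x\<bar> \<partial>unif l)
          \<le> ennreal (1 / l) * (\<integral>\<^sup>+x\<in>{0..l}. ennreal \<bar>H n x - K n x\<bar> \<partial>lborel)" .
      qed
    qed
  qed (use bd in auto)
  have "weakly_null (unif l) (\<lambda>n x. H n x - c n)"
    unfolding weakly_null_def
  proof (intro allI impI)
    fix \<psi> :: "real \<Rightarrow> real" assume \<psi>: "integrable (unif l) \<psi>"
    have "(\<integral>x. (H n x - c n) * \<psi> x \<partial>unif l) = (\<integral>x. (H n x - K n x) * \<psi> x \<partial>unif l) + (\<integral>x. (K n x - c n) * \<psi> x \<partial>unif l)" for n
    proof -
      have "integrable (unif l) (\<lambda>x. (H n x - K n x) * \<psi> x)" "integrable (unif l) (\<lambda>x. (K n x - c n) * \<psi> x)"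
        using bd \<psi> by (auto intro!: integrable_bounded_mult(1)[where C = "2 * C"])
      then have "(\<integral>x. (H n x - K n x) * \<psi> x + (K n x - c n) * \<psi> x \<partial>unif l)
        = (\<integral>x. (H n x - K n x) * \<psi> x \<partial>unif l) + (\<integral>x. (K n x - c n) * \<psi> x \<partial>unif l)"
        by simp
      then show ?thesis by (simp add: algebra_simps)
    qed
    then show "(\<lambda>n. \<integral>x. (H n x - c n) * \<psi> x \<partial>unif l) \<longlonglongrightarrow> 0"
      using tendsto_add[OF weakly_nullD[OF wH \<psi>] weakly_nullD[OF wK \<psi>]] by simp
  qed
  then show ?thesis by blast
qed

end

section \<open>The Feres random map\<close>

text \<open>\<open>T (dual i)\<close> is the inverse of \<open>T i\<close>.\<close>

definition dual :: "nat \<Rightarrow> nat" where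
  "dual i = (if i = 1 then 3 else if i = 3 then 1 else i)"

lemma index_cases:
  assumes "i \<in> {1..4::nat}" obtains "i = 1" | "i = 2" | "i = 3" | "i = 4"
  using assms by (auto simp: numeral_eq_Suc le_Suc_eq)

lemma sum_index: "(\<Sum>i\<in>{1..4::nat}. f i) = f 1 + f 2 + f 3 + (f 4 :: 'a :: comm_monoid_add)"
  by (simp add: numeral_eq_Suc)

lemma dual_dual: "dual (dual i) = i" by (simp add: dual_def)

lemma bij_betw_dual: "bij_betw dual {1..4} {1..4}"
  by (rule bij_betw_byWitness[where f' = dual]) (auto simp: dual_dual, auto simp: dual_def split: if_splits)

locale feres =
  fixes \<alpha> :: real
  assumes \<alpha>: "0 < \<alpha>" "\<alpha> < pi / 6"
begin

abbreviation T :: "nat \<Rightarrow> real \<Rightarrow> real" where "T \<equiv> feres_map \<alpha>"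
abbreviation P :: "nat \<Rightarrow> real \<Rightarrow> real" where "P \<equiv> feres_prob \<alpha>"

lemma T_dual: "i \<in> {1..4} \<Longrightarrow> T (dual i) (T i \<theta>) = \<theta>"
  by (erule index_cases) (simp_all add: feres_map_def dual_def)

lemma T_dual': "i \<in> {1..4} \<Longrightarrow> T i (T (dual i) \<theta>) = \<theta>"
  by (erule index_cases) (simp_all add: feres_map_def dual_def)

lemma cos_pos: "0 < cos \<alpha>" "0 < cos (2 * \<alpha>)"
  using \<alpha> by (auto intro!: cos_gt_zero)

lemma feres_u_sin:
  assumes "0 < \<theta>" "\<theta> < pi" "cos \<beta> \<noteq> 0"
  shows "feres_u \<beta> \<theta> = sin (\<theta> + \<beta>) / (2 * cos \<beta> * sin \<theta>)"
    "feres_u \<beta> (- \<theta>) = sin (\<theta> - \<beta>) / (2 * cos \<beta> * sin \<theta>)"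
proof -
  have s: "sin \<theta> \<noteq> 0" using assms(1,2) sin_gt_zero by force
  have "tan \<beta> / tan \<theta> = sin \<beta> * cos \<theta> / (cos \<beta> * sin \<theta>)" by (simp add: tan_def)
  then show "feres_u \<beta> \<theta> = sin (\<theta> + \<beta>) / (2 * cos \<beta> * sin \<theta>)"
    "feres_u \<beta> (- \<theta>) = sin (\<theta> - \<beta>) / (2 * cos \<beta> * sin \<theta>)"
    using s assms(3) unfolding feres_u_def tan_minus minus_divide_right[symmetric]
    by (simp_all only: sin_add sin_diff) (simp_all add: field_simps)
qed

text \<open>The sine of the invariant density cancels the pole of
  \<open>tan \<beta> / tan \<theta>\<close>, which leaves pure sines.\<close>

lemma feres_u_times_sin:
  assumes "0 < \<theta>" "\<theta> < pi"
  shows "feres_u \<alpha> \<theta> * sin \<theta> = sin (\<theta> + \<alpha>) / (2 * cos \<alpha>)"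
    "feres_u \<alpha> (- \<theta>) * sin \<theta> = sin (\<theta> - \<alpha>) / (2 * cos \<alpha>)"
    "2 * cos (2 * \<alpha>) * feres_u (2 * \<alpha>) \<theta> * sin \<theta> = sin (\<theta> + 2 * \<alpha>)"
    "2 * cos (2 * \<alpha>) * feres_u (2 * \<alpha>) (- \<theta>) * sin \<theta> = sin (\<theta> - 2 * \<alpha>)"
proof -
  have s: "sin \<theta> \<noteq> 0" using assms sin_gt_zero by force
  show "feres_u \<alpha> \<theta> * sin \<theta> = sin (\<theta> + \<alpha>) / (2 * cos \<alpha>)"
    "feres_u \<alpha> (- \<theta>) * sin \<theta> = sin (\<theta> - \<alpha>) / (2 * cos \<alpha>)"
    "2 * cos (2 * \<alpha>) * feres_u (2 * \<alpha>) \<theta> * sin \<theta> = sin (\<theta> + 2 * \<alpha>)"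
    "2 * cos (2 * \<alpha>) * feres_u (2 * \<alpha>) (- \<theta>) * sin \<theta> = sin (\<theta> - 2 * \<alpha>)"
    using s cos_pos by (simp_all add: feres_u_sin assms)
qed

text \<open>It turns the differences in the second and fourth probabilities into a single sine, the
  mirror image of the neighbouring piece.\<close>

lemma sin_identity: "sin (\<theta> + 2 * \<alpha>) * (2 * cos \<alpha>) = sin (\<theta> + 3 * \<alpha>) + sin (\<theta> + \<alpha>)"
proof -
  have e: "\<theta> + 3 * \<alpha> = (\<theta> + 2 * \<alpha>) + \<alpha>" "\<theta> + \<alpha> = (\<theta> + 2 * \<alpha>) - \<alpha>" by simp_all
  show ?thesis unfolding e sin_add[of "\<theta> + 2 * \<alpha>"] sin_diff[of "\<theta> + 2 * \<alpha>"] by simp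
qed

text \<open>Lebesgue density of the mass that uses branch i, extended by 0 to the line. The
  extension lets \<open>wt_dual\<close> hold at every real argument, with no check that images stay
  in the interval.\<close>

definition wt :: "nat \<Rightarrow> real \<Rightarrow> real" where
  "wt i \<theta> = P i \<theta> * (indicator {0..pi} \<theta> * sin \<theta> / 2)"

lemma wt_1: "2 * wt 1 \<theta> =
   (if \<theta> < 0 then 0 else if \<theta> < \<alpha> then sin \<theta> else if \<theta> < pi - 3 * \<alpha> then sin (\<theta> + \<alpha>) / (2 * cos \<alpha>)
    else if \<theta> < pi - 2 * \<alpha> then sin (\<theta> + 2 * \<alpha>) else 0)"
  using \<alpha> feres_u_times_sin[of \<theta>] by (simp add: wt_def feres_prob_def feres_p1_def indicator_def)

lemma wt_2: "2 * wt 2 \<theta> =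
   (if \<theta> < pi - 3 * \<alpha> then 0 else if \<theta> < pi - 2 * \<alpha> then sin (\<theta> + \<alpha>) / (2 * cos \<alpha>) - sin (\<theta> + 2 * \<alpha>)
    else if \<theta> < pi - \<alpha> then sin (\<theta> + \<alpha>) / (2 * cos \<alpha>) else 0)"
  using \<alpha> feres_u_times_sin[of \<theta>]
  by (simp add: wt_def feres_prob_def feres_p2_def indicator_def left_diff_distrib)

lemma wt_3: "2 * wt 3 \<theta> =
   (if \<theta> < 2 * \<alpha> then 0 else if \<theta> < 3 * \<alpha> then sin (\<theta> - 2 * \<alpha>) else if \<theta> < pi - \<alpha> then sin (\<theta> - \<alpha>) / (2 * cos \<alpha>)
    else if \<theta> \<le> pi then sin \<theta> else 0)"
  using \<alpha> feres_u_times_sin[of \<theta>] by (simp add: wt_def feres_prob_def feres_p3_def indicator_def)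

lemma wt_4: "2 * wt 4 \<theta> =
   (if \<theta> < \<alpha> then 0 else if \<theta> < 2 * \<alpha> then sin (\<theta> - \<alpha>) / (2 * cos \<alpha>)
    else if \<theta> < 3 * \<alpha> then sin (\<theta> - \<alpha>) / (2 * cos \<alpha>) - sin (\<theta> - 2 * \<alpha>) else 0)"
  using \<alpha> feres_u_times_sin[of \<theta>]
  by (simp add: wt_def feres_prob_def feres_p4_def indicator_def left_diff_distrib)

lemma wt_dual_13: "wt 3 (\<theta> + 2 * \<alpha>) = wt 1 \<theta>"
proof -
  have "2 * wt 3 (\<theta> + 2 * \<alpha>) = 2 * wt 1 \<theta>"
  \<comment> \<open>This point is sent to the closed end \<pi>, where the last nonzero clause of
    \<open>wt_3\<close> still applies; it gives sin \<pi> = 0, in agreement with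
    \<open>wt_1\<close>.\<close>
  proof (cases "\<theta> = pi - 2 * \<alpha>")
    case True then show ?thesis using \<alpha> unfolding wt_1 wt_3 by simp
  next
    case False then show ?thesis using \<alpha> unfolding wt_1 wt_3 by (simp add: add.commute)
  qed
  then show ?thesis by simp
qed

text \<open>\<open>T 2\<close> is the reflection in \<pi> - 2 \<alpha>, which exchanges the two
  pieces of the second probability. One half is computed with \<open>sin_identity\<close>; the other
  follows because the reflection is an involution.\<close>

lemma wt_dual_2: "wt 2 (- \<theta> + 2 * pi - 4 * \<alpha>) = wt 2 \<theta>"
proof -
  have 1: "wt 2 (- \<theta> + 2 * pi - 4 * \<alpha>) = wt 2 \<theta>" if t: "pi - 3 * \<alpha> \<le> \<theta>" "\<theta> < pi - 2 * \<alpha>" for \<theta>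
  proof -
    have s: "sin (- \<theta> + 2 * pi - 4 * \<alpha> + \<alpha>) = - sin (\<theta> + 3 * \<alpha>)"
    proof -
      have e: "- \<theta> + 2 * pi - 4 * \<alpha> + \<alpha> = - (\<theta> + 3 * \<alpha>) + 2 * pi" by simp
      show ?thesis unfolding e sin_periodic sin_minus ..
    qed
    have "2 * wt 2 \<theta> = sin (\<theta> + \<alpha>) / (2 * cos \<alpha>) - sin (\<theta> + 2 * \<alpha>)"
      using t unfolding wt_2 by simp
    also have "\<dots> = - sin (\<theta> + 3 * \<alpha>) / (2 * cos \<alpha>)"
      using sin_identity[of \<theta>] cos_pos(1) by (simp add: field_simps)
    also have "\<dots> = 2 * wt 2 (- \<theta> + 2 * pi - 4 * \<alpha>)"
    \<comment> \<open>Here the image is \<pi> - \<alpha>, just outside the half-open support, and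
      sin (\<theta> + 3 \<alpha>) vanishes as well.\<close>
    proof (cases "\<theta> = pi - 3 * \<alpha>")
      case True then show ?thesis using \<alpha> unfolding wt_2 by simp
    next
      case False then show ?thesis using t \<alpha> s unfolding wt_2 by simp
    qed
    finally show ?thesis by simp
  qed
  consider "\<theta> < pi - 3 * \<alpha>" | "pi - 3 * \<alpha> \<le> \<theta>" "\<theta> < pi - 2 * \<alpha>" | "\<theta> = pi - 2 * \<alpha>"
    | "pi - 2 * \<alpha> < \<theta>" "\<theta> \<le> pi - \<alpha>" | "pi - \<alpha> < \<theta>" by linarith
  then show ?thesis
  proof cases
    case 1
    then have "2 * wt 2 (- \<theta> + 2 * pi - 4 * \<alpha>) = 2 * wt 2 \<theta>" using \<alpha> unfolding wt_2 by simp
    then show ?thesis by simp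
  next
    case 2 then show ?thesis by (rule 1)
  next
    case 3
    then have "- \<theta> + 2 * pi - 4 * \<alpha> = \<theta>" by simp
    then show ?thesis by (simp only:)
  next
    case 4
    then show ?thesis using 1[of "- \<theta> + 2 * pi - 4 * \<alpha>"] by simp
  next
    case 5
    then have "2 * wt 2 (- \<theta> + 2 * pi - 4 * \<alpha>) = 2 * wt 2 \<theta>" using \<alpha> unfolding wt_2 by simp
    then show ?thesis by simp
  qed
qed


text \<open>The same argument for the reflection in 2 \<alpha>.\<close>

lemma wt_dual_4: "wt 4 (- \<theta> + 4 * \<alpha>) = wt 4 \<theta>"
proof -
  have 1: "wt 4 (- \<theta> + 4 * \<alpha>) = wt 4 \<theta>" if t: "2 * \<alpha> < \<theta>" "\<theta> \<le> 3 * \<alpha>" for \<theta>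
  proof -
    have i: "sin (\<theta> - 2 * \<alpha>) * (2 * cos \<alpha>) = sin (\<theta> - \<alpha>) + sin (\<theta> - 3 * \<alpha>)"
      using sin_identity[of "\<theta> - 4 * \<alpha>"] by simp
    have s: "sin (- \<theta> + 4 * \<alpha> - \<alpha>) = - sin (\<theta> - 3 * \<alpha>)"
      using sin_minus[of "\<theta> - 3 * \<alpha>"] by simp
    have "2 * wt 4 (- \<theta> + 4 * \<alpha>) = - sin (\<theta> - 3 * \<alpha>) / (2 * cos \<alpha>)"
      using t \<alpha> s unfolding wt_4 by simp
    also have "\<dots> = sin (\<theta> - \<alpha>) / (2 * cos \<alpha>) - sin (\<theta> - 2 * \<alpha>)"
      using i cos_pos(1) by (simp add: field_simps)
    also have "\<dots> = 2 * wt 4 \<theta>"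
    proof (cases "\<theta> = 3 * \<alpha>")
      case True
      then show ?thesis using \<alpha> cos_pos(1) unfolding wt_4 by (simp add: sin_double)
    next
      case False then show ?thesis using t \<alpha> unfolding wt_4 by simp
    qed
    finally show ?thesis by simp
  qed
  consider "\<theta> < \<alpha>" | "\<alpha> \<le> \<theta>" "\<theta> < 2 * \<alpha>" | "\<theta> = 2 * \<alpha>" | "2 * \<alpha> < \<theta>" "\<theta> \<le> 3 * \<alpha>" | "3 * \<alpha> < \<theta>" by linarith
  then show ?thesis
  proof cases
    case 2
    then show ?thesis using 1[of "- \<theta> + 4 * \<alpha>"] by simp
  next
    case 3
    then have "- \<theta> + 4 * \<alpha> = \<theta>" by simp
    then show ?thesis by (simp only:)
  next
    case 4 then show ?thesis by (rule 1)
  next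
    case 1
    then have "2 * wt 4 (- \<theta> + 4 * \<alpha>) = 2 * wt 4 \<theta>" using \<alpha> unfolding wt_4 by simp
    then show ?thesis by simp
  next
    case 5
    then have "2 * wt 4 (- \<theta> + 4 * \<alpha>) = 2 * wt 4 \<theta>" using \<alpha> unfolding wt_4 by simp
    then show ?thesis by simp
  qed
qed

text \<open>Detailed balance. As \<open>T i\<close> is an isometry of the line with inverse
  \<open>T (dual i)\<close>, equal densities at a point and at its image make the random map
  reversible.\<close>

lemma wt_dual: "i \<in> {1..4} \<Longrightarrow> wt (dual i) (T i \<theta>) = wt i \<theta>"
  using wt_dual_13[of \<theta>] wt_dual_13[of "\<theta> - 2 * \<alpha>"] wt_dual_2[of \<theta>] wt_dual_4[of \<theta>]
  by (erule_tac index_cases) (simp_all add: dual_def feres_map_def)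

lemma feres_u_complement: "feres_u \<beta> \<theta> + feres_u \<beta> (- \<theta>) = 1"
  by (simp add: feres_u_def field_simps)

text \<open>Together with \<open>P_nonneg\<close> this covers every real angle, also outside
  \<open>[0, \<pi>]\<close>, so averaging over the branches is an operator on functions on the whole
  line.\<close>

lemma P_sum: "P 1 \<theta> + P 2 \<theta> + P 3 \<theta> + P 4 \<theta> = 1"
  using \<alpha> feres_u_complement[of \<alpha> \<theta>]
  by (simp add: feres_prob_def feres_p1_def feres_p2_def feres_p3_def feres_p4_def)

text \<open>On the pieces given by a difference the sign is not visible. By detailed balance the
  weight there equals the weight at the mirror point, where it is a single sine of an angle in
  \<open>[0, \<pi>]\<close>.\<close>

lemma P_nonneg: "i \<in> {1..4} \<Longrightarrow> 0 \<le> P i \<theta>"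
proof -
  assume i: "i \<in> {1..4}"
  consider "\<theta> < \<alpha>" | "\<alpha> \<le> \<theta>" "\<theta> < pi - \<alpha>" | "pi - \<alpha> \<le> \<theta>" by linarith
  then show ?thesis
  proof cases
    case 2
    then have t: "0 < \<theta>" "\<theta> < pi" using \<alpha> by linarith+
    have s: "0 < sin \<theta>" using t by (rule sin_gt_zero)
    have w2: "0 \<le> wt 2 \<theta>" if "pi - 2 * \<alpha> \<le> \<theta>" for \<theta>
    proof -
      have "0 \<le> sin (\<theta> + \<alpha>)" if "\<theta> < pi - \<alpha>" using that \<open>pi - 2 * \<alpha> \<le> \<theta>\<close> \<alpha> by (intro sin_ge_zero) linarith+
      then have "0 \<le> 2 * wt 2 \<theta>" using that \<alpha> cos_pos(1) unfolding wt_2 by simp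
      then show ?thesis by simp
    qed
    have w4: "0 \<le> wt 4 \<theta>" if "\<theta> \<le> 2 * \<alpha>" for \<theta>
    proof (cases "\<theta> = 2 * \<alpha>")
      case True
      have "0 \<le> sin \<alpha>" using \<alpha> by (intro sin_ge_zero) linarith+
      then have "0 \<le> 2 * wt 4 \<theta>" using True \<alpha> cos_pos(1) unfolding wt_4 by simp
      then show ?thesis by simp
    next
      case False
      have "0 \<le> sin (\<theta> - \<alpha>)" if "\<alpha> \<le> \<theta>" using that \<open>\<theta> \<le> 2 * \<alpha>\<close> \<alpha> by (intro sin_ge_zero) linarith+
      then have "0 \<le> 2 * wt 4 \<theta>" using that False \<alpha> cos_pos(1) unfolding wt_4 by simp
      then show ?thesis by simp
    qed
    have sp: "0 \<le> sin (\<theta> + \<alpha>)" "0 \<le> sin (\<theta> - \<alpha>)"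
      "\<theta> < pi - 2 * \<alpha> \<Longrightarrow> 0 \<le> sin (\<theta> + 2 * \<alpha>)" "2 * \<alpha> \<le> \<theta> \<Longrightarrow> 0 \<le> sin (\<theta> - 2 * \<alpha>)"
      using 2 \<alpha> by (auto intro!: sin_ge_zero)
    have "0 \<le> wt i \<theta>"
      using i
    proof (cases rule: index_cases)
      case 1
      have "0 \<le> 2 * wt 1 \<theta>" using sp 2 \<alpha> cos_pos(1) unfolding wt_1 by simp
      then show ?thesis using 1 by simp
    next
      case 2 then show ?thesis using w2[of \<theta>] w2[of "- \<theta> + 2 * pi - 4 * \<alpha>"] wt_dual_2[of \<theta>] by (cases "pi - 2 * \<alpha> \<le> \<theta>") auto
    next
      case 3
      have "0 \<le> 2 * wt 3 \<theta>" using sp 2 \<alpha> cos_pos(1) s unfolding wt_3 by simp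
      then show ?thesis using 3 by simp
    next
      case 4 then show ?thesis using w4[of \<theta>] w4[of "- \<theta> + 4 * \<alpha>"] wt_dual_4[of \<theta>] by (cases "\<theta> \<le> 2 * \<alpha>") auto
    qed
    then show ?thesis using s t by (simp add: wt_def zero_le_mult_iff)
  qed (use i \<alpha> in \<open>auto elim!: index_cases simp: feres_prob_def feres_p1_def feres_p2_def feres_p3_def feres_p4_def\<close>)
qed

lemma P_le_1: "i \<in> {1..4} \<Longrightarrow> P i \<theta> \<le> 1"
  using P_sum[of \<theta>] P_nonneg[of 1 \<theta>] P_nonneg[of 2 \<theta>] P_nonneg[of 3 \<theta>] P_nonneg[of 4 \<theta>]
  by (erule_tac index_cases) simp_all

lemma feres_u_measurable [measurable]: "feres_u \<beta> \<in> borel_measurable borel"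
proof -
  have [measurable]: "(sin :: real \<Rightarrow> real) \<in> borel_measurable borel" "(cos :: real \<Rightarrow> real) \<in> borel_measurable borel"
    by (auto intro!: borel_measurable_continuous_onI continuous_intros)
  show ?thesis unfolding feres_u_def[abs_def] tan_def by measurable
qed

lemma P_measurable [measurable]: "P i \<in> borel_measurable borel"
proof -
  have "feres_p1 \<alpha> \<in> borel_measurable borel" "feres_p2 \<alpha> \<in> borel_measurable borel"
    "feres_p3 \<alpha> \<in> borel_measurable borel" "feres_p4 \<alpha> \<in> borel_measurable borel"
    unfolding feres_p1_def[abs_def] feres_p2_def[abs_def] feres_p3_def[abs_def] feres_p4_def[abs_def] by measurable
  then show ?thesis by (simp add: feres_prob_def)
qed

lemma T_measurable [measurable]: "T i \<in> borel_measurable borel"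
  unfolding feres_map_def[abs_def] by measurable

lemma wt_measurable [measurable]: "wt i \<in> borel_measurable borel"
  unfolding wt_def[abs_def] by measurable

end

section \<open>The invariant law of the angle, carried by the whole line\<close>

definition \<mu> :: "real measure" where
  "\<mu> = density lborel (\<lambda>\<theta>. ennreal (indicator {0..pi} \<theta> * sin \<theta> / 2))"

lemma sin_measurable [measurable]: "(sin :: real \<Rightarrow> real) \<in> borel_measurable borel"
  and cos_measurable [measurable]: "(cos :: real \<Rightarrow> real) \<in> borel_measurable borel"
  by (auto intro!: borel_measurable_continuous_onI continuous_intros)

lemma sets_\<mu> [measurable_cong, simp]: "sets \<mu> = sets borel" and space_\<mu> [simp]: "space \<mu> = UNIV"
  by (simp_all add: \<mu>_def)

lemma indicator_sin_nonneg: "0 \<le> indicator {0..pi} \<theta> * sin \<theta> / 2"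
  by (auto simp: indicator_def intro: sin_ge_zero)

lemma integral_\<mu>:
  fixes f :: "real \<Rightarrow> real"
  assumes [measurable]: "f \<in> borel_measurable borel"
  shows "(\<integral>\<theta>. f \<theta> \<partial>\<mu>) = (\<integral>\<theta>. f \<theta> * (indicator {0..pi} \<theta> * sin \<theta> / 2) \<partial>lborel)"
  unfolding \<mu>_def by (subst integral_density) (auto simp: mult.commute intro: sin_ge_zero split: split_indicator)

lemma integrable_\<mu>:
  fixes f :: "real \<Rightarrow> real"
  assumes [measurable]: "f \<in> borel_measurable borel"
  shows "integrable \<mu> f \<longleftrightarrow> integrable lborel (\<lambda>\<theta>. f \<theta> * (indicator {0..pi} \<theta> * sin \<theta> / 2))"
  unfolding \<mu>_def by (subst integrable_density) (auto simp: mult.commute intro: sin_ge_zero split: split_indicator)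

lemma emeasure_\<mu>_UNIV: "emeasure \<mu> UNIV = 1"
proof -
  have "emeasure \<mu> UNIV = (\<integral>\<^sup>+\<theta>. ennreal (sin \<theta> / 2) * indicator {0..pi} \<theta> \<partial>lborel)"
    unfolding \<mu>_def by (subst emeasure_density) (auto intro!: nn_integral_cong simp: indicator_def)
  also have "\<dots> = ennreal ((- cos pi / 2) - (- cos 0 / 2))"
    by (rule nn_integral_FTC_Icc) (auto intro!: derivative_eq_intros sin_ge_zero)
  finally show ?thesis by simp
qed

lemma finite_measure_\<mu>: "finite_measure \<mu>"
  using emeasure_\<mu>_UNIV by (intro finite_measureI) simp

lemma measure_\<mu>_UNIV: "measure \<mu> UNIV = 1" using emeasure_\<mu>_UNIV by (simp add: measure_def)

lemma measure_unif_UNIV: "0 < p \<Longrightarrow> measure (unif p) UNIV = 1"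
  using emeasure_unif_UNIV[of p] by (simp add: measure_def)

lemma abs_indicator_le: "\<bar>x\<bar> \<le> K \<Longrightarrow> \<bar>x * indicator D s\<bar> \<le> (K :: real)"
  by (auto simp: indicator_def)

lemma unif_bounded:
  fixes f :: "real \<Rightarrow> real"
  assumes p: "0 < p" and f: "f \<in> borel_measurable borel" "\<And>x. \<bar>f x\<bar> \<le> K"
  shows "integrable (unif p) f" "\<bar>\<integral>x. f x \<partial>unif p\<bar> \<le> K"
proof -
  interpret finite_measure "unif p" using p by (rule finite_measure_unif)
  have int: "integrable (unif p) g" if "g \<in> borel_measurable borel" "\<And>x. \<bar>g x\<bar> \<le> K'" for g and K' :: real
    using that by (intro integrable_const_bound[of _ K'] AE_I2) auto
  show "integrable (unif p) f" using int f by blast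
  have "\<bar>\<integral>x. f x \<partial>unif p\<bar> \<le> (\<integral>x. \<bar>f x\<bar> \<partial>unif p)" by (rule integral_abs_bound)
  also have "\<dots> \<le> (\<integral>x. K \<partial>unif p)"
    using f by (intro integral_mono int[of _ K] int[of "\<lambda>_. K" "\<bar>K\<bar>"]) auto
  also have "\<dots> = K" using measure_unif_UNIV[OF p] by simp
  finally show "\<bar>\<integral>x. f x \<partial>unif p\<bar> \<le> K" .
qed

lemma integrable_\<mu>_bounded:
  fixes f :: "real \<Rightarrow> real"
  assumes "f \<in> borel_measurable borel" "\<And>\<theta>. \<bar>f \<theta>\<bar> \<le> K"
  shows "integrable \<mu> f"
proof -
  interpret finite_measure \<mu> by (rule finite_measure_\<mu>)
  show ?thesis using assms by (intro integrable_const_bound[of _ K] AE_I2) auto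
qed

lemma AE_\<mu>: "AE \<theta> in \<mu>. 0 < \<theta> \<and> \<theta> < pi"
  unfolding \<mu>_def
  by (subst AE_density) (use AE_lborel_singleton[of 0] AE_lborel_singleton[of pi] in \<open>auto elim!: eventually_elim2 simp: indicator_def\<close>)

lemma lborel_integral_shift: "(\<integral>x. f (x + t :: real) \<partial>lborel) = (\<integral>x. f x \<partial>lborel :: real)"
  using lborel_integral_real_affine[of 1 f t] by (simp add: add.commute)

lemma lborel_integral_flip: "(\<integral>x. f (t - x :: real) \<partial>lborel) = (\<integral>x. f x \<partial>lborel :: real)"
  using lborel_integral_real_affine[of "-1" f t] by simp

context feres
begin

text \<open>Integrated detailed balance: the substitution by \<open>T i\<close> preserves Lebesgue
  measure and turns the weight of i into that of its dual.\<close>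

lemma integral_P_\<mu>:
  fixes g :: "real \<Rightarrow> real"
  assumes [measurable]: "g \<in> borel_measurable borel" and i: "i \<in> {1..4}"
  shows "(\<integral>\<theta>. P i \<theta> * g \<theta> \<partial>\<mu>) = (\<integral>\<theta>. P (dual i) \<theta> * g (T (dual i) \<theta>) \<partial>\<mu>)"
proof -
  have w: "(\<integral>\<theta>. P i \<theta> * g \<theta> \<partial>\<mu>) = (\<integral>\<theta>. wt i \<theta> * g \<theta> \<partial>lborel)"
    if [measurable]: "g \<in> borel_measurable borel" for i and g :: "real \<Rightarrow> real"
    by (subst integral_\<mu>) (auto simp: wt_def mult_ac intro!: Bochner_Integration.integral_cong)
  have "(\<integral>\<theta>. wt i \<theta> * g \<theta> \<partial>lborel) = (\<integral>\<theta>. wt (dual i) (T i \<theta>) * g (T (dual i) (T i \<theta>)) \<partial>lborel)"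
    using i by (simp add: wt_dual T_dual)
  also have "\<dots> = (\<integral>\<theta>. wt (dual i) \<theta> * g (T (dual i) \<theta>) \<partial>lborel)"
  proof -
    \<comment> \<open>Every branch is a shift by 2 \<alpha> or - 2 \<alpha>, or a
      reflection.\<close>
    have T: "(\<lambda>\<theta>. T i \<theta>) = (\<lambda>\<theta>. \<theta> + 2 * \<alpha>) \<or> (\<lambda>\<theta>. T i \<theta>) = (\<lambda>\<theta>. \<theta> + (- 2 * \<alpha>))
       \<or> (\<exists>c. (\<lambda>\<theta>. T i \<theta>) = (\<lambda>\<theta>. c - \<theta>))"
      using i
    proof (cases rule: index_cases)
      case 2
      then have "(\<lambda>\<theta>. T i \<theta>) = (\<lambda>\<theta>. (2 * pi - 4 * \<alpha>) - \<theta>)" by (auto simp: feres_map_def)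
      then show ?thesis by blast
    next
      case 4
      then have "(\<lambda>\<theta>. T i \<theta>) = (\<lambda>\<theta>. 4 * \<alpha> - \<theta>)" by (auto simp: feres_map_def)
      then show ?thesis by blast
    qed (auto simp: feres_map_def)
    let ?f = "\<lambda>\<theta>. wt (dual i) \<theta> * g (T (dual i) \<theta>)"
    from T show ?thesis
    proof (elim disjE exE)
      fix c assume "(\<lambda>\<theta>. T i \<theta>) = (\<lambda>\<theta>. c - \<theta>)"
      then have "T i \<theta> = c - \<theta>" for \<theta> by meson
      then show ?thesis using lborel_integral_flip[of ?f c] by simp
    next
      assume "(\<lambda>\<theta>. T i \<theta>) = (\<lambda>\<theta>. \<theta> + 2 * \<alpha>)"
      then have "T i \<theta> = \<theta> + 2 * \<alpha>" for \<theta> by meson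
      then show ?thesis using lborel_integral_shift[of ?f "2 * \<alpha>"] by simp
    next
      assume "(\<lambda>\<theta>. T i \<theta>) = (\<lambda>\<theta>. \<theta> + (- 2 * \<alpha>))"
      then have "T i \<theta> = \<theta> + (- 2 * \<alpha>)" for \<theta> by meson
      then show ?thesis using lborel_integral_shift[of ?f "- 2 * \<alpha>"] by simp
    qed
  qed
  finally show ?thesis by (subst (1 2) w) simp_all
qed

end

section \<open>The central angle\<close>

locale feres_billiard = feres +
  fixes M :: surface and r :: real
  assumes r: "0 < r" "M = Spherical \<Longrightarrow> r < pi / 2"
begin

abbreviation h :: real where "h \<equiv> sn M r"
abbreviation c :: real where "c \<equiv> cs M r"
abbreviation L :: real where "L \<equiv> circle_length M r"
abbreviation \<gamma> :: "real \<Rightarrow> real" where "\<gamma> \<equiv> central_angle M r"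
abbreviation B :: "real \<times> real \<Rightarrow> real \<times> real" where "B \<equiv> circular_billiard M r"

lemma h_pos: "0 < h" and c_pos: "0 < c"
  using r by (cases M; auto intro: sin_gt_zero cos_gt_zero)+

lemma L_pos: "0 < L" using h_pos by (simp add: circle_length_def)

text \<open>\<open>G\<close> is \<open>2 arctan (tan \<theta> / c)\<close> in a form that is smooth at \<open>\<pi>/2\<close>, with derivative \<open>\<pi> \<phi>0 sin\<close>.\<close>

definition q :: "real \<Rightarrow> real" where "q \<theta> = c * (cos \<theta>)\<^sup>2 + (sin \<theta>)\<^sup>2"

lemma q_pos: "0 < q \<theta>"
proof (cases "cos \<theta> = 0")
  case True
  then have "(sin \<theta>)\<^sup>2 = 1" by (simp add: sin_squared_eq)
  then show ?thesis by (simp add: q_def True)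
next
  case False
  then show ?thesis using c_pos by (simp add: q_def add_pos_nonneg)
qed

definition G :: "real \<Rightarrow> real" where
  "G \<theta> = 2 * \<theta> + 2 * arctan ((1 - c) * (sin \<theta> * cos \<theta>) / q \<theta>)"

text \<open>The argument of the arctangent in \<open>G\<close> is the tangent of \<gamma>/2 -
  \<theta>, by the subtraction formula applied to tan \<theta> / c and tan \<theta>. So half of
  \<open>G \<theta>\<close> has the right tangent, and it remains to place it in
  \<open>(0, \<pi>)\<close>, where \<gamma>/2 lies.\<close>

lemma central_angle_closed_form:
  assumes "0 \<le> \<theta>" "\<theta> \<le> pi" shows "\<gamma> \<theta> = G \<theta>"
proof (cases "\<theta> = 0 \<or> \<theta> = pi \<or> cos \<theta> = 0")
  case True
  have "\<theta> = pi / 2" if "cos \<theta> = 0"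
    using that assms by (metis cos_pi_half cos_inj_pi divide_le_eq_1 pi_half_ge_zero mult_le_cancel_left1 field_sum_of_halves le_add_same_cancel1)
  moreover have "\<gamma> (pi / 2) = pi"
    using central_angle_formula[of r M "pi / 2", OF r] by simp
  moreover have "\<gamma> 0 = 0" "\<gamma> pi = 2 * pi"
    by (simp_all add: central_angle_def linorder_not_le[THEN iffD2, OF pi_gt_zero])
  moreover have "G 0 = 0" "G pi = 2 * pi" "G (pi / 2) = pi" by (simp_all add: G_def)
  ultimately show ?thesis using True by metis
next
  case False
  then have t: "0 < \<theta>" "\<theta> < pi" and cn: "cos \<theta> \<noteq> 0" using assms by auto
  then have "\<theta> \<noteq> pi / 2" using cos_pi_half by metis
  then have f: "0 < \<gamma> \<theta>" "\<gamma> \<theta> < 2 * pi" "tan (\<gamma> \<theta> / 2) = tan \<theta> / c"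
    using central_angle_formula[OF r t] by simp_all
  define A where "A = (1 - c) * (sin \<theta> * cos \<theta>) / q \<theta>"
  define y where "y = \<theta> + arctan A"
  have sp: "0 < sin \<theta>" using t by (rule sin_gt_zero)
  have co: "0 < cos (arctan A)" by (simp add: cos_arctan add_pos_nonneg)
  have si: "sin (arctan A) = A * cos (arctan A)" by (simp add: sin_arctan cos_arctan)
  have A: "A * q \<theta> = (1 - c) * (sin \<theta> * cos \<theta>)" using q_pos[of \<theta>] by (simp add: A_def)
  have "sin y * q \<theta> = cos (arctan A) * (sin \<theta> * q \<theta> + cos \<theta> * (A * q \<theta>))"
    by (simp add: y_def sin_add si algebra_simps)
  also have "sin \<theta> * q \<theta> + cos \<theta> * (A * q \<theta>) = sin \<theta> * ((sin \<theta>)\<^sup>2 + (cos \<theta>)\<^sup>2)"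
    unfolding A unfolding q_def by algebra
  finally have sy: "sin y * q \<theta> = cos (arctan A) * sin \<theta>" by simp
  have "cos y * q \<theta> = cos (arctan A) * (cos \<theta> * q \<theta> - sin \<theta> * (A * q \<theta>))"
    by (simp add: y_def cos_add si algebra_simps)
  also have "cos \<theta> * q \<theta> - sin \<theta> * (A * q \<theta>) = c * cos \<theta> * ((sin \<theta>)\<^sup>2 + (cos \<theta>)\<^sup>2)"
    unfolding A unfolding q_def by algebra
  finally have cy: "cos y * q \<theta> = cos (arctan A) * (c * cos \<theta>)" by simp
  \<comment> \<open>A positive sine together with the bounds - \<pi>/2 < y < 3 \<pi>/2 forces 0 < y
    < \<pi>.\<close>
  have spy: "0 < sin y" using sy co sp q_pos[of \<theta>] by (metis mult_pos_pos zero_less_mult_pos2)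
  have y: "- (pi / 2) < y" "y < 3 * pi / 2"
    using t arctan_lbound[of A] arctan_ubound[of A] by (auto simp: y_def)
  have y0: "0 < y"
  proof (rule ccontr)
    assume "\<not> 0 < y"
    then have "0 \<le> sin (- y)" using y by (intro sin_ge_zero) auto
    then show False using spy by simp
  qed
  have y1: "y < pi"
  proof (rule ccontr)
    assume "\<not> y < pi"
    then have "0 \<le> sin (y - pi)" using y by (intro sin_ge_zero) auto
    then show False using spy by simp
  qed
  have s0: "sin (\<gamma> \<theta> / 2 - y) = 0"
  proof -
    have cny: "cos y \<noteq> 0" using cy co c_pos cn by auto
    have "tan y = (sin y * q \<theta>) / (cos y * q \<theta>)" using q_pos[of \<theta>] by (simp add: tan_def)
    also have "\<dots> = tan \<theta> / c" unfolding sy cy using co by (simp add: tan_def)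
    finally have "tan (\<gamma> \<theta> / 2) = tan y" using f(3) by simp
    moreover have "cos (\<gamma> \<theta> / 2) \<noteq> 0"
    proof
      assume "cos (\<gamma> \<theta> / 2) = 0"
      then have "tan \<theta> / c = 0" using f(3) by (simp add: tan_def)
      then show False using sp cn c_pos by (simp add: tan_def)
    qed
    ultimately have "sin (\<gamma> \<theta> / 2) * cos y = sin y * cos (\<gamma> \<theta> / 2)"
      using cny by (simp add: tan_def field_simps)
    then show ?thesis by (simp add: sin_diff mult.commute)
  qed
  have "- pi < \<gamma> \<theta> / 2 - y" "\<gamma> \<theta> / 2 - y < pi" using f(1,2) y0 y1 by linarith+
  from this s0 have "\<gamma> \<theta> / 2 - y = 0" by (rule sin_eq_0_pi)
  then show ?thesis by (simp add: G_def y_def A_def)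
qed

text \<open>With N / q the argument of the arctangent, q^2 + N^2 = R, so q cancels. The numerator X
  of the inner derivative satisfies R + X = c, which collapses 1 + X / R to c / R.\<close>

lemma G_deriv: "(G has_real_derivative 2 * c / (c\<^sup>2 * (cos \<theta>)\<^sup>2 + (sin \<theta>)\<^sup>2)) (at \<theta>)"
proof -
  define S where "S = sin \<theta>"
  define D where "D = cos \<theta>"
  define N where "N = (1 - c) * (S * D)"
  have SD: "S\<^sup>2 + D\<^sup>2 = 1" by (simp add: S_def D_def)
  have q: "q \<theta> = c * D\<^sup>2 + S\<^sup>2" by (simp add: q_def S_def D_def)
  have qp: "0 < q \<theta>" by (rule q_pos)
  define R where "R = c\<^sup>2 * D\<^sup>2 + S\<^sup>2"
  have Rq: "(q \<theta>)\<^sup>2 + N\<^sup>2 = R" unfolding q N_def R_def using SD by algebra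
  have Rp: "0 < R" unfolding Rq[symmetric] using qp by (simp add: add_pos_nonneg)
  have "((\<lambda>x. (1 - c) * (sin x * cos x) / q x) has_real_derivative
      ((1 - c) * (D * D + S * (- S)) * q \<theta> - N * (c * (2 * D * (- S)) + 2 * S * D)) / (q \<theta> * q \<theta>)) (at \<theta>)"
    unfolding q_def S_def D_def N_def
    using q_pos[of \<theta>] by (auto intro!: derivative_eq_intros simp: q_def)
  then have "(G has_real_derivative 2 * 1 + 2 * (inverse (1 + (N / q \<theta>)\<^sup>2) *
      (((1 - c) * (D * D + S * (- S)) * q \<theta> - N * (c * (2 * D * (- S)) + 2 * S * D)) / (q \<theta> * q \<theta>)))) (at \<theta>)"
    using DERIV_add[OF DERIV_cmult[OF DERIV_ident, of 2 \<theta> UNIV] DERIV_cmult[OF DERIV_chain2[OF DERIV_arctan], of _ _ \<theta> UNIV 2]]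
    unfolding G_def[abs_def] N_def S_def D_def by blast
  moreover have "2 * 1 + 2 * (inverse (1 + (N / q \<theta>)\<^sup>2) *
      (((1 - c) * (D * D + S * (- S)) * q \<theta> - N * (c * (2 * D * (- S)) + 2 * S * D)) / (q \<theta> * q \<theta>))) = 2 * c / R"
  proof -
    define X where "X = (1 - c) * (D * D + S * (- S)) * q \<theta> - N * (c * (2 * D * (- S)) + 2 * S * D)"
    have "1 + (N / q \<theta>)\<^sup>2 = R / (q \<theta>)\<^sup>2"
      using qp by (simp add: Rq[symmetric] power_divide add_divide_distrib)
    then have "inverse (1 + (N / q \<theta>)\<^sup>2) * (X / (q \<theta> * q \<theta>)) = X / R"
      using qp by (simp add: power2_eq_square)
    moreover have "2 * 1 + 2 * (X / R) = 2 * c / R"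
    proof -
      have "R + X = c" unfolding R_def X_def q N_def using SD by algebra
      then show ?thesis using Rp by (simp add: field_simps)
    qed
    ultimately show ?thesis unfolding X_def by (simp only:)
  qed
  ultimately show ?thesis by (simp add: R_def S_def D_def)
qed

text \<open>Times the density sin / 2 of \<open>\<mu>\<close> this is the derivative of
  \<open>G\<close> over 2 \<pi>: it is the density of the angle under which the central angle is
  uniform on \<open>[0, 2 \<pi>]\<close>. It is unbounded near the tangential directions but
  integrable.\<close>

definition \<phi>0 :: "real \<Rightarrow> real" where
  "\<phi>0 \<theta> = 2 * c / (c\<^sup>2 * (cos \<theta>)\<^sup>2 + (sin \<theta>)\<^sup>2) / (pi * sin \<theta>)"

lemma \<phi>0_measurable [measurable]: "\<phi>0 \<in> borel_measurable borel"
  unfolding \<phi>0_def[abs_def] by measurable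

lemma G_measurable [measurable]: "G \<in> borel_measurable borel"
  by (intro borel_measurable_continuous_onI continuous_at_imp_continuous_on ballI DERIV_isCont[OF G_deriv])

lemma \<gamma>_measurable [measurable]: "\<gamma> \<in> borel_measurable borel"
proof -
  have "\<gamma> = (\<lambda>\<theta>. if \<theta> \<le> 0 then 0 else if \<theta> \<ge> pi then 2 * pi else G \<theta>)"
    by (auto simp: central_angle_def[of M r] fun_eq_iff central_angle_closed_form[symmetric])
  moreover have "(\<lambda>\<theta>. if \<theta> \<le> 0 then 0 else if \<theta> \<ge> pi then 2 * pi else G \<theta>) \<in> borel_measurable borel"
    by measurable
  ultimately show ?thesis by (simp only:)
qed

lemma B_eq: "B (s, \<theta>) = ((s + h * \<gamma> \<theta>) rmod L, \<theta>)"
  by (simp add: circular_billiard_def)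

text \<open>Substituting x = G \<theta> makes the displacement h x uniform over one turn of the
  circle, so the new position is uniform whatever the starting point s.\<close>

lemma \<phi>0_pushforward:
  fixes w :: "real \<Rightarrow> real"
  assumes [measurable]: "w \<in> borel_measurable borel" and w: "\<And>s. \<bar>w s\<bar> \<le> C"
  shows "integrable \<mu> (\<lambda>\<theta>. w (fst (B (s, \<theta>))) * \<phi>0 \<theta>)"
    and "(\<integral>\<theta>. w (fst (B (s, \<theta>))) * \<phi>0 \<theta> \<partial>\<mu>) = (\<integral>s. w s \<partial>unif L)"
proof -
  define g' where "g' \<theta> = 2 * c / (c\<^sup>2 * (cos \<theta>)\<^sup>2 + (sin \<theta>)\<^sup>2)" for \<theta>
  have den: "0 < c\<^sup>2 * (cos \<theta>)\<^sup>2 + (sin \<theta>)\<^sup>2" for \<theta>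
  proof (cases "cos \<theta> = 0")
    case True
    then have "(sin \<theta>)\<^sup>2 = 1" by (simp add: sin_squared_eq)
    then show ?thesis by (simp add: True)
  next
    case False
    then show ?thesis using c_pos by (simp add: add_pos_nonneg)
  qed
  have cont: "continuous_on A g'" for A
    unfolding g'_def using den by (intro continuous_intros) (auto simp: less_le)
  let ?f = "\<lambda>x. w ((s + h * x) rmod L)"
  have G0: "G 0 = 0" "G pi = 2 * pi" by (simp_all add: G_def)
  have int: "set_integrable lborel {G 0..G pi} ?f"
    unfolding set_integrable_def
    real_scaleR_def
    by (rule integrable_bounded_mult(2)[where C = C]) (use w in \<open>auto simp: emeasure_lborel_Icc_eq\<close>)
  have sub: "set_integrable lborel {0..pi} (\<lambda>x. ?f (G x) * g' x)"
    "(LBINT x. ?f x * indicator {G 0..G pi} x) = (LBINT x. ?f (G x) * g' x * indicator {0..pi} x)"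
  proof -
    have d: "(G has_real_derivative g' x) (at x)" "0 \<le> g' x" for x
      using G_deriv[of x] den[of x] c_pos by (simp_all add: g'_def)
    show "set_integrable lborel {0..pi} (\<lambda>x. ?f (G x) * g' x)"
      "(LBINT x. ?f x * indicator {G 0..G pi} x) = (LBINT x. ?f (G x) * g' x * indicator {0..pi} x)"
      by (rule integral_substitution[OF int d(1) cont d(2) pi_ge_zero])+
  qed
  \<comment> \<open>The two ends are left out, because the sine in the denominator of
    \<open>\<phi>0\<close> cancels only where it is nonzero.\<close>
  have ae: "AE \<theta> in lborel. w (fst (B (s, \<theta>))) * \<phi>0 \<theta> * (indicator {0..pi} \<theta> * sin \<theta> / 2)
      = (?f (G \<theta>) * g' \<theta> * indicator {0..pi} \<theta>) / (2 * pi)"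
    using AE_lborel_singleton[of 0] AE_lborel_singleton[of pi]
  proof eventually_elim
    case (elim \<theta>)
    show ?case
    proof (cases "\<theta> \<in> {0..pi}")
      case True
      then have "sin \<theta> \<noteq> 0" using elim sin_gt_zero[of \<theta>] by auto
      moreover have "fst (B (s, \<theta>)) = (s + h * G \<theta>) rmod L"
        using True by (simp add: B_eq central_angle_closed_form)
      ultimately show ?thesis using True by (simp add: \<phi>0_def g'_def)
    qed simp
  qed
  have g'm [measurable]: "g' \<in> borel_measurable borel" unfolding g'_def[abs_def] by measurable
  have Bm [measurable]: "(\<lambda>\<theta>. fst (B (s, \<theta>))) \<in> borel_measurable borel"
    by (simp add: B_eq)
  have "integrable lborel (\<lambda>\<theta>. (?f (G \<theta>) * g' \<theta> * indicator {0..pi} \<theta>) / (2 * pi))"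
    using sub(1) by (simp add: set_integrable_def mult_ac)
  then have "integrable lborel (\<lambda>\<theta>. w (fst (B (s, \<theta>))) * \<phi>0 \<theta> * (indicator {0..pi} \<theta> * sin \<theta> / 2))"
    by (subst integrable_cong_AE[OF _ _ ae]) simp_all
  then show "integrable \<mu> (\<lambda>\<theta>. w (fst (B (s, \<theta>))) * \<phi>0 \<theta>)"
    by (subst integrable_\<mu>) auto
  have "(\<integral>\<theta>. w (fst (B (s, \<theta>))) * \<phi>0 \<theta> \<partial>\<mu>) = (LBINT \<theta>. (?f (G \<theta>) * g' \<theta> * indicator {0..pi} \<theta>) / (2 * pi))"
    by (subst integral_\<mu>; (rule integral_cong_AE[OF _ _ ae])?; measurable)
  also have "\<dots> = (LBINT x. ?f x * indicator {0..2 * pi} x) / (2 * pi)"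
    using sub(2) G0 by simp
  also have "\<dots> = (LBINT y. w ((s + y) rmod L) * indicator {0..L} y) / L"
  proof -
    have "(LBINT y. w ((s + y) rmod L) * indicator {0..L} y)
        = h * (LBINT x. w ((s + h * x) rmod L) * indicator {0..L} (h * x))"
      using lborel_integral_real_affine[of h "\<lambda>y. w ((s + y) rmod L) * indicator {0..L} y" 0] h_pos by simp
    also have "(LBINT x. w ((s + h * x) rmod L) * indicator {0..L} (h * x)) = (LBINT x. ?f x * indicator {0..2 * pi} x)"
      using h_pos by (intro Bochner_Integration.integral_cong)
        (auto simp: indicator_def circle_length_def zero_le_mult_iff mult.commute[of h])
    finally show ?thesis using h_pos by (simp add: circle_length_def)
  qed
  also have "\<dots> = (\<integral>y. w ((y + s) rmod L) \<partial>unif L)"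
    using L_pos by (subst integral_unif) (auto simp: add.commute)
  also have "\<dots> = (\<integral>s. w s \<partial>unif L)" by (rule integral_unif_rotation[OF L_pos]) measurable
  finally show "(\<integral>\<theta>. w (fst (B (s, \<theta>))) * \<phi>0 \<theta> \<partial>\<mu>) = (\<integral>s. w s \<partial>unif L)" .
qed

end

section \<open>Decay of the energy\<close>

text \<open>The variance is half the mean square distance of two independent copies.\<close>

lemma variance_identity:
  fixes p u :: "nat \<Rightarrow> real"
  assumes "p 1 + p 2 + p 3 + p 4 = 1"
  shows "(\<Sum>i\<in>{1..4}. p i * (u i)\<^sup>2) - (\<Sum>i\<in>{1..4}. p i * u i)\<^sup>2
    = (\<Sum>i\<in>{1..4}. \<Sum>j\<in>{1..4}. p i * p j * (u i - u j)\<^sup>2) / 2"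
proof -
  have p4: "p 4 = 1 - p 1 - p 2 - p 3" using assms by linarith
  show ?thesis unfolding sum_index p4 by (simp add: power2_eq_square algebra_simps)
qed

text \<open>From |d| \<le> t + d^2 / t for every t > 0: a small t is fixed first, then n is taken
  large.\<close>

lemma null_abs_of_null_square:
  fixes w :: "'a \<Rightarrow> real" and d :: "nat \<Rightarrow> 'a \<Rightarrow> real"
  assumes "finite_measure M" and [measurable]: "w \<in> borel_measurable M" "\<And>n. d n \<in> borel_measurable M"
    and w: "\<And>x. 0 \<le> w x" "\<And>x. w x \<le> 1" and d: "\<And>n x. \<bar>d n x\<bar> \<le> C"
    and null: "(\<lambda>n. \<integral>x. w x * (d n x)\<^sup>2 \<partial>M) \<longlonglongrightarrow> 0"
  shows "(\<lambda>n. \<integral>x. w x * \<bar>d n x\<bar> \<partial>M) \<longlonglongrightarrow> 0"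
proof (rule LIMSEQ_I)
  interpret finite_measure M by fact
  fix e :: real assume e: "0 < e"
  \<comment> \<open>The summand 1 keeps m positive for the zero measure, so that t below is well
    defined.\<close>
  define m where "m = measure M (space M) + 1"
  have m: "0 < m" "measure M (space M) \<le> m" by (simp_all add: m_def add_nonneg_pos)
  define t where "t = e / (2 * m)"
  have t: "0 < t" using e m by (simp add: t_def)
  from LIMSEQ_D[OF null, of "t * e / 2"] e t obtain N
    where N: "\<And>n. n \<ge> N \<Longrightarrow> \<bar>\<integral>x. w x * (d n x)\<^sup>2 \<partial>M\<bar> < t * e / 2" by auto
  show "\<exists>N. \<forall>n\<ge>N. norm ((\<integral>x. w x * \<bar>d n x\<bar> \<partial>M) - 0) < e"
  proof (intro exI allI impI)
    fix n assume n: "N \<le> n"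
    have C0: "0 \<le> C" using d[of 0 undefined] by linarith
    have i2: "integrable M (\<lambda>x. w x * (d n x)\<^sup>2)"
    proof (rule integrable_const_bound[of _ "C\<^sup>2"], rule AE_I2)
      fix x
      have "(d n x)\<^sup>2 \<le> C\<^sup>2" using d[of n x] by (simp add: abs_le_square_iff[symmetric] C0)
      then show "norm (w x * (d n x)\<^sup>2) \<le> C\<^sup>2"
        using mult_mono[OF w(2)[of x], of "(d n x)\<^sup>2" "C\<^sup>2"] w(1)[of x] by (simp add: abs_mult)
    qed simp
    have i1: "integrable M (\<lambda>x. w x * \<bar>d n x\<bar>)"
    proof (rule integrable_const_bound[of _ C], rule AE_I2)
      fix x show "norm (w x * \<bar>d n x\<bar>) \<le> C"
        using mult_mono[OF w(2)[of x] d[of n x]] w(1)[of x] by (simp add: abs_mult)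
    qed simp
    have "(\<integral>x. w x * \<bar>d n x\<bar> \<partial>M) \<le> (\<integral>x. t + (w x * (d n x)\<^sup>2) / t \<partial>M)"
    proof (rule integral_mono[OF i1])
      show "integrable M (\<lambda>x. t + (w x * (d n x)\<^sup>2) / t)" using i2 by simp
      fix x
      have "\<bar>d n x\<bar> \<le> t + (d n x)\<^sup>2 / t"
      proof (cases "\<bar>d n x\<bar> \<le> t")
        case True
        moreover have "0 \<le> (d n x)\<^sup>2 / t" using t by simp
        ultimately show ?thesis by linarith
      next
        case False
        then have "\<bar>d n x\<bar> * t \<le> \<bar>d n x\<bar> * \<bar>d n x\<bar>" by (intro mult_left_mono) auto
        then have "\<bar>d n x\<bar> \<le> (d n x)\<^sup>2 / t" using t by (simp add: field_simps power2_eq_square)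
        then show ?thesis using t by linarith
      qed
      then have "w x * \<bar>d n x\<bar> \<le> w x * (t + (d n x)\<^sup>2 / t)" using w by (intro mult_left_mono) auto
      also have "\<dots> = w x * t + (w x * (d n x)\<^sup>2) / t" by (simp add: distrib_left)
      also have "\<dots> \<le> t + (w x * (d n x)\<^sup>2) / t" using w(2)[of x] t by (simp add: mult_le_cancel_right1)
      finally show "w x * \<bar>d n x\<bar> \<le> t + (w x * (d n x)\<^sup>2) / t" .
    qed
    also have "\<dots> = t * measure M (space M) + (\<integral>x. w x * (d n x)\<^sup>2 \<partial>M) / t"
      using i2 by simp
    also have "\<dots> < t * m + e / 2"
    proof -
      have "t * measure M (space M) \<le> t * m" using t m by simp
      moreover have "(\<integral>x. w x * (d n x)\<^sup>2 \<partial>M) / t < e / 2" using N[OF n] t by (simp add: field_simps)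
      ultimately show ?thesis by linarith
    qed
    also have "\<dots> = e" using m by (simp add: t_def)
    finally have "(\<integral>x. w x * \<bar>d n x\<bar> \<partial>M) < e" .
    moreover have "0 \<le> (\<integral>x. w x * \<bar>d n x\<bar> \<partial>M)" using w by (intro integral_nonneg_AE) auto
    ultimately show "norm ((\<integral>x. w x * \<bar>d n x\<bar> \<partial>M) - 0) < e" by simp
  qed
qed

section \<open>The phase space, the billiard map and the averaging operator\<close>

context feres_billiard
begin

definition \<nu> :: "(real \<times> real) measure" where "\<nu> = unif L \<Otimes>\<^sub>M \<mu>"

lemma sets_\<nu> [measurable_cong]: "sets \<nu> = sets (borel \<Otimes>\<^sub>M borel)"
  unfolding \<nu>_def by (intro sets_pair_measure_cong) simp_all

lemma space_\<nu> [simp]: "space \<nu> = UNIV" by (simp add: \<nu>_def space_pair_measure)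

lemma finite_unif_L: "finite_measure (unif L)" using L_pos by (rule finite_measure_unif)

lemma finite_\<nu>: "finite_measure \<nu>"
  unfolding \<nu>_def by (intro finite_measure_pair_measure finite_unif_L finite_measure_\<mu>)

sublocale \<nu>: finite_measure \<nu> by (rule finite_\<nu>)

lemma Fubini_\<nu>:
  fixes u :: "real \<times> real \<Rightarrow> real"
  assumes u: "u \<in> borel_measurable (borel \<Otimes>\<^sub>M borel)" "\<And>y. \<bar>u y\<bar> \<le> C"
  shows "integrable \<nu> u"
    and "(\<integral>y. u y \<partial>\<nu>) = (\<integral>s. \<integral>\<theta>. u (s, \<theta>) \<partial>\<mu> \<partial>unif L)"
    and "(\<integral>y. u y \<partial>\<nu>) = (\<integral>\<theta>. \<integral>s. u (s, \<theta>) \<partial>unif L \<partial>\<mu>)"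
proof -
  have "u \<in> borel_measurable (unif L \<Otimes>\<^sub>M \<mu>)" using u(1) sets_\<nu> by (simp add: \<nu>_def cong: measurable_cong_sets)
  note * = Fubini_bounded[OF finite_unif_L finite_measure_\<mu> this u(2)]
  show "integrable \<nu> u" "(\<integral>y. u y \<partial>\<nu>) = (\<integral>s. \<integral>\<theta>. u (s, \<theta>) \<partial>\<mu> \<partial>unif L)"
    "(\<integral>y. u y \<partial>\<nu>) = (\<integral>\<theta>. \<integral>s. u (s, \<theta>) \<partial>unif L \<partial>\<mu>)"
    using * by (auto simp: \<nu>_def)
qed

lemma measure_\<nu>_UNIV: "measure \<nu> UNIV = 1"
proof -
  have "(\<integral>y. 1 \<partial>\<nu>) = (\<integral>s. \<integral>\<theta>. (1 :: real) \<partial>\<mu> \<partial>unif L)" by (rule Fubini_\<nu>(2)[of "\<lambda>_. 1" 1]) auto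
  then show ?thesis using measure_\<mu>_UNIV measure_unif_UNIV[OF L_pos] by simp
qed

lemma AE_\<nu>: "AE y in \<nu>. fst y \<in> {0..<L} \<and> snd y \<in> {0<..<pi}"
proof -
  interpret U: finite_measure "unif L" by (rule finite_unif_L)
  interpret \<mu>: finite_measure \<mu> by (rule finite_measure_\<mu>)
  interpret pair_sigma_finite "unif L" \<mu> ..
  have 1: "AE s in unif L. s \<in> {0..<L}"
    using L_pos AE_lborel_singleton[of L] by (subst AE_uniform_measure) (auto elim!: eventually_mono)
  have m: "{y. fst y \<in> {0..<L} \<and> snd y \<in> {0<..<pi}} \<in> sets (unif L \<Otimes>\<^sub>M \<mu>)"
  proof -
    have "{y. fst y \<in> {0..<L} \<and> snd y \<in> {0<..<pi}} = {0..<L} \<times> {0<..<pi}" by auto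
    then show ?thesis by simp
  qed
  show ?thesis
    unfolding \<nu>_def
  proof (rule AE_pair_measure)
    show "{x \<in> space (unif L \<Otimes>\<^sub>M \<mu>). fst x \<in> {0..<L} \<and> snd x \<in> {0<..<pi}} \<in> sets (unif L \<Otimes>\<^sub>M \<mu>)"
      using m by (simp add: space_pair_measure)
    show "AE x in unif L. AE y in \<mu>. fst (x, y) \<in> {0..<L} \<and> snd (x, y) \<in> {0<..<pi}"
      using 1 by eventually_elim (use AE_\<mu> in \<open>auto elim!: eventually_mono\<close>)
  qed
qed

definition Binv :: "real \<times> real \<Rightarrow> real \<times> real" where
  "Binv = (\<lambda>(s, \<theta>). ((s - h * \<gamma> \<theta>) rmod L, \<theta>))"

lemma B_measurable [measurable]: "B \<in> borel \<Otimes>\<^sub>M borel \<rightarrow>\<^sub>M borel \<Otimes>\<^sub>M borel"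
  unfolding circular_billiard_def by measurable

lemma Binv_measurable [measurable]: "Binv \<in> borel \<Otimes>\<^sub>M borel \<rightarrow>\<^sub>M borel \<Otimes>\<^sub>M borel"
  unfolding Binv_def by measurable

lemma snd_B [simp]: "snd (B y) = snd y" and snd_Binv [simp]: "snd (Binv y) = snd y"
  by (simp_all add: circular_billiard_def Binv_def split: prod.splits)

lemma Binv_B: "fst y \<in> {0..<L} \<Longrightarrow> Binv (B y) = y"
  by (cases y) (auto simp: Binv_def B_eq rmod_add_left[of _ _ "- _", simplified] rmod_idem abs_of_pos[OF L_pos])

text \<open>For fixed \<theta> the billiard map rotates the circle, which preserves the uniform law.
  \<open>Binv\<close> undoes it for positions in \<open>[0, L)\<close>, hence almost
  everywhere.\<close>

lemma integral_B:
  fixes u \<psi> :: "real \<times> real \<Rightarrow> real"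
  assumes [measurable]: "u \<in> borel_measurable (borel \<Otimes>\<^sub>M borel)" "\<psi> \<in> borel_measurable (borel \<Otimes>\<^sub>M borel)"
    and bd: "\<And>y. \<bar>u y\<bar> \<le> C" "\<And>y. \<bar>\<psi> y\<bar> \<le> D"
  shows "(\<integral>y. u (B y) * \<psi> y \<partial>\<nu>) = (\<integral>y. u y * \<psi> (Binv y) \<partial>\<nu>)"
proof -
  have C: "\<bar>u y * \<psi> z\<bar> \<le> C * D" for y z
    unfolding abs_mult using bd(1)[of y] bd(2)[of z] by (intro mult_mono) auto
  have "(\<integral>y. u (B y) * \<psi> y \<partial>\<nu>) = (\<integral>y. u (B y) * \<psi> (Binv (B y)) \<partial>\<nu>)"
  proof (rule integral_cong_AE)
    show "AE y in \<nu>. u (B y) * \<psi> y = u (B y) * \<psi> (Binv (B y))"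
      using AE_\<nu> by eventually_elim (simp add: Binv_B)
  qed measurable
  also have "\<dots> = (\<integral>\<theta>. \<integral>s. u (B (s, \<theta>)) * \<psi> (Binv (B (s, \<theta>))) \<partial>unif L \<partial>\<mu>)"
    by (rule Fubini_\<nu>(3)[of _ "C * D"]) (auto intro: C)
  also have "\<dots> = (\<integral>\<theta>. \<integral>s. u (s, \<theta>) * \<psi> (Binv (s, \<theta>)) \<partial>unif L \<partial>\<mu>)"
  proof (rule Bochner_Integration.integral_cong[OF refl])
    fix \<theta>
    show "(\<integral>s. u (B (s, \<theta>)) * \<psi> (Binv (B (s, \<theta>))) \<partial>unif L) = (\<integral>s. u (s, \<theta>) * \<psi> (Binv (s, \<theta>)) \<partial>unif L)"
      unfolding B_eq
      by (rule integral_unif_rotation[OF L_pos, where w = "\<lambda>s. u (s, \<theta>) * \<psi> (Binv (s, \<theta>))"]) measurable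
  qed
  also have "\<dots> = (\<integral>y. u y * \<psi> (Binv y) \<partial>\<nu>)"
    by (rule Fubini_\<nu>(3)[symmetric, of _ "C * D"]) (auto intro: C)
  finally show ?thesis .
qed

lemma integral_B':
  fixes u :: "real \<times> real \<Rightarrow> real"
  assumes "u \<in> borel_measurable (borel \<Otimes>\<^sub>M borel)" "\<And>y. \<bar>u y\<bar> \<le> C"
  shows "(\<integral>y. u (B y) \<partial>\<nu>) = (\<integral>y. u y \<partial>\<nu>)"
  using integral_B[OF assms(1) _ assms(2), of "\<lambda>_. 1" 1] by simp

lemma integral_P:
  fixes u :: "real \<times> real \<Rightarrow> real"
  assumes [measurable]: "u \<in> borel_measurable (borel \<Otimes>\<^sub>M borel)" and bd: "\<And>y. \<bar>u y\<bar> \<le> C" and i: "i \<in> {1..4}"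
  shows "(\<integral>y. P i (snd y) * u y \<partial>\<nu>) = (\<integral>y. P (dual i) (snd y) * u (fst y, T (dual i) (snd y)) \<partial>\<nu>)"
proof -
  have di: "dual i \<in> {1..4}" using i by (auto simp: dual_def)
  have C: "\<bar>P i (snd y) * u z\<bar> \<le> C" if "i \<in> {1..4}" for i y z
    using mult_mono[OF P_le_1[OF that, of "snd y"] bd[of z]] P_nonneg[OF that, of "snd y"] by (simp add: abs_mult)
  have "(\<integral>y. P i (snd y) * u y \<partial>\<nu>) = (\<integral>s. \<integral>\<theta>. P i \<theta> * u (s, \<theta>) \<partial>\<mu> \<partial>unif L)"
    by (subst Fubini_\<nu>(2)[of _ C]) (auto intro: C[OF i])
  also have "\<dots> = (\<integral>s. \<integral>\<theta>. P (dual i) \<theta> * u (s, T (dual i) \<theta>) \<partial>\<mu> \<partial>unif L)"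
    by (intro Bochner_Integration.integral_cong[OF refl] integral_P_\<mu>[OF _ i]) measurable
  also have "\<dots> = (\<integral>y. P (dual i) (snd y) * u (fst y, T (dual i) (snd y)) \<partial>\<nu>)"
    by (subst Fubini_\<nu>(2)[of _ C]) (auto intro: C[OF di])
  finally show ?thesis .
qed

definition Q :: "(real \<times> real \<Rightarrow> real) \<Rightarrow> real \<times> real \<Rightarrow> real" where
  "Q u y = (\<Sum>i\<in>{1..4}. P i (snd y) * u (fst y, T i (snd y)))"

lemma Q_measurable [measurable]:
  assumes [measurable]: "u \<in> borel_measurable (borel \<Otimes>\<^sub>M borel)"
  shows "Q u \<in> borel_measurable (borel \<Otimes>\<^sub>M borel)"
  unfolding Q_def[abs_def] by (intro borel_measurable_sum) measurable

lemma P_sum': "(\<Sum>i\<in>{1..4}. P i \<theta>) = 1"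
  using P_sum[of \<theta>] by (simp only: sum_index)

lemma Q_bound:
  assumes "\<And>y. \<bar>u y\<bar> \<le> C" shows "\<bar>Q u y\<bar> \<le> C"
proof -
  have "\<bar>Q u y\<bar> \<le> (\<Sum>i\<in>{1..4}. \<bar>P i (snd y) * u (fst y, T i (snd y))\<bar>)" unfolding Q_def by (rule sum_abs)
  also have "\<dots> \<le> (\<Sum>i\<in>{1..4}. P i (snd y) * C)"
    using assms P_nonneg by (intro sum_mono) (auto simp: abs_mult intro!: mult_left_mono)
  also have "\<dots> = C" by (simp only: sum_distrib_right[symmetric] P_sum' mult_1_left)
  finally show ?thesis .
qed

text \<open>Self-adjointness, the operator form of reversibility: branch i on the left becomes
  branch \<open>dual i\<close> on the right, and \<open>dual\<close> permutes the indices.\<close>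

lemma integral_Q_mult:
  fixes u \<psi> :: "real \<times> real \<Rightarrow> real"
  assumes [measurable]: "u \<in> borel_measurable (borel \<Otimes>\<^sub>M borel)" "\<psi> \<in> borel_measurable (borel \<Otimes>\<^sub>M borel)"
    and bd: "\<And>y. \<bar>u y\<bar> \<le> C" "\<And>y. \<bar>\<psi> y\<bar> \<le> D"
  shows "(\<integral>y. Q u y * \<psi> y \<partial>\<nu>) = (\<integral>y. u y * Q \<psi> y \<partial>\<nu>)"
proof -
  have C: "\<bar>u y * \<psi> z\<bar> \<le> C * D" for y z
    unfolding abs_mult using bd(1)[of y] bd(2)[of z] by (intro mult_mono) auto
  have PC: "\<bar>P i (snd y) * (u x * \<psi> z)\<bar> \<le> C * D" if "i \<in> {1..4}" for i x y z
    using mult_mono[OF P_le_1[OF that, of "snd y"] C[of x z]] P_nonneg[OF that, of "snd y"] by (simp add: abs_mult)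
  have "(\<integral>y. Q u y * \<psi> y \<partial>\<nu>) = (\<integral>y. (\<Sum>i\<in>{1..4}. P i (snd y) * (u (fst y, T i (snd y)) * \<psi> y)) \<partial>\<nu>)"
    by (simp only: Q_def sum_distrib_right mult.assoc)
  also have "\<dots> = (\<Sum>i\<in>{1..4}. \<integral>y. P i (snd y) * (u (fst y, T i (snd y)) * \<psi> y) \<partial>\<nu>)"
    by (intro Bochner_Integration.integral_sum Fubini_\<nu>(1)[of _ "C * D"]) (auto intro: PC)
  also have "\<dots> = (\<Sum>i\<in>{1..4}. \<integral>y. P (dual i) (snd y) * (u y * \<psi> (fst y, T (dual i) (snd y))) \<partial>\<nu>)"
  proof (intro sum.cong refl)
    fix i :: nat assume i: "i \<in> {1..4}"
    show "(\<integral>y. P i (snd y) * (u (fst y, T i (snd y)) * \<psi> y) \<partial>\<nu>)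
      = (\<integral>y. P (dual i) (snd y) * (u y * \<psi> (fst y, T (dual i) (snd y))) \<partial>\<nu>)"
      by (subst integral_P[OF _ _ i, where C = "C * D"]) (auto simp: T_dual'[OF i] intro: C)
  qed
  also have "\<dots> = (\<Sum>i\<in>{1..4}. \<integral>y. P i (snd y) * (u y * \<psi> (fst y, T i (snd y))) \<partial>\<nu>)"
    by (rule sum.reindex_bij_betw[OF bij_betw_dual])
  also have "\<dots> = (\<integral>y. (\<Sum>i\<in>{1..4}. P i (snd y) * (u y * \<psi> (fst y, T i (snd y)))) \<partial>\<nu>)"
    by (intro Bochner_Integration.integral_sum[symmetric] Fubini_\<nu>(1)[of _ "C * D"]) (auto intro: PC)
  also have "\<dots> = (\<integral>y. u y * Q \<psi> y \<partial>\<nu>)"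
    by (simp only: Q_def sum_distrib_left mult_ac)
  finally show ?thesis .
qed

lemma integral_Q:
  fixes u :: "real \<times> real \<Rightarrow> real"
  assumes "u \<in> borel_measurable (borel \<Otimes>\<^sub>M borel)" "\<And>y. \<bar>u y\<bar> \<le> C"
  shows "(\<integral>y. Q u y \<partial>\<nu>) = (\<integral>y. u y \<partial>\<nu>)"
proof -
  have "Q (\<lambda>_. 1) y = 1" for y using P_sum'[of "snd y"] by (simp add: Q_def)
  then show ?thesis using integral_Q_mult[OF assms(1) _ assms(2), of "\<lambda>_. 1" 1] by simp
qed

end

section \<open>Weak convergence on the phase space of the billiard\<close>

text \<open>The weight has no positive lower bound on its support. The cut-off min 1 (i w) is
  dominated by i w, so it yields a null sequence for each i, and it tends in L1 to the indicator of
  the support.\<close>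

lemma null_of_positive_weight:
  fixes w :: "'a \<Rightarrow> real" and d :: "nat \<Rightarrow> 'a \<Rightarrow> real"
  assumes "finite_measure M" and [measurable]: "w \<in> borel_measurable M" "\<And>n. d n \<in> borel_measurable M"
    and w: "\<And>x. 0 \<le> w x" "\<And>x. w x \<le> 1" and d: "\<And>n x. \<bar>d n x\<bar> \<le> C"
    and null: "(\<lambda>n. \<integral>x. w x * \<bar>d n x\<bar> \<partial>M) \<longlonglongrightarrow> 0"
  shows "(\<lambda>n. \<integral>x. \<bar>d n x\<bar> * indicator {x\<in>space M. 0 < w x} x \<partial>M) \<longlonglongrightarrow> 0"
proof -
  interpret finite_measure M by fact
  have C: "0 \<le> C" using d[of 0 undefined] by linarith
  show ?thesis
  proof (rule weak_limit_in_L1[where k = "\<lambda>n x. \<bar>d n x\<bar>" and s = "\<lambda>i x. min 1 (real i * w x)" and g = "\<lambda>_. 1"])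
    show "integrable M (\<lambda>x. min 1 (real i * w x))" for i
      using w(1) by (intro integrable_const_bound[of _ 1] AE_I2) auto
    show "(\<lambda>n. \<integral>x. \<bar>d n x\<bar> * min 1 (real i * w x) \<partial>M) \<longlonglongrightarrow> 0" for i
    proof (rule tendsto_sandwich[of "\<lambda>_. 0"])
      show "(\<lambda>n. real i * (\<integral>x. w x * \<bar>d n x\<bar> \<partial>M)) \<longlonglongrightarrow> 0"
        using null by (rule tendsto_mult_right_zero)
      show "\<forall>\<^sub>F n in sequentially. 0 \<le> (\<integral>x. \<bar>d n x\<bar> * min 1 (real i * w x) \<partial>M)"
        using w(1) by (intro always_eventually allI integral_nonneg_AE AE_I2) simp
      have "(\<integral>x. \<bar>d n x\<bar> * min 1 (real i * w x) \<partial>M) \<le> (\<integral>x. real i * (w x * \<bar>d n x\<bar>) \<partial>M)" for n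
      proof (rule integral_mono)
        have "\<bar>d n x\<bar> * min 1 (real i * w x) \<le> C * 1" for x
          using d[of n x] w(1)[of x] C by (intro mult_mono) auto
        then show "integrable M (\<lambda>x. \<bar>d n x\<bar> * min 1 (real i * w x))"
          using w(1) by (intro integrable_const_bound[of _ C] AE_I2) (auto simp: abs_mult)
        have "w x * \<bar>d n x\<bar> \<le> 1 * C" for x
          using d[of n x] w[of x] by (intro mult_mono) auto
        then have "integrable M (\<lambda>x. w x * \<bar>d n x\<bar>)"
          using w(1) by (intro integrable_const_bound[of _ C] AE_I2) (auto simp: abs_mult)
        then show "integrable M (\<lambda>x. real i * (w x * \<bar>d n x\<bar>))" by simp
        fix x
        have "\<bar>d n x\<bar> * min 1 (real i * w x) \<le> \<bar>d n x\<bar> * (real i * w x)" by (intro mult_left_mono) auto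
        then show "\<bar>d n x\<bar> * min 1 (real i * w x) \<le> real i * (w x * \<bar>d n x\<bar>)" by (simp add: mult_ac)
      qed
      then show "\<forall>\<^sub>F n in sequentially. (\<integral>x. \<bar>d n x\<bar> * min 1 (real i * w x) \<partial>M) \<le> real i * (\<integral>x. w x * \<bar>d n x\<bar> \<partial>M)"
        by (intro always_eventually allI) simp
    qed simp
    fix x assume x: "x \<in> space M"
    show "(\<lambda>i. min 1 (real i * w x)) \<longlonglongrightarrow> indicator {x \<in> space M. 0 < w x} x"
    proof (cases "0 < w x")
      case True
      obtain k :: nat where k: "1 / w x < real k" using reals_Archimedean2 by blast
      have "min 1 (real i * w x) = 1" if "k \<le> i" for i
      proof -
        have "1 < real k * w x" using k True by (simp add: divide_less_eq)
        also have "\<dots> \<le> real i * w x" using that True by (intro mult_right_mono) auto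
        finally show ?thesis by simp
      qed
      then have "\<forall>\<^sub>F i in sequentially. min 1 (real i * w x) = 1"
        by (auto simp: eventually_sequentially)
      then show ?thesis using True x by (simp add: tendsto_eventually)
    next
      case False
      then have "w x = 0" using w(1)[of x] by linarith
      then show ?thesis by simp
    qed
    show "\<bar>min 1 (real i * w x)\<bar> \<le> 1" for i using w(1)[of x] by simp
  next
    show "integrable M (\<lambda>x. indicator {x \<in> space M. 0 < w x} x :: real)"
      by (intro integrable_const_bound[of _ 1] AE_I2) (auto simp: indicator_def)
  qed (use d in auto)
qed

section \<open>Intervals of angles on which two branches compete\<close>

context feres
begin

lemma P_pos_of_wt_pos: "i \<in> {1..4} \<Longrightarrow> 0 < wt i \<theta> \<Longrightarrow> 0 < P i \<theta>"
  using P_nonneg[of i \<theta>] by (cases "P i \<theta> = 0") (auto simp: wt_def)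

lemma P_1_pos: assumes "0 < \<theta>" "\<theta> < pi - 2 * \<alpha>" shows "0 < P 1 \<theta>"
proof -
  have "0 < sin \<theta>" "0 < sin (\<theta> + \<alpha>)" "0 < sin (\<theta> + 2 * \<alpha>)" using assms \<alpha> by (auto intro!: sin_gt_zero)
  then have "0 < 2 * wt 1 \<theta>" using assms cos_pos(1) unfolding wt_1 by simp
  then show ?thesis by (intro P_pos_of_wt_pos) auto
qed

lemma P_3_pos: assumes "2 * \<alpha> < \<theta>" "\<theta> < pi" shows "0 < P 3 \<theta>"
proof -
  have "0 < sin \<theta>" "0 < sin (\<theta> - \<alpha>)" "0 < sin (\<theta> - 2 * \<alpha>)" using assms \<alpha> by (auto intro!: sin_gt_zero)
  then have "0 < 2 * wt 3 \<theta>" using assms cos_pos(1) unfolding wt_3 by simp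
  then show ?thesis by (intro P_pos_of_wt_pos) auto
qed

text \<open>One half is read off \<open>wt_2\<close>; the other is its mirror image under detailed
  balance.\<close>

lemma P_2_pos: assumes "pi - 3 * \<alpha> < \<theta>" "\<theta> < pi - \<alpha>" shows "0 < P 2 \<theta>"
proof -
  have *: "0 < wt 2 \<theta>" if "pi - 2 * \<alpha> \<le> \<theta>" "\<theta> < pi - \<alpha>" for \<theta>
  proof -
    have "0 < sin (\<theta> + \<alpha>)" using that \<alpha> by (intro sin_gt_zero) linarith+
    then have "0 < 2 * wt 2 \<theta>" using that \<alpha> cos_pos(1) unfolding wt_2 by simp
    then show ?thesis by simp
  qed
  have "0 < wt 2 \<theta>"
    using *[of \<theta>] *[of "- \<theta> + 2 * pi - 4 * \<alpha>"] wt_dual_2[of \<theta>] assms by (cases "pi - 2 * \<alpha> \<le> \<theta>") auto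
  then show ?thesis by (intro P_pos_of_wt_pos) auto
qed

lemma P_4_pos: assumes "\<alpha> < \<theta>" "\<theta> < 3 * \<alpha>" shows "0 < P 4 \<theta>"
proof -
  have *: "0 < wt 4 \<theta>" if t: "\<alpha> < \<theta>" "\<theta> \<le> 2 * \<alpha>" for \<theta>
  proof -
    have "0 < sin (\<theta> - \<alpha>)" using that \<alpha> by (intro sin_gt_zero) linarith+
    then have "0 < 2 * wt 4 \<theta>" using that \<alpha> cos_pos(1) unfolding wt_4 by (cases "\<theta> = 2 * \<alpha>") simp_all
    then show ?thesis by simp
  qed
  have "0 < wt 4 \<theta>"
    using *[of \<theta>] *[of "- \<theta> + 4 * \<alpha>"] wt_dual_4[of \<theta>] assms by (cases "\<theta> \<le> 2 * \<alpha>") auto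
  then show ?thesis by (intro P_pos_of_wt_pos) auto
qed

text \<open>Inside \<open>[a, b]\<close> the product of both probabilities with the density of
  \<open>\<mu>\<close> can vanish only at the ends, so \<open>null_of_positive_weight\<close>
  removes it and leaves Lebesgue measure.\<close>

lemma null_on_interval:
  fixes d :: "nat \<Rightarrow> real \<Rightarrow> real"
  assumes [measurable]: "\<And>n. d n \<in> borel_measurable borel" and d: "\<And>n x. \<bar>d n x\<bar> \<le> C"
    and ij: "i \<in> {1..4}" "j \<in> {1..4}"
    and null: "(\<lambda>n. \<integral>\<theta>. P i \<theta> * P j \<theta> * \<bar>d n \<theta>\<bar> \<partial>\<mu>) \<longlonglongrightarrow> 0"
    and ab: "\<And>\<theta>. a < \<theta> \<Longrightarrow> \<theta> < b \<Longrightarrow> 0 < \<theta> \<and> \<theta> < pi \<and> 0 < P i \<theta> \<and> 0 < P j \<theta>"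
  shows "(\<lambda>n. \<integral>\<^sup>+\<theta>\<in>{a..b}. ennreal \<bar>d n \<theta>\<bar> \<partial>lborel) \<longlonglongrightarrow> 0"
proof (rule ennreal_null_le)
  define w where "w \<theta> = P i \<theta> * P j \<theta> * (indicator {0..pi} \<theta> * sin \<theta> / 2)" for \<theta>
  have [measurable]: "w \<in> borel_measurable borel" unfolding w_def[abs_def] by measurable
  have w: "0 \<le> w \<theta>" "w \<theta> \<le> 1" for \<theta>
  proof -
    have 1: "0 \<le> P i \<theta> * P j \<theta>" "P i \<theta> * P j \<theta> \<le> 1 * 1"
      using ij P_nonneg P_le_1 by (intro mult_nonneg_nonneg mult_mono; auto)+
    show "0 \<le> w \<theta>" unfolding w_def by (rule mult_nonneg_nonneg[OF 1(1) indicator_sin_nonneg])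
    have "indicator {0..pi} \<theta> * sin \<theta> / 2 \<le> 1"
      using order_trans[OF sin_le_one[of \<theta>], of 2] by (simp add: indicator_def)
    from mult_mono[OF 1(2) this _ indicator_sin_nonneg] have "w \<theta> \<le> 1 * 1 * 1" unfolding w_def by simp
    then show "w \<theta> \<le> 1" by simp
  qed
  interpret finite_measure "unif pi" by (rule finite_measure_unif) simp
  have "(\<integral>\<theta>. w \<theta> * \<bar>d n \<theta>\<bar> \<partial>unif pi) = (\<integral>\<theta>. P i \<theta> * P j \<theta> * \<bar>d n \<theta>\<bar> \<partial>\<mu>) / pi" for n
    by (subst integral_unif, simp, measurable, subst integral_\<mu>, measurable)
      (auto simp: w_def indicator_def intro!: Bochner_Integration.integral_cong arg_cong[of _ _ "\<lambda>x. x / pi"])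
  then have "(\<lambda>n. \<integral>\<theta>. w \<theta> * \<bar>d n \<theta>\<bar> \<partial>unif pi) \<longlonglongrightarrow> 0"
    using tendsto_divide_zero[OF null, of pi] by simp
  then have "(\<lambda>n. \<integral>\<theta>. \<bar>d n \<theta>\<bar> * indicator {x\<in>space (unif pi). 0 < w x} \<theta> \<partial>unif pi) \<longlonglongrightarrow> 0"
    by (intro null_of_positive_weight[OF finite_measure_axioms]) (use w d in auto)
  then have "(\<lambda>n. ennreal (pi * (\<integral>\<theta>. \<bar>d n \<theta>\<bar> * indicator {x. 0 < w x} \<theta> \<partial>unif pi))) \<longlonglongrightarrow> ennreal 0"
    by (intro tendsto_ennrealI tendsto_mult_right_zero) simp
  then show "(\<lambda>n. ennreal (pi * (\<integral>\<theta>. \<bar>d n \<theta>\<bar> * indicator {x. 0 < w x} \<theta> \<partial>unif pi))) \<longlonglongrightarrow> 0" by simp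
  fix n
  let ?g = "\<lambda>\<theta>. \<bar>d n \<theta>\<bar> * indicator {x. 0 < w x} \<theta>"
  have C: "0 \<le> C" using d[of 0 0] by linarith
  have i: "integrable (unif pi) ?g"
    using d C by (intro integrable_const_bound[of _ C] AE_I2) (auto simp: indicator_def)
  have "(\<integral>\<^sup>+\<theta>\<in>{a..b}. ennreal \<bar>d n \<theta>\<bar> \<partial>lborel) \<le> (\<integral>\<^sup>+\<theta>. ennreal (?g \<theta>) * indicator {0..pi} \<theta> \<partial>lborel)"
  proof (rule nn_integral_mono_AE)
    show "AE x in lborel. ennreal \<bar>d n x\<bar> * indicator {a..b} x \<le> ennreal (?g x) * indicator {0..pi} x"
      using AE_lborel_singleton[of a] AE_lborel_singleton[of b]
    proof eventually_elim
      case (elim x)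
      show ?case
      proof (cases "x \<in> {a..b}")
        case True
        then have "0 < x \<and> x < pi \<and> 0 < P i x \<and> 0 < P j x" using ab[of x] elim by auto
        then have "0 < w x" "x \<in> {0..pi}" by (auto simp: w_def sin_gt_zero)
        then show ?thesis using True by simp
      qed simp
    qed
  qed
  also have "\<dots> = ennreal pi * (\<integral>\<^sup>+\<theta>. ennreal (?g \<theta>) \<partial>unif pi)"
  proof -
    have "x = ennreal pi * (x / ennreal pi)" for x :: ennreal
      by (simp add: ennreal_times_divide ennreal_mult_divide_eq mult.commute[of "ennreal pi"] pi_gt_zero)
    then show ?thesis by (subst nn_integral_unif) auto
  qed
  also have "(\<integral>\<^sup>+\<theta>. ennreal (?g \<theta>) \<partial>unif pi) = ennreal (\<integral>\<theta>. ?g \<theta> \<partial>unif pi)"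
    by (rule nn_integral_eq_integral[OF i]) simp
  also have "ennreal pi * \<dots> = ennreal (pi * (\<integral>\<theta>. ?g \<theta> \<partial>unif pi))"
    by (rule ennreal_mult[symmetric]) (auto intro!: integral_nonneg_AE)
  finally show "(\<integral>\<^sup>+\<theta>\<in>{a..b}. ennreal \<bar>d n \<theta>\<bar> \<partial>lborel) \<le> ennreal (pi * (\<integral>\<theta>. ?g \<theta> \<partial>unif pi))" .
qed

end

section \<open>Iterating an observable along the random billiard\<close>

context feres_billiard
begin

text \<open>Expectation of u after n steps. The outermost Q belongs to the first step of the
  particle: a branch is chosen, then B moves the position, then n steps remain.\<close>

primrec evol :: "nat \<Rightarrow> (real \<times> real \<Rightarrow> real) \<Rightarrow> real \<times> real \<Rightarrow> real" where
  "evol 0 u = u"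
| "evol (Suc n) u = Q (\<lambda>y. evol n u (B y))"

lemma evol_measurable [measurable]:
  "u \<in> borel_measurable (borel \<Otimes>\<^sub>M borel) \<Longrightarrow> evol n u \<in> borel_measurable (borel \<Otimes>\<^sub>M borel)"
  by (induction n) auto

lemma evol_bound: "(\<And>y. \<bar>u y\<bar> \<le> C) \<Longrightarrow> \<bar>evol n u y\<bar> \<le> C"
proof (induction n arbitrary: y)
  case (Suc n)
  then have "\<bar>evol n u (B y)\<bar> \<le> C" for y by blast
  then show ?case unfolding evol.simps by (rule Q_bound)
qed simp

end

locale feres_observable = feres_billiard +
  fixes u :: "real \<times> real \<Rightarrow> real" and C :: real
  assumes u [measurable]: "u \<in> borel_measurable (borel \<Otimes>\<^sub>M borel)" and C: "\<And>y. \<bar>u y\<bar> \<le> C"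
begin

text \<open>Taken half a step after \<open>evol\<close>: then \<open>evol (Suc n) u\<close> is
  \<open>Q (hn n)\<close>, and since B preserves the energy, consecutive energies differ by what Q
  alone destroys.\<close>

definition hn :: "nat \<Rightarrow> real \<times> real \<Rightarrow> real" where "hn n y = evol n u (B y)"

lemma hn_measurable [measurable]: "hn n \<in> borel_measurable (borel \<Otimes>\<^sub>M borel)"
  unfolding hn_def[abs_def] by measurable

lemma hn_bound: "\<bar>hn n y\<bar> \<le> C"
  unfolding hn_def using C by (rule evol_bound)

lemma evol_Suc: "evol (Suc n) u = Q (hn n)"
  by (simp add: hn_def[abs_def])

lemma C_nonneg: "0 \<le> C" using C[of undefined] by linarith

lemma square_le: "\<bar>x\<bar> \<le> C \<Longrightarrow> x\<^sup>2 \<le> C\<^sup>2"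
  using C_nonneg by (simp add: abs_le_square_iff[symmetric])

lemma integral_hn: "(\<integral>y. hn n y \<partial>\<nu>) = (\<integral>y. u y \<partial>\<nu>)"
proof (induction n)
  case 0 show ?case unfolding hn_def using integral_B'[OF u C] by simp
next
  case (Suc n)
  have "(\<integral>y. hn (Suc n) y \<partial>\<nu>) = (\<integral>y. evol (Suc n) u y \<partial>\<nu>)"
    unfolding hn_def using C by (intro integral_B'[of _ C] evol_bound) measurable
  also have "\<dots> = (\<integral>y. hn n y \<partial>\<nu>)"
    unfolding evol_Suc by (rule integral_Q[OF hn_measurable hn_bound])
  finally show ?case using Suc by simp
qed

text \<open>Both B and Q preserve integrals, so the loss is the integral of Q (h^2) - (Q h)^2, which
  at each point is the variance of h over the random branch.\<close>

lemma energy_difference: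
  "(\<integral>y. (hn n y)\<^sup>2 \<partial>\<nu>) - (\<integral>y. (hn (Suc n) y)\<^sup>2 \<partial>\<nu>)
    = (\<integral>y. (\<Sum>i\<in>{1..4}. \<Sum>j\<in>{1..4}. P i (snd y) * P j (snd y) *
        (hn n (fst y, T i (snd y)) - hn n (fst y, T j (snd y)))\<^sup>2) / 2 \<partial>\<nu>)"
proof -
  have sq: "\<bar>(hn n y)\<^sup>2\<bar> \<le> C\<^sup>2" for y using square_le[OF hn_bound] by simp
  have sQ: "\<bar>(Q (hn n) y)\<^sup>2\<bar> \<le> C\<^sup>2" for y using square_le[OF Q_bound[OF hn_bound]] by simp
  have "(\<integral>y. (hn (Suc n) y)\<^sup>2 \<partial>\<nu>) = (\<integral>y. (Q (hn n) (B y))\<^sup>2 \<partial>\<nu>)"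
    by (simp only: hn_def[of "Suc n"] evol_Suc)
  also have "\<dots> = (\<integral>y. (Q (hn n) y)\<^sup>2 \<partial>\<nu>)"
    by (rule integral_B'[where u = "\<lambda>y. (Q (hn n) y)\<^sup>2", OF _ sQ]) measurable
  finally have 1: "(\<integral>y. (hn (Suc n) y)\<^sup>2 \<partial>\<nu>) = (\<integral>y. (Q (hn n) y)\<^sup>2 \<partial>\<nu>)" .
  have 2: "(\<integral>y. (hn n y)\<^sup>2 \<partial>\<nu>) = (\<integral>y. Q (\<lambda>y. (hn n y)\<^sup>2) y \<partial>\<nu>)"
    by (rule integral_Q[symmetric, OF _ sq]) measurable
  have "integrable \<nu> (Q (\<lambda>y. (hn n y)\<^sup>2))" "integrable \<nu> (\<lambda>y. (Q (hn n) y)\<^sup>2)"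
    by (rule Fubini_\<nu>(1)[OF _ Q_bound[OF sq]] Fubini_\<nu>(1)[OF _ sQ]; measurable)+
  then have "(\<integral>y. (hn n y)\<^sup>2 \<partial>\<nu>) - (\<integral>y. (hn (Suc n) y)\<^sup>2 \<partial>\<nu>)
    = (\<integral>y. Q (\<lambda>y. (hn n y)\<^sup>2) y - (Q (hn n) y)\<^sup>2 \<partial>\<nu>)"
    unfolding 1 2 by (rule Bochner_Integration.integral_diff[symmetric])
  also have "\<dots> = (\<integral>y. (\<Sum>i\<in>{1..4}. \<Sum>j\<in>{1..4}. P i (snd y) * P j (snd y) *
        (hn n (fst y, T i (snd y)) - hn n (fst y, T j (snd y)))\<^sup>2) / 2 \<partial>\<nu>)"
    unfolding Q_def by (intro Bochner_Integration.integral_cong refl variance_identity P_sum)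
  finally show ?thesis .
qed

lemma energy_differences_null:
  "(\<lambda>n. (\<integral>y. (hn n y)\<^sup>2 \<partial>\<nu>) - (\<integral>y. (hn (Suc n) y)\<^sup>2 \<partial>\<nu>)) \<longlonglongrightarrow> 0"
proof -
  let ?E = "\<lambda>n. \<integral>y. (hn n y)\<^sup>2 \<partial>\<nu>"
  have "0 \<le> ?E n - ?E (Suc n)" for n
    unfolding energy_difference by (intro integral_nonneg_AE AE_I2 divide_nonneg_pos sum_nonneg mult_nonneg_nonneg P_nonneg) auto
  then have "decseq ?E" by (intro decseq_SucI) simp
  moreover have "0 \<le> ?E n" for n by simp
  ultimately obtain e where e: "?E \<longlonglongrightarrow> e" using decseq_convergent[of ?E 0] by metis
  from tendsto_diff[OF e LIMSEQ_Suc[OF e]] show ?thesis by simp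
qed

text \<open>Each pair of branches is one nonnegative term of the double sum, whose integral is twice
  the energy decrement.\<close>

lemma branch_difference_null:
  assumes ij: "i \<in> {1..4}" "j \<in> {1..4}"
  shows "(\<lambda>n. \<integral>y. P i (snd y) * P j (snd y) * \<bar>hn n (fst y, T i (snd y)) - hn n (fst y, T j (snd y))\<bar> \<partial>\<nu>) \<longlonglongrightarrow> 0"
proof (rule null_abs_of_null_square[OF finite_\<nu>, where C = "2 * C"])
  let ?f = "\<lambda>n i j y. P i (snd y) * P j (snd y) * (hn n (fst y, T i (snd y)) - hn n (fst y, T j (snd y)))\<^sup>2"
  have PP: "0 \<le> P i \<theta> * P j \<theta>" "P i \<theta> * P j \<theta> \<le> 1" if "i \<in> {1..4}" "j \<in> {1..4}" for i j \<theta>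
    using that P_nonneg P_le_1 by (auto intro!: mult_nonneg_nonneg mult_le_one)
  show "0 \<le> P i (snd y) * P j (snd y)" "P i (snd y) * P j (snd y) \<le> 1" for y using PP[OF ij] by auto
  have d: "\<bar>hn n y - hn n z\<bar> \<le> 2 * C" for n y z using hn_bound[of n y] hn_bound[of n z] by linarith
  then show "\<bar>hn n (fst y, T i (snd y)) - hn n (fst y, T j (snd y))\<bar> \<le> 2 * C" for n y .
  have nn: "0 \<le> ?f n i j y" if "i \<in> {1..4}" "j \<in> {1..4}" for n i j y using PP(1)[OF that] by simp
  have bd: "\<bar>?f n i j y\<bar> \<le> 1 * (2 * C)\<^sup>2" if "i \<in> {1..4}" "j \<in> {1..4}" for n i j y
  proof -
    have "(hn n (fst y, T i (snd y)) - hn n (fst y, T j (snd y)))\<^sup>2 \<le> (2 * C)\<^sup>2"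
      using d[of n "(fst y, T i (snd y))" "(fst y, T j (snd y))"] C_nonneg by (intro abs_le_square_iff[THEN iffD1]) simp
    then show ?thesis using PP[OF that] by (subst abs_mult, intro mult_mono) auto
  qed
  have int: "integrable \<nu> (?f n i j)" if "i \<in> {1..4}" "j \<in> {1..4}" for n i j
    by (rule Fubini_\<nu>(1)[OF _ bd[OF that]]) measurable
  show "(\<lambda>n. \<integral>y. ?f n i j y \<partial>\<nu>) \<longlonglongrightarrow> 0"
  proof (rule tendsto_sandwich[of "\<lambda>_. 0"])
    show "(\<lambda>n. 2 * ((\<integral>y. (hn n y)\<^sup>2 \<partial>\<nu>) - (\<integral>y. (hn (Suc n) y)\<^sup>2 \<partial>\<nu>))) \<longlonglongrightarrow> 0"
      using energy_differences_null by (rule tendsto_mult_right_zero)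
    show "\<forall>\<^sub>F n in sequentially. 0 \<le> (\<integral>y. ?f n i j y \<partial>\<nu>)"
      using nn[OF ij] by (intro always_eventually allI integral_nonneg_AE AE_I2) auto
    have "(\<integral>y. ?f n i j y \<partial>\<nu>) \<le> (\<integral>y. (\<Sum>i\<in>{1..4}. \<Sum>j\<in>{1..4}. ?f n i j y) \<partial>\<nu>)" for n
    proof (rule integral_mono)
      show "integrable \<nu> (\<lambda>y. \<Sum>i\<in>{1..4}. \<Sum>j\<in>{1..4}. ?f n i j y)" using int by (intro Bochner_Integration.integrable_sum)
      fix y
      have "?f n i j y \<le> (\<Sum>j\<in>{1..4}. ?f n i j y)" using nn ij by (intro member_le_sum) auto
      also have "\<dots> \<le> (\<Sum>i\<in>{1..4}. \<Sum>j\<in>{1..4}. ?f n i j y)"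
        using nn ij by (intro member_le_sum[of i _ "\<lambda>i. \<Sum>j\<in>{1..4}. ?f n i j y"] sum_nonneg) auto
      finally show "?f n i j y \<le> (\<Sum>i\<in>{1..4}. \<Sum>j\<in>{1..4}. ?f n i j y)" .
    qed (rule int[OF ij])
    then show "\<forall>\<^sub>F n in sequentially. (\<integral>y. ?f n i j y \<partial>\<nu>) \<le> 2 * ((\<integral>y. (hn n y)\<^sup>2 \<partial>\<nu>) - (\<integral>y. (hn (Suc n) y)\<^sup>2 \<partial>\<nu>))"
      unfolding energy_difference by (intro always_eventually allI) simp
  qed simp
qed measurable

text \<open>Integration over a set D of positions leaves a function of the angle. The branches do
  not move s, so branch differences pass through the integral. D stays arbitrary because its
  products with sets of angles generate the phase space.\<close>

definition Hn :: "real set \<Rightarrow> nat \<Rightarrow> real \<Rightarrow> real" where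
  "Hn D n \<theta> = (\<integral>s. hn n (s, \<theta>) * indicator D s \<partial>unif L)"

lemma Hn_measurable [measurable]:
  assumes [measurable]: "D \<in> sets borel"
  shows "Hn D n \<in> borel_measurable borel"
proof -
  interpret finite_measure "unif L" by (rule finite_unif_L)
  show ?thesis unfolding Hn_def[abs_def] by measurable
qed

lemma Hn_bound:
  assumes [measurable]: "D \<in> sets borel" shows "\<bar>Hn D n \<theta>\<bar> \<le> C"
  unfolding Hn_def by (rule unif_bounded(2)[OF L_pos _ abs_indicator_le[OF hn_bound]]) measurable

lemma Hn_branch_difference_null:
  assumes ij: "i \<in> {1..4}" "j \<in> {1..4}" and D [measurable]: "D \<in> sets borel"
  shows "(\<lambda>n. \<integral>\<theta>. P i \<theta> * P j \<theta> * \<bar>Hn D n (T i \<theta>) - Hn D n (T j \<theta>)\<bar> \<partial>\<mu>) \<longlonglongrightarrow> 0"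
proof (rule tendsto_sandwich[of "\<lambda>_. 0"])
  have PP: "0 \<le> P i \<theta> * P j \<theta>" "P i \<theta> * P j \<theta> \<le> 1" for \<theta>
    using ij P_nonneg P_le_1 by (auto intro!: mult_nonneg_nonneg mult_le_one)
  interpret U: finite_measure "unif L" by (rule finite_unif_L)
  interpret \<mu>: finite_measure \<mu> by (rule finite_measure_\<mu>)
  let ?d = "\<lambda>n s \<theta>. hn n (s, T i \<theta>) - hn n (s, T j \<theta>)"
  have d: "\<bar>?d n s \<theta>\<bar> \<le> 2 * C" for n s \<theta> using hn_bound[of n "(s, T i \<theta>)"] hn_bound[of n "(s, T j \<theta>)"] by linarith
  show "(\<lambda>n. \<integral>y. P i (snd y) * P j (snd y) * \<bar>?d n (fst y) (snd y)\<bar> \<partial>\<nu>) \<longlonglongrightarrow> 0"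
    by (rule branch_difference_null[OF ij])
  show "\<forall>\<^sub>F n in sequentially. 0 \<le> (\<integral>\<theta>. P i \<theta> * P j \<theta> * \<bar>Hn D n (T i \<theta>) - Hn D n (T j \<theta>)\<bar> \<partial>\<mu>)"
    using PP by (intro always_eventually allI integral_nonneg_AE AE_I2) auto
  have PPd: "\<bar>P i \<theta> * P j \<theta> * \<bar>x\<bar>\<bar> \<le> 2 * C" if "\<bar>x\<bar> \<le> 2 * C" for \<theta> x
  proof -
    have "\<bar>P i \<theta> * P j \<theta> * \<bar>x\<bar>\<bar> = P i \<theta> * P j \<theta> * \<bar>x\<bar>" using PP(1)[of \<theta>] by simp
    also have "\<dots> \<le> 1 * (2 * C)" using PP[of \<theta>] that C_nonneg by (intro mult_mono) auto
    finally show ?thesis by simp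
  qed
  have "(\<integral>\<theta>. P i \<theta> * P j \<theta> * \<bar>Hn D n (T i \<theta>) - Hn D n (T j \<theta>)\<bar> \<partial>\<mu>)
    \<le> (\<integral>\<theta>. \<integral>s. P i \<theta> * P j \<theta> * \<bar>?d n s \<theta>\<bar> \<partial>unif L \<partial>\<mu>)" for n
  proof (rule integral_mono)
    have "\<bar>Hn D n x - Hn D n y\<bar> \<le> 2 * C" for x y using Hn_bound[OF D, of n x] Hn_bound[OF D, of n y] by linarith
    then show "integrable \<mu> (\<lambda>\<theta>. P i \<theta> * P j \<theta> * \<bar>Hn D n (T i \<theta>) - Hn D n (T j \<theta>)\<bar>)"
      by (intro \<mu>.integrable_const_bound[of _ "2 * C"] AE_I2) (auto simp only: real_norm_def intro!: PPd, measurable)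
    have "\<bar>\<integral>s. P i \<theta> * P j \<theta> * \<bar>?d n s \<theta>\<bar> \<partial>unif L\<bar> \<le> 2 * C" for \<theta>
      by (rule unif_bounded(2)[OF L_pos _ PPd[OF d]]) measurable
    then show "integrable \<mu> (\<lambda>\<theta>. \<integral>s. P i \<theta> * P j \<theta> * \<bar>?d n s \<theta>\<bar> \<partial>unif L)"
      by (intro \<mu>.integrable_const_bound[of _ "2 * C"] AE_I2) (auto simp only: real_norm_def, measurable)
    fix \<theta>
    have "Hn D n (T i \<theta>) - Hn D n (T j \<theta>) = (\<integral>s. ?d n s \<theta> * indicator D s \<partial>unif L)"
      unfolding Hn_def left_diff_distrib
      by (rule Bochner_Integration.integral_diff[symmetric]; rule unif_bounded(1)[OF L_pos _ abs_indicator_le[OF hn_bound]]; measurable)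
    then have "\<bar>Hn D n (T i \<theta>) - Hn D n (T j \<theta>)\<bar> \<le> (\<integral>s. \<bar>?d n s \<theta> * indicator D s\<bar> \<partial>unif L)"
      by (simp only: integral_abs_bound)
    also have "\<dots> \<le> (\<integral>s. \<bar>?d n s \<theta>\<bar> \<partial>unif L)"
    proof (rule integral_mono)
      show "integrable (unif L) (\<lambda>s. \<bar>?d n s \<theta> * indicator D s\<bar>)" "integrable (unif L) (\<lambda>s. \<bar>?d n s \<theta>\<bar>)"
        by (rule unif_bounded(1)[OF L_pos, of _ "2 * C"], measurable, simp only: abs_abs abs_indicator_le d)+
    qed (auto simp: indicator_def)
    finally have "P i \<theta> * P j \<theta> * \<bar>Hn D n (T i \<theta>) - Hn D n (T j \<theta>)\<bar> \<le> P i \<theta> * P j \<theta> * (\<integral>s. \<bar>?d n s \<theta>\<bar> \<partial>unif L)"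
      by (rule mult_left_mono[OF _ PP(1)])
    then show "P i \<theta> * P j \<theta> * \<bar>Hn D n (T i \<theta>) - Hn D n (T j \<theta>)\<bar> \<le> (\<integral>s. P i \<theta> * P j \<theta> * \<bar>?d n s \<theta>\<bar> \<partial>unif L)"
      by simp
  qed
  moreover have "(\<integral>y. P i (snd y) * P j (snd y) * \<bar>?d n (fst y) (snd y)\<bar> \<partial>\<nu>)
      = (\<integral>\<theta>. \<integral>s. P i \<theta> * P j \<theta> * \<bar>?d n s \<theta>\<bar> \<partial>unif L \<partial>\<mu>)" for n
    by (subst Fubini_\<nu>(3)[OF _ PPd[OF d]]) auto
  ultimately show "\<forall>\<^sub>F n in sequentially. (\<integral>\<theta>. P i \<theta> * P j \<theta> * \<bar>Hn D n (T i \<theta>) - Hn D n (T j \<theta>)\<bar> \<partial>\<mu>)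
      \<le> (\<integral>y. P i (snd y) * P j (snd y) * \<bar>?d n (fst y) (snd y)\<bar> \<partial>\<nu>)"
    by (intro always_eventually allI) simp
qed simp

lemma Hn_interval_null:
  assumes ij: "i \<in> {1..4}" "j \<in> {1..4}" and D [measurable]: "D \<in> sets borel"
    and ab: "\<And>\<theta>. a < \<theta> \<Longrightarrow> \<theta> < b \<Longrightarrow> 0 < \<theta> \<and> \<theta> < pi \<and> 0 < P i \<theta> \<and> 0 < P j \<theta>"
  shows "(\<lambda>n. \<integral>\<^sup>+\<theta>\<in>{a..b}. ennreal \<bar>Hn D n (T i \<theta>) - Hn D n (T j \<theta>)\<bar> \<partial>lborel) \<longlonglongrightarrow> 0"
proof (rule null_on_interval[OF _ _ ij _ ab, where C = "2 * C"])
  show "(\<lambda>\<theta>. Hn D n (T i \<theta>) - Hn D n (T j \<theta>)) \<in> borel_measurable borel" for n by measurable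
  show "\<bar>Hn D n (T i \<theta>) - Hn D n (T j \<theta>)\<bar> \<le> 2 * C" for n \<theta>
    using Hn_bound[OF D, of n "T i \<theta>"] Hn_bound[OF D, of n "T j \<theta>"] by linarith
  show "(\<lambda>n. \<integral>\<theta>. P i \<theta> * P j \<theta> * \<bar>Hn D n (T i \<theta>) - Hn D n (T j \<theta>)\<bar> \<partial>\<mu>) \<longlonglongrightarrow> 0"
    by (rule Hn_branch_difference_null[OF ij D])
qed

text \<open>The defect is the same at x and at its mirror image, so the half window to the left of b
  controls the whole window.\<close>

lemma reflection_null:
  assumes [measurable]: "D \<in> sets borel" and b: "b = e + k"
    and null: "(\<lambda>n. \<integral>\<^sup>+x\<in>{e..b}. ennreal \<bar>Hn D n (2 * b - x) - Hn D n x\<bar> \<partial>lborel) \<longlonglongrightarrow> 0"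
  shows "(\<lambda>n. \<integral>\<^sup>+x\<in>{b - k..b + k}. ennreal \<bar>Hn D n (2 * b - x) - Hn D n x\<bar> \<partial>lborel) \<longlonglongrightarrow> 0"
proof (rule ennreal_null_le[OF ennreal_null_add[OF null null]])
  fix n
  let ?f = "\<lambda>x. ennreal \<bar>Hn D n (2 * b - x) - Hn D n x\<bar>"
  have "(\<integral>\<^sup>+x\<in>{b - k..b + k}. ?f x \<partial>lborel) \<le> (\<integral>\<^sup>+x. ?f x * indicator {e..b} x + ?f (2 * b - x) * indicator {e..b} (2 * b - x) \<partial>lborel)"
    by (intro nn_integral_mono) (auto simp: indicator_def b abs_minus_commute)
  also have "\<dots> = (\<integral>\<^sup>+x\<in>{e..b}. ?f x \<partial>lborel) + (\<integral>\<^sup>+x. ?f (2 * b - x) * indicator {e..b} (2 * b - x) \<partial>lborel)"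
    by (rule nn_integral_add; measurable)
  also have "(\<integral>\<^sup>+x. ?f (2 * b - x) * indicator {e..b} (2 * b - x) \<partial>lborel) = (\<integral>\<^sup>+x\<in>{e..b}. ?f x \<partial>lborel)"
    by (rule nn_integral_flip) measurable
  finally show "(\<integral>\<^sup>+x\<in>{b - k..b + k}. ?f x \<partial>lborel) \<le> (\<integral>\<^sup>+x\<in>{e..b}. ?f x \<partial>lborel) + (\<integral>\<^sup>+x\<in>{e..b}. ?f x \<partial>lborel)" .
qed

text \<open>The windows of half-width 2 \<alpha> about 3 \<alpha> and \<pi> - 3 \<alpha> reach to 5
  \<alpha> and \<pi> - 5 \<alpha>, which stays inside \<open>[0, \<pi>]\<close> as \<alpha> < \<pi>
  / 6.\<close>

lemma Hn_dihedral:
  assumes irr: "\<alpha> / pi \<notin> \<rat>" and D [measurable]: "D \<in> sets borel"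
  shows "asymptotically_dihedral (Hn D) C (4 * \<alpha>) pi (3 * \<alpha>) (pi - 3 * \<alpha>)"
proof
  show "Hn D n \<in> borel_measurable borel" for n by measurable
  show "\<bar>Hn D n x\<bar> \<le> C" for n x by (rule Hn_bound[OF D])
  show "(\<lambda>n. \<integral>\<^sup>+x\<in>{0..pi - 4 * \<alpha>}. ennreal \<bar>Hn D n (x + 4 * \<alpha>) - Hn D n x\<bar> \<partial>lborel) \<longlonglongrightarrow> 0"
  proof -
    \<comment> \<open>Branches 1 and 3 are both possible between 2 \<alpha> and \<pi> - 2 \<alpha>,
      and their images differ by 4 \<alpha>.\<close>
    have "(\<lambda>n. \<integral>\<^sup>+\<theta>\<in>{2 * \<alpha>..pi - 2 * \<alpha>}. ennreal \<bar>Hn D n (T 1 \<theta>) - Hn D n (T 3 \<theta>)\<bar> \<partial>lborel) \<longlonglongrightarrow> 0"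
      using \<alpha> by (intro Hn_interval_null D) (auto intro: P_1_pos[unfolded One_nat_def] P_3_pos)
    moreover have "(\<integral>\<^sup>+\<theta>\<in>{2 * \<alpha>..pi - 2 * \<alpha>}. ennreal \<bar>Hn D n (T 1 \<theta>) - Hn D n (T 3 \<theta>)\<bar> \<partial>lborel)
      = (\<integral>\<^sup>+x\<in>{0..pi - 4 * \<alpha>}. ennreal \<bar>Hn D n (x + 4 * \<alpha>) - Hn D n x\<bar> \<partial>lborel)" for n
      by (subst nn_integral_shift[where t = "2 * \<alpha>", symmetric])
        (auto simp: feres_map_def indicator_def add.assoc intro!: nn_integral_cong)
    ultimately show ?thesis by simp
  qed
  have "(\<lambda>n. \<integral>\<^sup>+x\<in>{3 * \<alpha> - 2 * \<alpha>..3 * \<alpha> + 2 * \<alpha>}. ennreal \<bar>Hn D n (2 * (3 * \<alpha>) - x) - Hn D n x\<bar> \<partial>lborel) \<longlonglongrightarrow> 0"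
  proof (rule reflection_null[OF D, where e = \<alpha>])
    \<comment> \<open>Branches 1 and 4 compete here: with x = 4 \<alpha> - \<theta> the image under
      \<open>T 4\<close>, the image under \<open>T 1\<close> is 6 \<alpha> - x.\<close>
    have "(\<lambda>n. \<integral>\<^sup>+\<theta>\<in>{\<alpha>..3 * \<alpha>}. ennreal \<bar>Hn D n (T 1 \<theta>) - Hn D n (T 4 \<theta>)\<bar> \<partial>lborel) \<longlonglongrightarrow> 0"
      using \<alpha> by (intro Hn_interval_null D) (auto intro: P_1_pos[unfolded One_nat_def] P_4_pos)
    moreover have "(\<integral>\<^sup>+\<theta>\<in>{\<alpha>..3 * \<alpha>}. ennreal \<bar>Hn D n (T 1 \<theta>) - Hn D n (T 4 \<theta>)\<bar> \<partial>lborel)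
      = (\<integral>\<^sup>+x\<in>{\<alpha>..3 * \<alpha>}. ennreal \<bar>Hn D n (2 * (3 * \<alpha>) - x) - Hn D n x\<bar> \<partial>lborel)" for n
      by (subst nn_integral_flip[where t = "4 * \<alpha>", symmetric])
        (auto simp: feres_map_def indicator_def intro!: nn_integral_cong)
    ultimately show "(\<lambda>n. \<integral>\<^sup>+x\<in>{\<alpha>..3 * \<alpha>}. ennreal \<bar>Hn D n (2 * (3 * \<alpha>) - x) - Hn D n x\<bar> \<partial>lborel) \<longlonglongrightarrow> 0" by simp
  qed simp
  then show "(\<lambda>n. \<integral>\<^sup>+x\<in>{3 * \<alpha> - 4 * \<alpha> / 2..3 * \<alpha> + 4 * \<alpha> / 2}. ennreal \<bar>Hn D n (2 * (3 * \<alpha>) - x) - Hn D n x\<bar> \<partial>lborel) \<longlonglongrightarrow> 0"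
    by simp
  have "(\<lambda>n. \<integral>\<^sup>+x\<in>{(pi - 3 * \<alpha>) - 2 * \<alpha>..(pi - 3 * \<alpha>) + 2 * \<alpha>}. ennreal \<bar>Hn D n (2 * (pi - 3 * \<alpha>) - x) - Hn D n x\<bar> \<partial>lborel) \<longlonglongrightarrow> 0"
  proof (rule reflection_null[OF D, where e = "pi - 5 * \<alpha>"])
    \<comment> \<open>Branches 2 and 3 compete here: with x = \<theta> - 2 \<alpha> the image under
      \<open>T 3\<close>, the image under \<open>T 2\<close> is 2 (\<pi> - 3 \<alpha>) - x.\<close>
    have "(\<lambda>n. \<integral>\<^sup>+\<theta>\<in>{pi - 3 * \<alpha>..pi - \<alpha>}. ennreal \<bar>Hn D n (T 2 \<theta>) - Hn D n (T 3 \<theta>)\<bar> \<partial>lborel) \<longlonglongrightarrow> 0"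
      using \<alpha> by (intro Hn_interval_null D) (auto intro: P_2_pos P_3_pos)
    moreover have "(\<integral>\<^sup>+\<theta>\<in>{pi - 3 * \<alpha>..pi - \<alpha>}. ennreal \<bar>Hn D n (T 2 \<theta>) - Hn D n (T 3 \<theta>)\<bar> \<partial>lborel)
      = (\<integral>\<^sup>+x\<in>{pi - 5 * \<alpha>..pi - 3 * \<alpha>}. ennreal \<bar>Hn D n (2 * (pi - 3 * \<alpha>) - x) - Hn D n x\<bar> \<partial>lborel)" for n
      by (subst nn_integral_shift[where t = "2 * \<alpha>", symmetric])
        (auto simp: feres_map_def indicator_def algebra_simps intro!: nn_integral_cong)
    ultimately show "(\<lambda>n. \<integral>\<^sup>+x\<in>{pi - 5 * \<alpha>..pi - 3 * \<alpha>}. ennreal \<bar>Hn D n (2 * (pi - 3 * \<alpha>) - x) - Hn D n x\<bar> \<partial>lborel) \<longlonglongrightarrow> 0" by simp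
  qed simp
  then show "(\<lambda>n. \<integral>\<^sup>+x\<in>{(pi - 3 * \<alpha>) - 4 * \<alpha> / 2..(pi - 3 * \<alpha>) + 4 * \<alpha> / 2}. ennreal \<bar>Hn D n (2 * (pi - 3 * \<alpha>) - x) - Hn D n x\<bar> \<partial>lborel) \<longlonglongrightarrow> 0"
    by simp
  \<comment> \<open>This number is \<pi> / (2 \<alpha>) - 3; the rational map from x to 1 / (2 (x +
    3)) recovers \<alpha> / \<pi> from it.\<close>
  show "2 * (pi - 3 * \<alpha> - 3 * \<alpha>) / (4 * \<alpha>) \<notin> \<rat>"
  proof
    assume "2 * (pi - 3 * \<alpha> - 3 * \<alpha>) / (4 * \<alpha>) \<in> \<rat>"
    moreover have "1 / (2 * (x + 3)) \<in> \<rat>" if "x \<in> \<rat>" for x :: real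
      using that by (intro Rats_divide Rats_mult Rats_add) auto
    ultimately have "1 / (2 * ((2 * (pi - 3 * \<alpha> - 3 * \<alpha>) / (4 * \<alpha>)) + 3)) \<in> \<rat>"
      by blast
    also have "1 / (2 * ((2 * (pi - 3 * \<alpha> - 3 * \<alpha>) / (4 * \<alpha>)) + 3)) = \<alpha> / pi"
      using \<alpha> by (simp add: field_simps)
    finally show False using irr by simp
  qed
qed (use \<alpha> in auto)

text \<open>A test against \<open>\<mu>\<close> is a test against the uniform law once multiplied by
  the density. The test 1 then shows that the unknown centring constants may be replaced by the
  means.\<close>

lemma Hn_weak:
  assumes irr: "\<alpha> / pi \<notin> \<rat>" and D [measurable]: "D \<in> sets borel"
  shows "weakly_null \<mu> (\<lambda>n \<theta>. Hn D n \<theta> - (\<integral>\<theta>. Hn D n \<theta> \<partial>\<mu>))"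
proof -
  interpret \<mu>: finite_measure \<mu> by (rule finite_measure_\<mu>)
  obtain c where c: "weakly_null (unif pi) (\<lambda>n \<theta>. Hn D n \<theta> - c n)" 
    using asymptotically_dihedral.equidistributed[OF Hn_dihedral[OF irr D]] by blast
  have int: "integrable \<mu> (Hn D n)" for n
    using Hn_bound[OF D] by (intro \<mu>.integrable_const_bound[of _ C] AE_I2) auto
  have lim: "(\<lambda>n. \<integral>\<theta>. (Hn D n \<theta> - c n) * \<psi> \<theta> \<partial>\<mu>) \<longlonglongrightarrow> 0" if \<psi>: "integrable \<mu> \<psi>" for \<psi> :: "real \<Rightarrow> real"
  proof -
    have [measurable]: "\<psi> \<in> borel_measurable borel" using borel_measurable_integrable[OF \<psi>] by simp
    let ?\<psi> = "\<lambda>\<theta>. \<psi> \<theta> * (indicator {0..pi} \<theta> * sin \<theta> / 2)"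
    have "integrable lborel ?\<psi>" using \<psi> by (subst (asm) integrable_\<mu>) auto
    then have "integrable lborel (\<lambda>\<theta>. ?\<psi> \<theta> / pi)" by (rule integrable_divide)
    also have "(\<lambda>\<theta>. ?\<psi> \<theta> / pi) = (\<lambda>\<theta>. (indicator {0..pi} \<theta> / pi) *\<^sub>R ?\<psi> \<theta>)"
      by (auto simp: indicator_def)
    finally have "integrable (unif pi) ?\<psi>"
      unfolding unif_eq_density[OF pi_gt_zero] by (subst integrable_density) auto
    then have "(\<lambda>n. pi * (\<integral>\<theta>. (Hn D n \<theta> - c n) * ?\<psi> \<theta> \<partial>unif pi)) \<longlonglongrightarrow> 0"
      by (intro tendsto_mult_right_zero weakly_nullD[OF c])
    moreover have "pi * (\<integral>\<theta>. (Hn D n \<theta> - c n) * ?\<psi> \<theta> \<partial>unif pi) = (\<integral>\<theta>. (Hn D n \<theta> - c n) * \<psi> \<theta> \<partial>\<mu>)" for n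
      by (subst integral_unif, simp, measurable, subst integral_\<mu>, measurable)
        (auto simp: indicator_def intro!: Bochner_Integration.integral_cong)
    ultimately show ?thesis by (simp only:)
  qed
  have mean: "(\<lambda>n. (\<integral>\<theta>. Hn D n \<theta> \<partial>\<mu>) - c n) \<longlonglongrightarrow> 0"
    using lim[of "\<lambda>_. 1"] int measure_\<mu>_UNIV by simp
  show ?thesis
    unfolding weakly_null_def
  proof (intro allI impI)
    fix \<psi> :: "real \<Rightarrow> real" assume \<psi>: "integrable \<mu> \<psi>"
    have "(\<integral>\<theta>. (Hn D n \<theta> - (\<integral>\<theta>. Hn D n \<theta> \<partial>\<mu>)) * \<psi> \<theta> \<partial>\<mu>)
      = (\<integral>\<theta>. (Hn D n \<theta> - c n) * \<psi> \<theta> \<partial>\<mu>) - ((\<integral>\<theta>. Hn D n \<theta> \<partial>\<mu>) - c n) * (\<integral>\<theta>. \<psi> \<theta> \<partial>\<mu>)" for n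
    proof -
      have "integrable \<mu> (\<lambda>\<theta>. Hn D n \<theta> * \<psi> \<theta>)"
        using Hn_bound[OF D] \<psi> by (intro integrable_bounded_mult(1)[where C = C]) auto
      then show ?thesis using \<psi> by (simp add: left_diff_distrib)
    qed
    then show "(\<lambda>n. \<integral>\<theta>. (Hn D n \<theta> - (\<integral>\<theta>. Hn D n \<theta> \<partial>\<mu>)) * \<psi> \<theta> \<partial>\<mu>) \<longlonglongrightarrow> 0"
      using tendsto_diff[OF lim[OF \<psi>] tendsto_mult_left_zero[OF mean, of "\<integral>\<theta>. \<psi> \<theta> \<partial>\<mu>"]] by simp
  qed
qed

text \<open>Conditional mean given the position. The dihedral argument says nothing about s, so
  \<open>hn\<close> is first compared with this function and not with a constant.\<close>

definition cn :: "nat \<Rightarrow> real \<Rightarrow> real" where "cn n s = (\<integral>\<theta>. hn n (s, \<theta>) \<partial>\<mu>)"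

lemma cn_measurable [measurable]: "cn n \<in> borel_measurable borel"
proof -
  interpret finite_measure \<mu> by (rule finite_measure_\<mu>)
  show ?thesis unfolding cn_def[abs_def] by measurable
qed

lemma cn_bound: "\<bar>cn n s\<bar> \<le> C"
proof -
  have "\<bar>cn n s\<bar> \<le> (\<integral>\<theta>. \<bar>hn n (s, \<theta>)\<bar> \<partial>\<mu>)" unfolding cn_def by (rule integral_abs_bound)
  also have "\<dots> \<le> (\<integral>\<theta>. C \<partial>\<mu>)"
    using hn_bound by (intro integral_mono integrable_\<mu>_bounded[of _ C]) (auto simp: C_nonneg)
  also have "\<dots> = C" using measure_\<mu>_UNIV by simp
  finally show ?thesis .
qed

definition kn :: "nat \<Rightarrow> real \<times> real \<Rightarrow> real" where "kn n y = hn n y - cn n (fst y)"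

lemma kn_measurable [measurable]: "kn n \<in> borel_measurable (borel \<Otimes>\<^sub>M borel)"
  unfolding kn_def[abs_def] by measurable

lemma kn_bound: "\<bar>kn n y\<bar> \<le> 2 * C"
  unfolding kn_def using hn_bound[of n y] cn_bound[of n "fst y"] by linarith

text \<open>Fubini in both orders: paired with a rectangle, \<open>kn\<close> shows only
  \<open>Hn D n\<close> minus its mean.\<close>

lemma kn_rectangle:
  assumes [measurable]: "D \<in> sets borel" "E \<in> sets borel"
  shows "(\<integral>y. kn n y * indicator (D \<times> E) y \<partial>\<nu>)
    = (\<integral>\<theta>. (Hn D n \<theta> - (\<integral>\<theta>. Hn D n \<theta> \<partial>\<mu>)) * indicator E \<theta> \<partial>\<mu>)"
proof -
  have DE [measurable]: "D \<times> E \<in> sets (borel \<Otimes>\<^sub>M borel)" by simp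
  have "(\<integral>y. kn n y * indicator (D \<times> E) y \<partial>\<nu>) = (\<integral>\<theta>. \<integral>s. kn n (s, \<theta>) * indicator (D \<times> E) (s, \<theta>) \<partial>unif L \<partial>\<mu>)"
    by (rule Fubini_\<nu>(3)[OF _ abs_indicator_le[OF kn_bound]]) measurable
  also have "\<dots> = (\<integral>\<theta>. (Hn D n \<theta> - (\<integral>\<theta>. Hn D n \<theta> \<partial>\<mu>)) * indicator E \<theta> \<partial>\<mu>)"
  proof (rule Bochner_Integration.integral_cong[OF refl])
    fix \<theta>
    have "(\<integral>s. kn n (s, \<theta>) * indicator (D \<times> E) (s, \<theta>) \<partial>unif L)
      = (\<integral>s. (hn n (s, \<theta>) * indicator D s - cn n s * indicator D s) * indicator E \<theta> \<partial>unif L)"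
      by (intro Bochner_Integration.integral_cong) (auto simp: kn_def indicator_def)
    also have "\<dots> = (Hn D n \<theta> - (\<integral>s. cn n s * indicator D s \<partial>unif L)) * indicator E \<theta>"
    proof -
      have "integrable (unif L) (\<lambda>s. hn n (s, \<theta>) * indicator D s)" "integrable (unif L) (\<lambda>s. cn n s * indicator D s)"
        by (rule unif_bounded(1)[OF L_pos _ abs_indicator_le[OF hn_bound]] unif_bounded(1)[OF L_pos _ abs_indicator_le[OF cn_bound]]; measurable)+
      then show ?thesis by (simp add: Hn_def)
    qed
    also have "(\<integral>s. cn n s * indicator D s \<partial>unif L) = (\<integral>s. \<integral>\<theta>. hn n (s, \<theta>) * indicator D s \<partial>\<mu> \<partial>unif L)"
      by (simp add: cn_def)
    also have "\<dots> = (\<integral>\<theta>. Hn D n \<theta> \<partial>\<mu>)"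
    proof -
      have "(\<lambda>y. hn n y * indicator D (fst y)) \<in> borel_measurable (borel \<Otimes>\<^sub>M borel)" by measurable
      note F = Fubini_\<nu>(2,3)[OF this abs_indicator_le[OF hn_bound]]
      show ?thesis unfolding Hn_def using F(1)[symmetric] F(2) by simp
    qed
    finally show "(\<integral>s. kn n (s, \<theta>) * indicator (D \<times> E) (s, \<theta>) \<partial>unif L)
      = (Hn D n \<theta> - (\<integral>\<theta>. Hn D n \<theta> \<partial>\<mu>)) * indicator E \<theta>" .
  qed
  finally show ?thesis .
qed

lemma kn_weak:
  assumes irr: "\<alpha> / pi \<notin> \<rat>"
  shows "weakly_null \<nu> kn"
proof (rule weakly_null_generator[OF finite_\<nu>, where C = "2 * C" and G = "{a \<times> b | a b. a \<in> sets borel \<and> b \<in> sets borel}"])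
  show "Int_stable {a \<times> b | a b. a \<in> sets (borel :: real measure) \<and> b \<in> sets (borel :: real measure)}"
    by (rule Int_stable_pair_measure_generator)
  show "sets \<nu> = sigma_sets (space \<nu>) {a \<times> b | a b. a \<in> sets borel \<and> b \<in> sets borel}"
    by (simp add: sets_\<nu> sets_pair_measure)
  have *: "(\<lambda>n. \<integral>y. kn n y * indicator (D \<times> E) y \<partial>\<nu>) \<longlonglongrightarrow> 0" if "D \<in> sets borel" "E \<in> sets borel" for D E
    unfolding kn_rectangle[OF that] using that
    by (intro weakly_nullD[OF Hn_weak[OF irr]] integrable_\<mu>_bounded[of _ 1]) auto
  then show "(\<lambda>n. \<integral>y. kn n y * indicator E y \<partial>\<nu>) \<longlonglongrightarrow> 0"
    if "E \<in> {a \<times> b | a b. a \<in> sets borel \<and> b \<in> sets borel}" for E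
    using that by auto
  show "(\<lambda>n. \<integral>y. kn n y \<partial>\<nu>) \<longlonglongrightarrow> 0" using *[of UNIV UNIV] by simp
qed (auto simp: kn_bound cong: measurable_cong_sets)

end

section \<open>Removing the dependence on the position\<close>

lemma weakly_null_diff:
  assumes "weakly_null M k" "weakly_null M k'"
    and "\<And>n. k n \<in> borel_measurable M" "\<And>n x. x \<in> space M \<Longrightarrow> \<bar>k n x\<bar> \<le> K"
    and "\<And>n. k' n \<in> borel_measurable M" "\<And>n x. x \<in> space M \<Longrightarrow> \<bar>k' n x\<bar> \<le> K'"
  shows "weakly_null M (\<lambda>n x. k n x - k' n x)"
  unfolding weakly_null_def
proof (intro allI impI)
  fix \<psi> :: "'a \<Rightarrow> real" assume \<psi>: "integrable M \<psi>"
  have "(\<integral>x. (k n x - k' n x) * \<psi> x \<partial>M) = (\<integral>x. k n x * \<psi> x \<partial>M) - (\<integral>x. k' n x * \<psi> x \<partial>M)" for n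
    using integrable_bounded_mult(1)[OF assms(3,4) \<psi>] integrable_bounded_mult(1)[OF assms(5,6) \<psi>]
    by (simp add: left_diff_distrib)
  then show "(\<lambda>n. \<integral>x. (k n x - k' n x) * \<psi> x \<partial>M) \<longlonglongrightarrow> 0"
    using tendsto_diff[OF weakly_nullD[OF assms(1) \<psi>] weakly_nullD[OF assms(2) \<psi>]] by simp
qed

context feres_billiard
begin

text \<open>Weak nullity passes through an operator whose dual A keeps tests measurable and bounded
  by 1. It is used with A = Q, by self-adjointness, and with A the composition with
  \<open>Binv\<close>.\<close>

lemma weakly_null_\<nu>_transfer:
  fixes k g :: "nat \<Rightarrow> real \<times> real \<Rightarrow> real"
  assumes k: "weakly_null \<nu> k"
    and g: "\<And>n. g n \<in> borel_measurable (borel \<Otimes>\<^sub>M borel)" "\<And>n y. \<bar>g n y\<bar> \<le> K"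
    and A: "\<And>\<psi>. \<psi> \<in> borel_measurable (borel \<Otimes>\<^sub>M borel) \<Longrightarrow> A \<psi> \<in> borel_measurable (borel \<Otimes>\<^sub>M borel)"
      "\<And>\<psi>. (\<And>y. \<bar>\<psi> y\<bar> \<le> 1) \<Longrightarrow> (\<And>y. \<bar>A \<psi> y\<bar> \<le> 1)"
    and dual: "\<And>n \<psi>. \<psi> \<in> borel_measurable (borel \<Otimes>\<^sub>M borel) \<Longrightarrow> (\<And>y. \<bar>\<psi> y\<bar> \<le> 1) \<Longrightarrow>
      (\<integral>y. g n y * \<psi> y \<partial>\<nu>) = (\<integral>y. k n y * A \<psi> y \<partial>\<nu>)"
  shows "weakly_null \<nu> g"
proof (rule weakly_null_sets[OF finite_\<nu>])
  show "g n \<in> borel_measurable \<nu>" for n using g(1)[of n] by (simp cong: measurable_cong_sets add: sets_\<nu>)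
  show "\<bar>g n x\<bar> \<le> K" for n x by (rule g(2))
  fix E assume "E \<in> sets \<nu>"
  then have E [measurable]: "E \<in> sets (borel \<Otimes>\<^sub>M borel)" by (simp add: sets_\<nu>)
  let ?\<psi> = "indicator E :: real \<times> real \<Rightarrow> real"
  have \<psi>: "?\<psi> \<in> borel_measurable (borel \<Otimes>\<^sub>M borel)" "\<And>y. \<bar>?\<psi> y\<bar> \<le> 1" by simp_all
  have "integrable \<nu> (A ?\<psi>)" by (rule Fubini_\<nu>(1)[OF A(1)[OF \<psi>(1)] A(2)[OF \<psi>(2)]])
  from weakly_nullD[OF k this] show "(\<lambda>n. \<integral>y. g n y * indicator E y \<partial>\<nu>) \<longlonglongrightarrow> 0"
    unfolding dual[OF \<psi>] .
qed

end

context feres_observable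
begin

lemma integral_\<phi>0:
  assumes "w \<in> borel_measurable borel" "\<And>s. \<bar>w s\<bar> \<le> (K :: real)"
  shows "(\<integral>\<theta>. w (fst (B (s, \<theta>))) * \<phi>0 \<theta> \<partial>\<mu>) = (\<integral>s. w s \<partial>unif L)" and "integrable \<mu> \<phi>0" "(\<integral>\<theta>. \<phi>0 \<theta> \<partial>\<mu>) = 1"
  using \<phi>0_pushforward[OF assms] \<phi>0_pushforward[of "\<lambda>_. 1" 1] measure_unif_UNIV[OF L_pos] by simp_all

text \<open>Q averages over angles only, so it fixes functions of s.\<close>

lemma Q_kn: "Q (kn n) y = evol (Suc n) u y - cn n (fst y)"
proof -
  have "Q (kn n) y = Q (hn n) y - (\<Sum>i\<in>{1..4}. P i (snd y)) * cn n (fst y)"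
    unfolding Q_def kn_def by (simp only: right_diff_distrib sum_subtractf sum_distrib_right fst_conv)
  then show ?thesis by (simp only: P_sum' evol_Suc mult_1_left)
qed

lemma Q_kn_weak:
  assumes irr: "\<alpha> / pi \<notin> \<rat>"
  shows "weakly_null \<nu> (\<lambda>n. Q (kn n))" "weakly_null \<nu> (\<lambda>n y. Q (kn n) (B y))"
proof -
  show 1: "weakly_null \<nu> (\<lambda>n. Q (kn n))"
    by (rule weakly_null_\<nu>_transfer[OF kn_weak[OF irr], where K = "2 * C" and A = Q])
      (auto intro!: Q_bound kn_bound integral_Q_mult[where C = "2 * C" and D = 1])
  show "weakly_null \<nu> (\<lambda>n y. Q (kn n) (B y))"
  proof (rule weakly_null_\<nu>_transfer[OF 1, where K = "2 * C" and A = "\<lambda>\<psi> y. \<psi> (Binv y)"])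
    fix n and \<psi> :: "real \<times> real \<Rightarrow> real"
    assume \<psi>: "\<psi> \<in> borel_measurable (borel \<Otimes>\<^sub>M borel)" "\<And>y. \<bar>\<psi> y\<bar> \<le> 1"
    show "(\<integral>y. Q (kn n) (B y) * \<psi> y \<partial>\<nu>) = (\<integral>y. Q (kn n) y * \<psi> (Binv y) \<partial>\<nu>)"
      by (rule integral_B[OF _ \<psi>(1) Q_bound[OF kn_bound] \<psi>(2)]) measurable
  qed (measurable, auto intro!: Q_bound kn_bound)
qed

text \<open>As \<open>hn (Suc n)\<close> is \<open>Q (kn n)\<close> plus the old conditional mean,
  composed with B, the difference equals \<open>cn n (fst (B y)) - cn (Suc n) (fst y)\<close>. So
  the rotated \<open>cn n\<close>, whose rotation varies with the angle, is asymptotically a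
  function of s alone.\<close>

lemma cn_drift_weak:
  assumes irr: "\<alpha> / pi \<notin> \<rat>"
  shows "weakly_null \<nu> (\<lambda>n y. kn (Suc n) y - Q (kn n) (B y))"
proof (rule weakly_null_diff[OF _ Q_kn_weak(2)[OF irr], where K = "2 * C" and K' = "2 * C"])
  show "weakly_null \<nu> (\<lambda>n. kn (Suc n))"
    using kn_weak[OF irr] unfolding weakly_null_def by (auto intro: LIMSEQ_Suc)
qed (auto intro!: Q_bound kn_bound simp: sets_\<nu> cong: measurable_cong_sets)

lemma integral_cn: "(\<integral>s. cn n s \<partial>unif L) = (\<integral>y. u y \<partial>\<nu>)"
  unfolding cn_def using Fubini_\<nu>(2)[OF hn_measurable hn_bound, of n] integral_hn[of n] by simp

text \<open>Tested against w(s) \<phi>0(\<theta>), the rotated term integrates exactly to the mean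
  of \<open>cn n\<close>, which is the integral of u for every n. What remains is
  \<open>cn (Suc n)\<close> minus that mean, paired with w.\<close>

lemma cn_weak:
  assumes irr: "\<alpha> / pi \<notin> \<rat>" and w [measurable]: "w \<in> borel_measurable borel" "\<And>s. \<bar>w s\<bar> \<le> K"
  shows "(\<lambda>n. \<integral>s. (cn n s - (\<integral>y. u y \<partial>\<nu>)) * w s \<partial>unif L) \<longlonglongrightarrow> 0"
proof -
  interpret U: finite_measure "unif L" by (rule finite_unif_L)
  interpret \<mu>: finite_measure \<mu> by (rule finite_measure_\<mu>)
  interpret pair_sigma_finite "unif L" \<mu> ..
  define m where "m = (\<integral>y. u y \<partial>\<nu>)"
  let ?\<psi> = "\<lambda>y. w (fst y) * \<phi>0 (snd y)"
  have iw: "integrable (unif L) w" by (rule unif_bounded(1)[OF L_pos w])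
  \<comment> \<open>This test is integrable but unbounded, which is why \<open>weakly_null\<close>
    admits all of L1.\<close>
  have \<psi>: "integrable \<nu> ?\<psi>"
    unfolding \<nu>_def
  proof (rule Fubini_integrable)
    show "?\<psi> \<in> borel_measurable (unif L \<Otimes>\<^sub>M \<mu>)" by simp
    have "integrable (unif L) (\<lambda>s. \<bar>w s\<bar> * (\<integral>\<theta>. \<bar>\<phi>0 \<theta>\<bar> \<partial>\<mu>))" using iw by simp
    then show "integrable (unif L) (\<lambda>s. \<integral>\<theta>. norm (w (fst (s, \<theta>)) * \<phi>0 (snd (s, \<theta>))) \<partial>\<mu>)"
      by (simp add: abs_mult)
    show "AE s in unif L. integrable \<mu> (\<lambda>\<theta>. w (fst (s, \<theta>)) * \<phi>0 (snd (s, \<theta>)))"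
      using integral_\<phi>0(2)[OF w] by simp
  qed
  have Fub: "(\<integral>y. f y * ?\<psi> y \<partial>\<nu>) = (\<integral>s. (\<integral>\<theta>. f (s, \<theta>) * \<phi>0 \<theta> \<partial>\<mu>) * w s \<partial>unif L)"
    if f: "f \<in> borel_measurable (borel \<Otimes>\<^sub>M borel)" "\<And>y. \<bar>f y\<bar> \<le> 2 * C" for f :: "real \<times> real \<Rightarrow> real"
  proof -
    have "integrable \<nu> (\<lambda>y. f y * ?\<psi> y)"
      using f by (intro integrable_bounded_mult(1)[OF _ _ \<psi>]) (auto simp: sets_\<nu> cong: measurable_cong_sets)
    then have "(\<integral>y. f y * ?\<psi> y \<partial>\<nu>) = (\<integral>s. \<integral>\<theta>. f (s, \<theta>) * (w s * \<phi>0 \<theta>) \<partial>\<mu> \<partial>unif L)"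
      unfolding \<nu>_def by (subst integral_fst'[symmetric]) auto
    also have "\<dots> = (\<integral>s. (\<integral>\<theta>. f (s, \<theta>) * \<phi>0 \<theta> \<partial>\<mu>) * w s \<partial>unif L)"
      by (intro Bochner_Integration.integral_cong refl, subst integral_mult_left_zero[symmetric]) (simp add: mult_ac)
    finally show ?thesis .
  qed
  have drift: "kn (Suc n) y - Q (kn n) (B y) = cn n (fst (B y)) - cn (Suc n) (fst y)" for n y
    unfolding Q_kn kn_def hn_def by simp
  have "(\<integral>y. (cn n (fst (B y)) - cn (Suc n) (fst y)) * ?\<psi> y \<partial>\<nu>)
     = - (\<integral>s. (cn (Suc n) s - m) * w s \<partial>unif L)" for n
  proof -
    have "\<bar>cn n (fst (B y)) - cn (Suc n) (fst y)\<bar> \<le> 2 * C" for y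
      using cn_bound[of n "fst (B y)"] cn_bound[of "Suc n" "fst y"] by linarith
    then have "(\<integral>y. (cn n (fst (B y)) - cn (Suc n) (fst y)) * ?\<psi> y \<partial>\<nu>)
      = (\<integral>s. (\<integral>\<theta>. (cn n (fst (B (s, \<theta>))) - cn (Suc n) s) * \<phi>0 \<theta> \<partial>\<mu>) * w s \<partial>unif L)"
      by (subst Fub) auto
    also have "\<dots> = (\<integral>s. - ((cn (Suc n) s - m) * w s) \<partial>unif L)"
    proof (intro Bochner_Integration.integral_cong refl)
      fix s
      have "integrable \<mu> (\<lambda>\<theta>. cn n (fst (B (s, \<theta>))) * \<phi>0 \<theta>)" by (rule \<phi>0_pushforward[OF cn_measurable cn_bound])
      then have "(\<integral>\<theta>. (cn n (fst (B (s, \<theta>))) - cn (Suc n) s) * \<phi>0 \<theta> \<partial>\<mu>) = m - cn (Suc n) s"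
        using integral_\<phi>0[of "cn n" C, OF cn_measurable cn_bound] integral_cn[of n]
        by (simp add: left_diff_distrib m_def)
      then show "(\<integral>\<theta>. (cn n (fst (B (s, \<theta>))) - cn (Suc n) s) * \<phi>0 \<theta> \<partial>\<mu>) * w s = - ((cn (Suc n) s - m) * w s)"
        by (simp add: left_diff_distrib)
    qed
    finally show ?thesis by simp
  qed
  then have "(\<lambda>n. - (\<integral>s. (cn (Suc n) s - m) * w s \<partial>unif L)) \<longlonglongrightarrow> 0"
    using weakly_nullD[OF cn_drift_weak[OF irr] \<psi>] unfolding drift by simp
  then have "(\<lambda>n. \<integral>s. (cn (Suc n) s - m) * w s \<partial>unif L) \<longlonglongrightarrow> 0"
    using tendsto_minus_cancel_left by force
  then show ?thesis unfolding m_def by (rule LIMSEQ_imp_Suc)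
qed

text \<open>\<open>evol (Suc n) u\<close> is the weakly null \<open>Q (kn n)\<close> plus
  \<open>cn n\<close>. The latter is tested on E through w, the \<open>\<mu>\<close>-measure of the
  slices of E.\<close>

theorem evol_weak:
  assumes irr: "\<alpha> / pi \<notin> \<rat>"
  shows "weakly_null \<nu> (\<lambda>n y. evol n u y - (\<integral>y. u y \<partial>\<nu>))"
proof (rule weakly_null_sets[OF finite_\<nu>])
  define m where "m = (\<integral>y. u y \<partial>\<nu>)"
  have m: "\<bar>m\<bar> \<le> C"
  proof -
    have "\<bar>m\<bar> \<le> (\<integral>y. \<bar>u y\<bar> \<partial>\<nu>)" unfolding m_def by (rule integral_abs_bound)
    also have "\<dots> \<le> (\<integral>y. C \<partial>\<nu>)" using C C_nonneg by (intro integral_mono Fubini_\<nu>(1)[of _ C]) auto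
    finally show ?thesis using measure_\<nu>_UNIV by simp
  qed
  show "(\<lambda>y. evol n u y - (\<integral>y. u y \<partial>\<nu>)) \<in> borel_measurable \<nu>" for n
    by (simp add: sets_\<nu> cong: measurable_cong_sets)
  show "\<bar>evol n u y - (\<integral>y. u y \<partial>\<nu>)\<bar> \<le> 2 * C" for n y
    using evol_bound[where u = u and n = n and y = y, OF C] m unfolding m_def by linarith
  fix E assume "E \<in> sets \<nu>"
  then have [measurable]: "E \<in> sets (borel \<Otimes>\<^sub>M borel)" by (simp add: sets_\<nu>)
  interpret \<mu>: finite_measure \<mu> by (rule finite_measure_\<mu>)
  define w where "w s = (\<integral>\<theta>. indicator E (s, \<theta>) \<partial>\<mu> :: real)" for s
  have [measurable]: "w \<in> borel_measurable borel" unfolding w_def[abs_def] by measurable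
  have w: "\<bar>w s\<bar> \<le> 1" for s
  proof -
    have "\<bar>w s\<bar> \<le> (\<integral>\<theta>. \<bar>indicator E (s, \<theta>)\<bar> \<partial>\<mu>)" unfolding w_def by (rule integral_abs_bound)
    also have "\<dots> \<le> (\<integral>\<theta>. 1 \<partial>\<mu>)" by (intro integral_mono integrable_\<mu>_bounded[of _ 1]) auto
    finally show ?thesis using measure_\<mu>_UNIV by simp
  qed
  have cm: "\<bar>cn n s - m\<bar> \<le> 2 * C" for n s using cn_bound[of n s] m by linarith
  have "(\<integral>y. (evol (Suc n) u y - m) * indicator E y \<partial>\<nu>)
     = (\<integral>y. Q (kn n) y * indicator E y \<partial>\<nu>) + (\<integral>s. (cn n s - m) * w s \<partial>unif L)" for n
  proof -
    have "integrable \<nu> (\<lambda>y. Q (kn n) y * indicator E y)" "integrable \<nu> (\<lambda>y. (cn n (fst y) - m) * indicator E y)"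
      by (rule Fubini_\<nu>(1)[OF _ abs_indicator_le[OF Q_bound[OF kn_bound]]] Fubini_\<nu>(1)[OF _ abs_indicator_le[OF cm]]; measurable)+
    then have "(\<integral>y. Q (kn n) y * indicator E y + (cn n (fst y) - m) * indicator E y \<partial>\<nu>)
      = (\<integral>y. Q (kn n) y * indicator E y \<partial>\<nu>) + (\<integral>y. (cn n (fst y) - m) * indicator E y \<partial>\<nu>)"
      by (rule Bochner_Integration.integral_add)
    also have "(\<integral>y. (cn n (fst y) - m) * indicator E y \<partial>\<nu>) = (\<integral>s. \<integral>\<theta>. (cn n s - m) * indicator E (s, \<theta>) \<partial>\<mu> \<partial>unif L)"
      by (subst Fubini_\<nu>(2)[OF _ abs_indicator_le[OF cm]]) auto
    also have "\<dots> = (\<integral>s. (cn n s - m) * w s \<partial>unif L)" by (simp add: w_def)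
    also have "(\<lambda>y. Q (kn n) y * indicator E y + (cn n (fst y) - m) * indicator E y) = (\<lambda>y. (evol (Suc n) u y - m) * indicator E y)"
      unfolding Q_kn by (rule ext) (simp only: distrib_right[symmetric] diff_add_cancel add_diff_eq)
    finally show ?thesis .
  qed
  moreover have "(\<lambda>n. \<integral>y. Q (kn n) y * indicator E y \<partial>\<nu>) \<longlonglongrightarrow> 0"
    by (intro weakly_nullD[OF Q_kn_weak(1)[OF irr]] Fubini_\<nu>(1)[of _ 1]) auto
  moreover have "(\<lambda>n. \<integral>s. (cn n s - m) * w s \<partial>unif L) \<longlonglongrightarrow> 0"
    unfolding m_def by (rule cn_weak[OF irr _ w]) measurable
  ultimately have "(\<lambda>n. \<integral>y. (evol (Suc n) u y - m) * indicator E y \<partial>\<nu>) \<longlonglongrightarrow> 0"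
    using tendsto_add by fastforce
  then show "(\<lambda>n. \<integral>y. (evol n u y - (\<integral>y. u y \<partial>\<nu>)) * indicator E y \<partial>\<nu>) \<longlonglongrightarrow> 0"
    unfolding m_def by (rule LIMSEQ_imp_Suc)
qed

end

section \<open>The skew-product\<close>

context feres_billiard
begin

abbreviation S :: "real \<times> real \<times> real \<Rightarrow> real \<times> real \<times> real" where "S \<equiv> skew_product M r \<alpha>"

text \<open>Left end of the fibre interval of branch i. The sum stops before i, so
  \<open>cum 1\<close> is 0 and \<open>cum 5\<close> is 1.\<close>

definition cum :: "nat \<Rightarrow> real \<Rightarrow> real" where "cum i \<theta> = (\<Sum>k\<in>{1..<i}. P k \<theta>)"

lemma cum_measurable [measurable]: "cum i \<in> borel_measurable borel"
  unfolding cum_def[abs_def] by measurable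

lemma cum_Suc: "1 \<le> i \<Longrightarrow> cum (Suc i) \<theta> = cum i \<theta> + P i \<theta>"
  by (simp add: cum_def)

lemma cum_simps: "cum 1 \<theta> = 0" "cum 5 \<theta> = 1"
  using P_sum'[of \<theta>] by (simp_all add: cum_def atLeastLessThan_nat_numeral numeral_eq_Suc)

lemma cum_mono: "i \<le> j \<Longrightarrow> j \<le> 5 \<Longrightarrow> cum i \<theta> \<le> cum j \<theta>"
  unfolding cum_def by (intro sum_mono2) (auto intro!: P_nonneg)

lemma skew_domain_iff:
  "1 \<le> i \<Longrightarrow> (\<theta>, x) \<in> skew_domain \<alpha> i \<longleftrightarrow> \<theta> \<in> {0..pi} \<and> x \<in> {0..1} \<and> cum i \<theta> < x \<and> x < cum (Suc i) \<theta>"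
  by (simp add: skew_domain_def cum_def atLeastLessThanSuc_atLeastAtMost)

lemma skew_domain_disjoint:
  assumes "i \<in> {1..4}" "j \<in> {1..4}" "(\<theta>, x) \<in> skew_domain \<alpha> i" "(\<theta>, x) \<in> skew_domain \<alpha> j"
  shows "i = j"
proof (rule ccontr)
  assume "i \<noteq> j"
  then consider "Suc i \<le> j" | "Suc j \<le> i" by linarith
  then show False
    using assms cum_mono[of "Suc i" j \<theta>] cum_mono[of "Suc j" i \<theta>] by cases (auto simp: skew_domain_iff)
qed

lemma skew_product_branch:
  assumes "i \<in> {1..4}" "(\<theta>, x) \<in> skew_domain \<alpha> i"
  shows "S (x, s, \<theta>) = ((x - cum i \<theta>) / P i \<theta>, B (s, T i \<theta>))"
proof -
  have "(THE i. i \<in> {1..4} \<and> (\<theta>, x) \<in> skew_domain \<alpha> i) = i"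
    using assms skew_domain_disjoint by (intro the_equality) blast+
  moreover have "\<exists>i\<in>{1..4}. (\<theta>, x) \<in> skew_domain \<alpha> i" using assms by blast
  ultimately show ?thesis by (simp add: skew_product_def Let_def skew_fibre_def random_billiard_def cum_def)
qed

text \<open>Unfolding the definite description into finitely many cases makes measurability
  accessible.\<close>

lemma skew_product_cases:
  "S (x, s, \<theta>) = (if (\<theta>, x) \<in> skew_domain \<alpha> 1 then ((x - cum 1 \<theta>) / P 1 \<theta>, B (s, T 1 \<theta>))
    else if (\<theta>, x) \<in> skew_domain \<alpha> 2 then ((x - cum 2 \<theta>) / P 2 \<theta>, B (s, T 2 \<theta>))
    else if (\<theta>, x) \<in> skew_domain \<alpha> 3 then ((x - cum 3 \<theta>) / P 3 \<theta>, B (s, T 3 \<theta>))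
    else if (\<theta>, x) \<in> skew_domain \<alpha> 4 then ((x - cum 4 \<theta>) / P 4 \<theta>, B (s, T 4 \<theta>))
    else (x, s, \<theta>))"
proof -
  consider i where "i \<in> {1..4}" "(\<theta>, x) \<in> skew_domain \<alpha> i" | "\<forall>i\<in>{1..4}. (\<theta>, x) \<notin> skew_domain \<alpha> i" by blast
  then show ?thesis
  proof cases
    case (1 i)
    have n: "(\<theta>, x) \<notin> skew_domain \<alpha> j" if "j \<in> {1..4}" "j \<noteq> i" for j using skew_domain_disjoint 1 that by blast
    show ?thesis using 1(1)
      by (cases rule: index_cases; use n 1(2) skew_product_branch[OF 1, of s] in simp)
  next
    case 2
    then have "(\<theta>, x) \<notin> skew_domain \<alpha> 1" "(\<theta>, x) \<notin> skew_domain \<alpha> 2" "(\<theta>, x) \<notin> skew_domain \<alpha> 3" "(\<theta>, x) \<notin> skew_domain \<alpha> 4"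
      by auto
    with 2 show ?thesis by (simp add: skew_product_def)
  qed
qed

abbreviation \<B> :: "(real \<times> real \<times> real) measure" where "\<B> \<equiv> borel \<Otimes>\<^sub>M (borel \<Otimes>\<^sub>M borel)"

lemma S_measurable [measurable]: "S \<in> \<B> \<rightarrow>\<^sub>M \<B>"
proof -
  have "(\<lambda>(x, s, \<theta>). S (x, s, \<theta>)) \<in> \<B> \<rightarrow>\<^sub>M \<B>"
    unfolding skew_product_cases by (simp only: skew_domain_iff le_refl one_le_numeral) measurable
  then show ?thesis by simp
qed

lemma Sn_measurable [measurable]: "S ^^ n \<in> \<B> \<rightarrow>\<^sub>M \<B>"
  by (induction n) (auto intro: measurable_comp)

lemma integral_branch:
  fixes \<omega> \<phi> :: "real \<Rightarrow> real"
  assumes [measurable]: "\<omega> \<in> borel_measurable borel" "\<phi> \<in> borel_measurable borel"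
    and bd: "\<And>x. \<bar>\<omega> x\<bar> \<le> K" "\<And>x. \<bar>\<phi> x\<bar> \<le> D" and p: "0 \<le> p"
  shows "integrable lborel (\<lambda>x. \<omega> ((x - b) / p) * \<phi> x * indicator {b<..<b + p} x)"
    and "(\<integral>x. \<omega> ((x - b) / p) * \<phi> x * indicator {b<..<b + p} x \<partial>lborel) = p * (\<integral>x. \<omega> x * \<phi> (b + p * x) \<partial>unif 1)"
proof -
  have "\<bar>\<omega> x * \<phi> y\<bar> \<le> K * D" for x y
    unfolding abs_mult using bd(1)[of x] bd(2)[of y] by (intro mult_mono) auto
  then show "integrable lborel (\<lambda>x. \<omega> ((x - b) / p) * \<phi> x * indicator {b<..<b + p} x)"
    by (intro integrable_bounded_mult(1)[where C = "K * D"]) (auto simp: emeasure_lborel_Ioo p)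
  show "(\<integral>x. \<omega> ((x - b) / p) * \<phi> x * indicator {b<..<b + p} x \<partial>lborel) = p * (\<integral>x. \<omega> x * \<phi> (b + p * x) \<partial>unif 1)"
  \<comment> \<open>For p = 0 the interval is empty, so the quotient by 0 is never seen.\<close>
  proof (cases "p = 0")
    case False
    then have p: "0 < p" using assms(5) by simp
    have "(\<integral>x. \<omega> ((x - b) / p) * \<phi> x * indicator {b<..<b + p} x \<partial>lborel)
       = p * (\<integral>x. \<omega> x * \<phi> (b + p * x) * indicator {b<..<b + p} (b + p * x) \<partial>lborel)"
      using p by (subst lborel_integral_real_affine[of p _ b]) auto
    also have "(\<integral>x. \<omega> x * \<phi> (b + p * x) * indicator {b<..<b + p} (b + p * x) \<partial>lborel)
       = (\<integral>x. \<omega> x * \<phi> (b + p * x) * indicator {0..1} x \<partial>lborel)"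
    proof (rule integral_cong_AE)
      show "AE x in lborel. \<omega> x * \<phi> (b + p * x) * indicator {b<..<b + p} (b + p * x) = \<omega> x * \<phi> (b + p * x) * indicator {0..1} x"
        using AE_lborel_singleton[of 0] AE_lborel_singleton[of 1]
      proof eventually_elim
        case (elim x)
        then have "b + p * x \<in> {b<..<b + p} \<longleftrightarrow> x \<in> {0..1}" using p by (auto simp: zero_less_mult_iff)
        then show ?case by (simp add: indicator_def)
      qed
    qed measurable
    finally show ?thesis by (subst integral_unif) auto
  qed simp
qed

text \<open>Each branch stretches its fibre interval onto the unit interval: under the uniform law
  it is chosen with probability \<open>P i \<theta>\<close>, and the new x is again uniform.\<close>

lemma integral_skew_fibre:
  fixes W :: "real \<times> real \<times> real \<Rightarrow> real" and \<phi> :: "real \<Rightarrow> real"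
  assumes [measurable]: "W \<in> borel_measurable \<B>" "\<phi> \<in> borel_measurable borel"
    and bd: "\<And>z. \<bar>W z\<bar> \<le> K" "\<And>x. \<bar>\<phi> x\<bar> \<le> D" and \<theta>: "\<theta> \<in> {0..pi}"
  shows "(\<integral>x. W (S (x, s, \<theta>)) * \<phi> x \<partial>unif 1)
    = (\<Sum>i\<in>{1..4}. P i \<theta> * (\<integral>x. W (x, B (s, T i \<theta>)) * \<phi> (cum i \<theta> + P i \<theta> * x) \<partial>unif 1))"
proof -
  let ?\<omega> = "\<lambda>i x. W (x, B (s, T i \<theta>))"
  let ?g = "\<lambda>i x. ?\<omega> i ((x - cum i \<theta>) / P i \<theta>) * \<phi> x * indicator {cum i \<theta><..<cum i \<theta> + P i \<theta>} x"
  \<comment> \<open>In the unit interval only the five division points are uncovered, where the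
    skew-product is the identity by convention.\<close>
  have ae: "AE x in lborel. W (S (x, s, \<theta>)) * \<phi> x * indicator {0..1} x = (\<Sum>i\<in>{1..4}. ?g i x)"
    using AE_lborel_singleton[of "cum 1 \<theta>"] AE_lborel_singleton[of "cum 2 \<theta>"] AE_lborel_singleton[of "cum 3 \<theta>"]
      AE_lborel_singleton[of "cum 4 \<theta>"] AE_lborel_singleton[of "cum 5 \<theta>"]
  proof eventually_elim
    case (elim x)
    have cs: "cum 2 \<theta> = cum 1 \<theta> + P 1 \<theta>" "cum 3 \<theta> = cum 2 \<theta> + P 2 \<theta>" "cum 4 \<theta> = cum 3 \<theta> + P 3 \<theta>" "cum 5 \<theta> = cum 4 \<theta> + P 4 \<theta>"
      using cum_Suc[of 1 \<theta>] cum_Suc[of 2 \<theta>] cum_Suc[of 3 \<theta>] cum_Suc[of 4 \<theta>] by (simp_all add: numeral_eq_Suc)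
    have dom: "(\<theta>, x) \<in> skew_domain \<alpha> i \<longleftrightarrow> x \<in> {cum i \<theta><..<cum i \<theta> + P i \<theta>}" if "i \<in> {1..4}" for i
    proof -
      have "0 \<le> cum i \<theta>" "cum (Suc i) \<theta> \<le> 1"
        using that cum_mono[of 1 i \<theta>] cum_mono[of "Suc i" 5 \<theta>] cum_simps[of \<theta>] by auto
      then show ?thesis using that \<theta> cum_Suc[of i \<theta>] by (auto simp: skew_domain_iff)
    qed
    show ?case
    proof (cases "\<exists>i\<in>{1..4}. (\<theta>, x) \<in> skew_domain \<alpha> i")
      case True
      then obtain i where i: "i \<in> {1..4}" "(\<theta>, x) \<in> skew_domain \<alpha> i" by blast
      have "(\<Sum>j\<in>{1..4}. ?g j x) = (\<Sum>j\<in>{i}. ?g j x)"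
      proof (rule sum.mono_neutral_right)
        show "\<forall>j\<in>{1..4} - {i}. ?g j x = 0"
        proof
          fix j assume j: "j \<in> {1..4} - {i}"
          then have "(\<theta>, x) \<notin> skew_domain \<alpha> j" using i skew_domain_disjoint by blast
          then show "?g j x = 0" using dom[of j] j by auto
        qed
      qed (use i in auto)
      also have "\<dots> = ?g i x"
      proof -
        have "(\<Sum>j\<in>{i}. f j) = f i" for f :: "nat \<Rightarrow> real" by simp
        then show ?thesis .
      qed
      finally have "(\<Sum>j\<in>{1..4}. ?g j x) = ?g i x" .
      moreover have "x \<in> {0..1}" using i by (simp add: skew_domain_iff)
      moreover have "x \<in> {cum i \<theta><..<cum i \<theta> + P i \<theta>}" using i dom by blast
      ultimately show ?thesis unfolding skew_product_branch[OF i, of s] by (simp only: indicator_simps)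
    next
      case False
      have "?g i x = 0" if "i \<in> {1..4}" for i using False dom[OF that] that by auto
      then have "(\<Sum>i\<in>{1..4}. ?g i x) = 0" by (intro sum.neutral) blast
      moreover have "x \<notin> {0..1}"
      proof
        assume x: "x \<in> {0..1}"
        have "\<not> (cum i \<theta> < x \<and> x < cum i \<theta> + P i \<theta>)" if "i \<in> {1..4}" for i using False dom[OF that] that by auto
        from this[of 1] this[of 2] this[of 3] this[of 4] show False using x elim cs cum_simps[of \<theta>] by auto
      qed
      ultimately show ?thesis by (simp only: indicator_simps mult_zero_right not_False_eq_True)
    qed
  qed
  have g: "integrable lborel (?g i)" "(\<integral>x. ?g i x \<partial>lborel) = P i \<theta> * (\<integral>x. ?\<omega> i x * \<phi> (cum i \<theta> + P i \<theta> * x) \<partial>unif 1)"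
    if "i \<in> {1..4}" for i
  proof -
    have "?\<omega> i \<in> borel_measurable borel" by simp
    note * = integral_branch[OF this assms(2) bd P_nonneg[OF that]]
    show "integrable lborel (?g i)" "(\<integral>x. ?g i x \<partial>lborel) = P i \<theta> * (\<integral>x. ?\<omega> i x * \<phi> (cum i \<theta> + P i \<theta> * x) \<partial>unif 1)"
      by (rule *)+
  qed
  have "(\<integral>x. W (S (x, s, \<theta>)) * \<phi> x \<partial>unif 1) = (\<integral>x. W (S (x, s, \<theta>)) * \<phi> x * indicator {0..1} x \<partial>lborel)"
    by (subst integral_unif) auto
  also have "\<dots> = (\<integral>x. (\<Sum>i\<in>{1..4}. ?g i x) \<partial>lborel)"
    by (rule integral_cong_AE[OF _ _ ae]) measurable
  also have "\<dots> = (\<Sum>i\<in>{1..4}. P i \<theta> * (\<integral>x. ?\<omega> i x * \<phi> (cum i \<theta> + P i \<theta> * x) \<partial>unif 1))"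
    by (subst Bochner_Integration.integral_sum[OF g(1)]) (auto intro!: sum.cong simp only: g(2))
  finally show ?thesis .
qed

section \<open>The invariant law on the whole space and the transfer operator\<close>

definition \<xi> :: "(real \<times> real \<times> real) measure" where "\<xi> = unif 1 \<Otimes>\<^sub>M \<nu>"

lemma sets_\<xi> [measurable_cong]: "sets \<xi> = sets \<B>"
  unfolding \<xi>_def by (intro sets_pair_measure_cong) (simp_all add: sets_\<nu>)

lemma space_\<xi> [simp]: "space \<xi> = UNIV" by (simp add: \<xi>_def space_pair_measure)

lemma finite_\<xi>: "finite_measure \<xi>"
  unfolding \<xi>_def by (intro finite_measure_pair_measure finite_measure_unif finite_\<nu>) simp

lemma Fubini_\<xi>:
  fixes u :: "real \<times> real \<times> real \<Rightarrow> real"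
  assumes u: "u \<in> borel_measurable \<B>" "\<And>y. \<bar>u y\<bar> \<le> K"
  shows "integrable \<xi> u" and "(\<integral>z. u z \<partial>\<xi>) = (\<integral>y. \<integral>x. u (x, y) \<partial>unif 1 \<partial>\<nu>)"
proof -
  have "u \<in> borel_measurable (unif 1 \<Otimes>\<^sub>M \<nu>)" using u(1) sets_\<xi> by (simp add: \<xi>_def cong: measurable_cong_sets)
  note * = Fubini_bounded[OF finite_measure_unif[OF zero_less_one] finite_\<nu> this u(2)]
  show "integrable \<xi> u" "(\<integral>z. u z \<partial>\<xi>) = (\<integral>y. \<integral>x. u (x, y) \<partial>unif 1 \<partial>\<nu>)"
    using * by (auto simp: \<xi>_def)
qed

lemma section_measurable:
  assumes F: "F \<in> borel_measurable \<B>" and g: "g \<in> borel_measurable borel"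
  shows "(\<lambda>x. F (g x, b) :: real) \<in> borel_measurable borel"
proof -
  have "(\<lambda>x. (g x, b)) \<in> borel \<rightarrow>\<^sub>M \<B>"
    by (rule measurable_Pair[OF g measurable_const]) (simp add: space_pair_measure)
  from measurable_compose[OF this F] show ?thesis .
qed

text \<open>The transfer operator of the skew-product with respect to \<open>\<xi>\<close>, see \<open>integral_skew_product\<close>.\<close>

definition R :: "(real \<times> real \<times> real \<Rightarrow> real) \<Rightarrow> real \<times> real \<times> real \<Rightarrow> real" where
  "R \<Phi> = (\<lambda>(x, y). \<Sum>i\<in>{1..4}. P (dual i) (snd y) *
    \<Phi> (cum i (T (dual i) (snd y)) + P i (T (dual i) (snd y)) * x, fst (Binv y), T (dual i) (snd y)))"

lemma R_measurable [measurable]: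
  assumes [measurable]: "\<Phi> \<in> borel_measurable \<B>" shows "R \<Phi> \<in> borel_measurable \<B>"
  unfolding R_def case_prod_beta' by (intro borel_measurable_sum) measurable

lemma dual_in: "i \<in> {1..4} \<Longrightarrow> dual i \<in> {1..4}" by (auto simp: dual_def)

lemma P_dual_sum: "(\<Sum>i\<in>{1..4}. P (dual i) \<theta>) = 1"
  using sum.reindex_bij_betw[OF bij_betw_dual, of "\<lambda>i. P i \<theta>"] P_sum'[of \<theta>] by (simp only:)

lemma convex_bound:
  assumes "\<And>i. i \<in> {1..4} \<Longrightarrow> \<bar>f i\<bar> \<le> K"
  shows "\<bar>\<Sum>i\<in>{1..4}. P (dual i) \<theta> * f i\<bar> \<le> (K :: real)"
proof -
  have "\<bar>\<Sum>i\<in>{1..4}. P (dual i) \<theta> * f i\<bar> \<le> (\<Sum>i\<in>{1..4}. \<bar>P (dual i) \<theta> * f i\<bar>)" by (rule sum_abs)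
  also have "\<dots> \<le> (\<Sum>i\<in>{1..4}. P (dual i) \<theta> * K)"
    using assms P_nonneg[OF dual_in] by (intro sum_mono) (simp add: abs_mult mult_left_mono)
  also have "\<dots> = K" by (simp only: sum_distrib_right[symmetric] P_dual_sum mult_1_left)
  finally show ?thesis .
qed

lemma R_bound: "(\<And>z. \<bar>\<Phi> z\<bar> \<le> D) \<Longrightarrow> \<bar>R \<Phi> z\<bar> \<le> D"
  by (cases z) (auto simp only: R_def split_conv intro!: convex_bound)

text \<open>Duality branch by branch: the fibre is stretched, the angle is carried along
  \<open>T i\<close> by detailed balance, and the position is carried along B by invariance.\<close>

lemma integral_skew_product:
  fixes W \<Phi> :: "real \<times> real \<times> real \<Rightarrow> real"
  assumes [measurable]: "W \<in> borel_measurable \<B>" "\<Phi> \<in> borel_measurable \<B>"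
    and bd: "\<And>z. \<bar>W z\<bar> \<le> K" "\<And>z. \<bar>\<Phi> z\<bar> \<le> D"
  shows "(\<integral>z. W (S z) * \<Phi> z \<partial>\<xi>) = (\<integral>z. W z * R \<Phi> z \<partial>\<xi>)"
proof -
  interpret U: finite_measure "unif 1" by (rule finite_measure_unif) simp
  have KD: "\<bar>W z * \<Phi> z'\<bar> \<le> K * D" for z z'
    unfolding abs_mult using bd(1)[of z] bd(2)[of z'] by (intro mult_mono) auto
  have PKD: "\<bar>P i \<theta> * a\<bar> \<le> K * D" if "i \<in> {1..4}" "\<bar>a\<bar> \<le> K * D" for i \<theta> a
    using mult_mono[OF P_le_1[OF that(1), of \<theta>] that(2)] P_nonneg[OF that(1), of \<theta>] by (simp add: abs_mult)
  \<comment> \<open>\<open>V\<close> is the contribution of branch i seen from the starting point,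
    \<open>Y\<close> the same seen from the end point.\<close>
  define V where "V i y = (\<integral>x. W (x, B (fst y, T i (snd y))) * \<Phi> (cum i (snd y) + P i (snd y) * x, y) \<partial>unif 1)" for i y
  define Y where "Y i y = (\<integral>x. W (x, y) * \<Phi> (cum i (T (dual i) (snd y)) + P i (T (dual i) (snd y)) * x, fst (Binv y), T (dual i) (snd y)) \<partial>unif 1)" for i y
  have [measurable]: "V i \<in> borel_measurable (borel \<Otimes>\<^sub>M borel)" for i
    unfolding V_def[abs_def] by measurable
  have [measurable]: "Y i \<in> borel_measurable (borel \<Otimes>\<^sub>M borel)" for i
    unfolding Y_def[abs_def] by measurable
  have V: "\<bar>V i y\<bar> \<le> K * D" for i y unfolding V_def
    by (rule unif_bounded(2)[OF zero_less_one _ KD]) (intro borel_measurable_times section_measurable; measurable)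
  have Y: "\<bar>Y i y\<bar> \<le> K * D" for i y unfolding Y_def
    by (rule unif_bounded(2)[OF zero_less_one _ KD]) (intro borel_measurable_times section_measurable; measurable)
  have "(\<integral>z. W (S z) * \<Phi> z \<partial>\<xi>) = (\<integral>y. \<integral>x. W (S (x, y)) * \<Phi> (x, y) \<partial>unif 1 \<partial>\<nu>)"
    by (rule Fubini_\<xi>(2)[OF _ KD]) measurable
  also have "\<dots> = (\<integral>y. (\<Sum>i\<in>{1..4}. P i (snd y) * V i y) \<partial>\<nu>)"
  proof (rule integral_cong_AE)
    show "AE y in \<nu>. (\<integral>x. W (S (x, y)) * \<Phi> (x, y) \<partial>unif 1) = (\<Sum>i\<in>{1..4}. P i (snd y) * V i y)"
      using AE_\<nu>
    proof eventually_elim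
      case (elim y)
      then show ?case
        unfolding V_def
        using integral_skew_fibre[of W "\<lambda>x. \<Phi> (x, y)" K D "snd y" "fst y"] bd section_measurable[OF assms(2), of "\<lambda>x. x" y] by simp
    qed
  qed measurable
  also have "\<dots> = (\<Sum>i\<in>{1..4}. \<integral>y. P i (snd y) * V i y \<partial>\<nu>)"
    by (intro Bochner_Integration.integral_sum Fubini_\<nu>(1)[OF _ PKD[OF _ V]]) measurable
  also have "\<dots> = (\<Sum>i\<in>{1..4}. \<integral>y. P (dual i) (snd y) * Y i y \<partial>\<nu>)"
  proof (rule sum.cong[OF refl])
    fix i :: nat assume i: "i \<in> {1..4}"
    have "(\<integral>y. P i (snd y) * V i y \<partial>\<nu>) = (\<integral>y. P (dual i) (snd y) * V i (fst y, T (dual i) (snd y)) \<partial>\<nu>)"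
      by (rule integral_P[OF _ V i]) measurable
    also have "\<dots> = (\<integral>y. P (dual i) (snd (B y)) * Y i (B y) \<partial>\<nu>)"
    proof (rule integral_cong_AE)
      show "AE y in \<nu>. P (dual i) (snd y) * V i (fst y, T (dual i) (snd y)) = P (dual i) (snd (B y)) * Y i (B y)"
        using AE_\<nu> by eventually_elim (simp add: V_def Y_def Binv_B T_dual'[OF i])
    qed measurable
    also have "\<dots> = (\<integral>y. P (dual i) (snd y) * Y i y \<partial>\<nu>)"
      by (rule integral_B'[OF _ PKD[OF dual_in[OF i] Y]]) measurable
    finally show "(\<integral>y. P i (snd y) * V i y \<partial>\<nu>) = (\<integral>y. P (dual i) (snd y) * Y i y \<partial>\<nu>)" .
  qed
  also have "\<dots> = (\<integral>y. (\<Sum>i\<in>{1..4}. P (dual i) (snd y) * Y i y) \<partial>\<nu>)"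
    by (intro Bochner_Integration.integral_sum[symmetric] Fubini_\<nu>(1)[OF _ PKD[OF dual_in Y]]) measurable
  also have "\<dots> = (\<integral>y. \<integral>x. W (x, y) * R \<Phi> (x, y) \<partial>unif 1 \<partial>\<nu>)"
  proof (rule Bochner_Integration.integral_cong[OF refl])
    fix y
    let ?f = "\<lambda>i x. W (x, y) * \<Phi> (cum i (T (dual i) (snd y)) + P i (T (dual i) (snd y)) * x, fst (Binv y), T (dual i) (snd y))"
    have "(\<Sum>i\<in>{1..4}. P (dual i) (snd y) * Y i y) = (\<Sum>i\<in>{1..4}. \<integral>x. P (dual i) (snd y) * ?f i x \<partial>unif 1)"
      by (simp only: Y_def integral_mult_right_zero)
    also have "\<dots> = (\<integral>x. (\<Sum>i\<in>{1..4}. P (dual i) (snd y) * ?f i x) \<partial>unif 1)"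
      by (intro Bochner_Integration.integral_sum[symmetric] integrable_mult_right unif_bounded(1)[OF zero_less_one _ KD]
          borel_measurable_times section_measurable) measurable
    also have "\<dots> = (\<integral>x. W (x, y) * R \<Phi> (x, y) \<partial>unif 1)"
      by (simp only: R_def split_conv sum_distrib_left mult.left_commute)
    finally show "(\<Sum>i\<in>{1..4}. P (dual i) (snd y) * Y i y) = (\<integral>x. W (x, y) * R \<Phi> (x, y) \<partial>unif 1)" .
  qed
  also have "\<dots> = (\<integral>z. W z * R \<Phi> z \<partial>\<xi>)"
  proof (rule Fubini_\<xi>(2)[symmetric])
    show "\<bar>W z * R \<Phi> z\<bar> \<le> K * D" for z
      unfolding abs_mult using bd(1)[of z] R_bound[of \<Phi> D z, OF bd(2)] by (intro mult_mono) auto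
  qed measurable
  finally show ?thesis .
qed

lemma R_iterate_measurable [measurable]: "\<Phi> \<in> borel_measurable \<B> \<Longrightarrow> (R ^^ k) \<Phi> \<in> borel_measurable \<B>"
  by (induction k) auto

lemma R_iterate_bound: "(\<And>z. \<bar>\<Phi> z\<bar> \<le> D) \<Longrightarrow> \<bar>(R ^^ k) \<Phi> z\<bar> \<le> D"
  by (induction k arbitrary: z) (simp, simp only: funpow.simps comp_apply R_bound)

lemma integral_skew_product_iterate:
  fixes W \<Phi> :: "real \<times> real \<times> real \<Rightarrow> real"
  assumes "W \<in> borel_measurable \<B>" "\<Phi> \<in> borel_measurable \<B>"
    and bd: "\<And>z. \<bar>W z\<bar> \<le> K" "\<And>z. \<bar>\<Phi> z\<bar> \<le> D"
  shows "(\<integral>z. W ((S ^^ k) z) * \<Phi> z \<partial>\<xi>) = (\<integral>z. W z * (R ^^ k) \<Phi> z \<partial>\<xi>)"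
  using assms(2) bd(2)
proof (induction k arbitrary: \<Phi>)
  case (Suc k)
  note [measurable] = assms(1) Suc.prems(1)
  have "(\<integral>z. W ((S ^^ k) (S z)) * \<Phi> z \<partial>\<xi>) = (\<integral>z. W ((S ^^ k) z) * R \<Phi> z \<partial>\<xi>)"
    by (rule integral_skew_product[where W = "\<lambda>z. W ((S ^^ k) z)", OF _ _ bd(1) Suc.prems(2)]) measurable
  also have "\<dots> = (\<integral>z. W z * (R ^^ k) (R \<Phi>) z \<partial>\<xi>)"
    by (rule Suc.IH) (use R_bound[of \<Phi> D, OF Suc.prems(2)] in measurable)
  finally show ?case by (simp add: funpow_swap1)
qed simp

text \<open>\<open>Rl l\<close> is a Lipschitz constant in \<open>x\<close> of \<open>R \<Phi>\<close> if \<open>l\<close> is one of \<open>\<Phi>\<close>.\<close>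

definition Rl :: "(real \<Rightarrow> real) \<Rightarrow> real \<Rightarrow> real" where
  "Rl l \<theta> = (\<Sum>i\<in>{1..4}. P (dual i) \<theta> * (P i (T (dual i) \<theta>) * l (T (dual i) \<theta>)))"

lemma Rl_measurable [measurable]:
  assumes [measurable]: "l \<in> borel_measurable borel" shows "Rl l \<in> borel_measurable borel"
  unfolding Rl_def[abs_def] by (intro borel_measurable_sum) measurable

text \<open>The inverse of branch i contracts x by the probability of that branch at the preimage
  angle.\<close>

lemma R_Lipschitz:
  assumes "\<And>x x' y. \<bar>\<Phi> (x, y) - \<Phi> (x', y)\<bar> \<le> l (snd y) * \<bar>x - x'\<bar>"
  shows "\<bar>R \<Phi> (x, y) - R \<Phi> (x', y)\<bar> \<le> Rl l (snd y) * \<bar>x - x'\<bar>"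
proof -
  let ?p = "\<lambda>i. P (dual i) (snd y)" and ?T = "\<lambda>i. T (dual i) (snd y)"
  let ?z = "\<lambda>i x. (cum i (?T i) + P i (?T i) * x, fst (Binv y), ?T i)"
  have "R \<Phi> (x, y) - R \<Phi> (x', y) = (\<Sum>i\<in>{1..4}. ?p i * (\<Phi> (?z i x) - \<Phi> (?z i x')))"
    by (simp only: R_def split_conv sum_subtractf right_diff_distrib)
  then have "\<bar>R \<Phi> (x, y) - R \<Phi> (x', y)\<bar> \<le> (\<Sum>i\<in>{1..4}. \<bar>?p i * (\<Phi> (?z i x) - \<Phi> (?z i x'))\<bar>)"
    by (simp only: sum_abs)
  also have "\<dots> \<le> (\<Sum>i\<in>{1..4}. ?p i * (P i (?T i) * l (?T i)) * \<bar>x - x'\<bar>)"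
  proof (rule sum_mono)
    fix i :: nat assume i: "i \<in> {1..4}"
    have "\<bar>\<Phi> (?z i x) - \<Phi> (?z i x')\<bar> \<le> l (?T i) * \<bar>P i (?T i) * x - P i (?T i) * x'\<bar>"
      using assms[of "cum i (?T i) + P i (?T i) * x" "(fst (Binv y), ?T i)" "cum i (?T i) + P i (?T i) * x'"] by simp
    also have "\<bar>P i (?T i) * x - P i (?T i) * x'\<bar> = P i (?T i) * \<bar>x - x'\<bar>"
      using P_nonneg[OF i, of "?T i"] by (simp add: right_diff_distrib[symmetric] abs_mult)
    finally have "?p i * \<bar>\<Phi> (?z i x) - \<Phi> (?z i x')\<bar> \<le> ?p i * (l (?T i) * (P i (?T i) * \<bar>x - x'\<bar>))"
      using P_nonneg[OF dual_in[OF i]] by (rule mult_left_mono)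
    then show "\<bar>?p i * (\<Phi> (?z i x) - \<Phi> (?z i x'))\<bar> \<le> ?p i * (P i (?T i) * l (?T i)) * \<bar>x - x'\<bar>"
      using P_nonneg[OF dual_in[OF i], of "snd y"] by (simp add: abs_mult mult_ac)
  qed
  also have "\<dots> = Rl l (snd y) * \<bar>x - x'\<bar>" by (simp only: Rl_def sum_distrib_right)
  finally show ?thesis .
qed

section \<open>Decay in the mean of the Lipschitz constants in the fibre\<close>

context
  fixes K :: real assumes K: "0 \<le> K"
begin

definition lk :: "nat \<Rightarrow> real \<Rightarrow> real" where "lk k = (Rl ^^ k) (\<lambda>_. K)"

lemma lk_simps: "lk 0 = (\<lambda>_. K)" "lk (Suc k) = Rl (lk k)" by (simp_all add: lk_def)

lemma lk_measurable [measurable]: "lk k \<in> borel_measurable borel"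
  by (induction k) (simp_all add: lk_simps)

lemma lk_bounds: "0 \<le> lk k \<theta>" "lk k \<theta> \<le> K"
proof -
  have "0 \<le> lk k \<theta> \<and> \<bar>lk k \<theta>\<bar> \<le> K"
  proof (induction k arbitrary: \<theta>)
    case (Suc k)
    have "0 \<le> lk (Suc k) \<theta>"
      unfolding lk_simps Rl_def using Suc P_nonneg dual_in by (intro sum_nonneg mult_nonneg_nonneg) auto
    moreover have "\<bar>P i \<theta> * lk k \<theta>\<bar> \<le> K" if "i \<in> {1..4}" for i \<theta>
      using mult_mono[OF P_le_1[OF that, of \<theta>], of "lk k \<theta>" K] Suc[of \<theta>] P_nonneg[OF that, of \<theta>] by (auto simp: abs_mult)
    then have "\<bar>lk (Suc k) \<theta>\<bar> \<le> K" unfolding lk_simps Rl_def by (intro convex_bound)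
    ultimately show ?case by blast
  qed (simp add: lk_simps K)
  then show "0 \<le> lk k \<theta>" "lk k \<theta> \<le> K" by auto
qed

lemma P_lk_bound: "i \<in> {1..4} \<Longrightarrow> j \<in> {1..4} \<Longrightarrow> \<bar>P i \<theta> * (P j \<theta>' * lk k \<theta>'')\<bar> \<le> K"
  unfolding abs_mult
  using mult_mono[OF P_le_1[of i \<theta>] mult_mono[OF P_le_1[of j \<theta>'] lk_bounds(2)[of k \<theta>'']]] lk_bounds(1)[of k \<theta>'']
    P_nonneg[of i \<theta>] P_nonneg[of j \<theta>'] by simp

text \<open>Detailed balance turns the sum over preimages into a sum over images. The probability
  appears squared, once as the weight of the branch and once as its contraction factor.\<close>

lemma integral_lk_Suc: "(\<integral>\<theta>. lk (Suc k) \<theta> \<partial>\<mu>) = (\<integral>\<theta>. (\<Sum>i\<in>{1..4}. (P i \<theta>)\<^sup>2) * lk k \<theta> \<partial>\<mu>)"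
proof -
  have "(\<integral>\<theta>. lk (Suc k) \<theta> \<partial>\<mu>) = (\<Sum>i\<in>{1..4}. \<integral>\<theta>. P (dual i) \<theta> * (P i (T (dual i) \<theta>) * lk k (T (dual i) \<theta>)) \<partial>\<mu>)"
    unfolding lk_simps Rl_def
    by (intro Bochner_Integration.integral_sum integrable_\<mu>_bounded[OF _ P_lk_bound[OF dual_in]]) measurable
  also have "\<dots> = (\<Sum>i\<in>{1..4}. \<integral>\<theta>. P i \<theta> * (P i \<theta> * lk k \<theta>) \<partial>\<mu>)"
    by (intro sum.cong refl integral_P_\<mu>[where g = "\<lambda>\<theta>. P i \<theta> * lk k \<theta>" for i, symmetric]) measurable
  also have "\<dots> = (\<integral>\<theta>. (\<Sum>i\<in>{1..4}. P i \<theta> * (P i \<theta> * lk k \<theta>)) \<partial>\<mu>)"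
    by (intro Bochner_Integration.integral_sum[symmetric] integrable_\<mu>_bounded[OF _ P_lk_bound]) measurable
  finally show ?thesis by (simp only: sum_distrib_right power2_eq_square mult.assoc)
qed

text \<open>1 minus the sum of squares is twice the sum of products of distinct probabilities.
  Between \<alpha> and \<pi> - \<alpha> one of the branches 1, 2 competes with one of 3, 4; nearer
  to the ends a single branch is certain.\<close>

lemma P_squares: "(\<Sum>i\<in>{1..4}. (P i \<theta>)\<^sup>2) \<le> 1" "\<alpha> < \<theta> \<Longrightarrow> \<theta> < pi - \<alpha> \<Longrightarrow> (\<Sum>i\<in>{1..4}. (P i \<theta>)\<^sup>2) < 1"
proof -
  have id: "1 - (\<Sum>i\<in>{1..4}. (P i \<theta>)\<^sup>2) = 2 * ((P 1 \<theta> + P 2 \<theta>) * (P 3 \<theta> + P 4 \<theta>)) + 2 * (P 1 \<theta> * P 2 \<theta>) + 2 * (P 3 \<theta> * P 4 \<theta>)"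
  proof -
    have "1 = (P 1 \<theta> + P 2 \<theta> + P 3 \<theta> + P 4 \<theta>)\<^sup>2" unfolding P_sum by simp
    then show ?thesis unfolding sum_index by (simp add: power2_eq_square algebra_simps)
  qed
  have nn: "0 \<le> P 1 \<theta>" "0 \<le> P 2 \<theta>" "0 \<le> P 3 \<theta>" "0 \<le> P 4 \<theta>" by (auto intro: P_nonneg)
  then have nn': "0 \<le> (P 1 \<theta> + P 2 \<theta>) * (P 3 \<theta> + P 4 \<theta>)" "0 \<le> P 1 \<theta> * P 2 \<theta>" "0 \<le> P 3 \<theta> * P 4 \<theta>"
    by auto
  then show "(\<Sum>i\<in>{1..4}. (P i \<theta>)\<^sup>2) \<le> 1" using id by linarith
  assume \<theta>: "\<alpha> < \<theta>" "\<theta> < pi - \<alpha>"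
  have "0 < P 1 \<theta> + P 2 \<theta>"
    using P_1_pos[of \<theta>] P_2_pos[of \<theta>] \<theta> \<alpha> nn by (cases "\<theta> < pi - 2 * \<alpha>") (auto simp: add_pos_nonneg add_nonneg_pos)
  moreover have "0 < P 3 \<theta> + P 4 \<theta>"
    using P_3_pos[of \<theta>] P_4_pos[of \<theta>] \<theta> \<alpha> nn by (cases "2 * \<alpha> < \<theta>") (auto simp: add_pos_nonneg add_nonneg_pos)
  ultimately have "0 < (P 1 \<theta> + P 2 \<theta>) * (P 3 \<theta> + P 4 \<theta>)" by (rule mult_pos_pos)
  then show "(\<Sum>i\<in>{1..4}. (P i \<theta>)\<^sup>2) < 1" using id nn'(2,3) by linarith
qed

text \<open>The part over the angles where the contraction is strict.\<close>

definition mid :: "nat \<Rightarrow> real \<Rightarrow> real" where "mid k \<theta> = lk k \<theta> * indicator {\<alpha><..<pi - \<alpha>} \<theta>"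

lemma mid_measurable [measurable]: "mid k \<in> borel_measurable borel"
  unfolding mid_def[abs_def] by measurable

lemma mid_bounds: "0 \<le> mid k \<theta>" "mid k \<theta> \<le> K" "\<bar>mid k \<theta>\<bar> \<le> K"
  using lk_bounds[of k \<theta>] K by (auto simp: mid_def indicator_def)

text \<open>The integrals of \<open>lk\<close> decrease, so their decrements tend to 0. These are
  integrals of \<open>lk\<close> against 1 minus the sum of squares, which is positive on the middle
  region.\<close>

lemma integral_mid_null: "(\<lambda>k. \<integral>\<theta>. mid k \<theta> \<partial>\<mu>) \<longlonglongrightarrow> 0"
proof -
  let ?w = "\<lambda>\<theta>. 1 - (\<Sum>i\<in>{1..4}. (P i \<theta>)\<^sup>2)"
  let ?e = "\<lambda>k. \<integral>\<theta>. lk k \<theta> \<partial>\<mu>"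
  have [measurable]: "?w \<in> borel_measurable borel" by measurable
  have w: "0 \<le> ?w \<theta>" "?w \<theta> \<le> 1" for \<theta> using P_squares(1)[of \<theta>] by (auto intro: sum_nonneg)
  have lkb: "\<bar>lk k \<theta>\<bar> \<le> K" for k \<theta> using lk_bounds[of k \<theta>] by simp
  have i: "integrable \<mu> (lk k)" for k by (rule integrable_\<mu>_bounded[OF _ lkb]) measurable
  have d: "?e k - ?e (Suc k) = (\<integral>\<theta>. ?w \<theta> * \<bar>lk k \<theta>\<bar> \<partial>\<mu>)" for k
  proof -
    have "integrable \<mu> (\<lambda>\<theta>. (\<Sum>i\<in>{1..4}. (P i \<theta>)\<^sup>2) * lk k \<theta>)"
      using w by (intro integrable_bounded_mult(1)[where C = 1] i) (auto intro!: sum_nonneg simp: abs_of_nonneg)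
    then have "?e k - ?e (Suc k) = (\<integral>\<theta>. lk k \<theta> - (\<Sum>i\<in>{1..4}. (P i \<theta>)\<^sup>2) * lk k \<theta> \<partial>\<mu>)"
      unfolding integral_lk_Suc by (rule Bochner_Integration.integral_diff[OF i, symmetric])
    also have "\<dots> = (\<integral>\<theta>. ?w \<theta> * \<bar>lk k \<theta>\<bar> \<partial>\<mu>)"
      using lk_bounds(1) by (simp add: left_diff_distrib abs_of_nonneg)
    finally show ?thesis .
  qed
  have "0 \<le> ?e k - ?e (Suc k)" for k unfolding d using w by (intro integral_nonneg_AE AE_I2 mult_nonneg_nonneg) auto
  then have "decseq ?e" by (intro decseq_SucI) simp
  moreover have "0 \<le> ?e k" for k using lk_bounds(1) by (intro integral_nonneg_AE AE_I2)
  ultimately obtain e where e: "?e \<longlonglongrightarrow> e" using decseq_convergent[of ?e 0] by metis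
  have "(\<lambda>k. \<integral>\<theta>. ?w \<theta> * \<bar>lk k \<theta>\<bar> \<partial>\<mu>) \<longlonglongrightarrow> 0"
    using tendsto_diff[OF e LIMSEQ_Suc[OF e]] unfolding d by simp
  then have n: "(\<lambda>k. \<integral>\<theta>. \<bar>lk k \<theta>\<bar> * indicator {x\<in>space \<mu>. 0 < ?w x} \<theta> \<partial>\<mu>) \<longlonglongrightarrow> 0"
    by (intro null_of_positive_weight[OF finite_measure_\<mu> _ _ w lkb]) measurable
  show ?thesis
  proof (rule tendsto_sandwich[OF _ _ tendsto_const n])
    show "\<forall>\<^sub>F k in sequentially. 0 \<le> (\<integral>\<theta>. mid k \<theta> \<partial>\<mu>)"
      using mid_bounds(1) by (intro always_eventually allI integral_nonneg_AE AE_I2)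
    have "(\<integral>\<theta>. mid k \<theta> \<partial>\<mu>) \<le> (\<integral>\<theta>. \<bar>lk k \<theta>\<bar> * indicator {x\<in>space \<mu>. 0 < ?w x} \<theta> \<partial>\<mu>)" for k
    proof (rule integral_mono)
      show "integrable \<mu> (mid k)" by (rule integrable_\<mu>_bounded[OF _ mid_bounds(3)]) measurable
      show "integrable \<mu> (\<lambda>\<theta>. \<bar>lk k \<theta>\<bar> * indicator {x\<in>space \<mu>. 0 < ?w x} \<theta>)"
        using lkb K by (intro integrable_\<mu>_bounded[of _ K]) (auto simp: indicator_def)
      show "mid k \<theta> \<le> \<bar>lk k \<theta>\<bar> * indicator {x\<in>space \<mu>. 0 < ?w x} \<theta>" for \<theta>
        using P_squares(2)[of \<theta>] lk_bounds(1)[of k \<theta>] by (auto simp: mid_def indicator_def)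
    qed
    then show "\<forall>\<^sub>F k in sequentially. (\<integral>\<theta>. mid k \<theta> \<partial>\<mu>) \<le> (\<integral>\<theta>. \<bar>lk k \<theta>\<bar> * indicator {x\<in>space \<mu>. 0 < ?w x} \<theta> \<partial>\<mu>)"
      by (intro always_eventually allI)
  qed
qed

text \<open>Near an end the certain branch moves the angle by 2 \<alpha> away from that end, and the
  region at the other end is not reached since 4 \<alpha> < \<pi>.\<close>

lemma T_into_mid:
  assumes "i \<in> {1..4}" "0 < \<theta>" "\<theta> < pi" "\<theta> < \<alpha> \<or> pi - \<alpha> < \<theta>" "P i \<theta> \<noteq> 0"
  shows "T i \<theta> \<in> {\<alpha><..<pi - \<alpha>}"
  using assms \<alpha>
  by (cases rule: index_cases[OF assms(1)])
    (auto simp: feres_map_def feres_prob_def feres_p1_def feres_p2_def feres_p3_def feres_p4_def split: if_splits)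

lemma lk_outside:
  assumes \<theta>: "0 < \<theta>" "\<theta> < pi" "\<theta> < \<alpha> \<or> pi - \<alpha> < \<theta>"
  shows "lk (Suc k) \<theta> \<le> (\<Sum>i\<in>{1..4}. P (dual i) \<theta> * mid k (T (dual i) \<theta>))"
  unfolding lk_simps Rl_def
proof (rule sum_mono)
  fix i :: nat assume i: "i \<in> {1..4}"
  show "P (dual i) \<theta> * (P i (T (dual i) \<theta>) * lk k (T (dual i) \<theta>)) \<le> P (dual i) \<theta> * mid k (T (dual i) \<theta>)"
  proof (cases "P (dual i) \<theta> = 0")
    case False
    then have "mid k (T (dual i) \<theta>) = lk k (T (dual i) \<theta>)"
      using T_into_mid[OF dual_in[OF i] \<theta>] by (simp add: mid_def)
    then show ?thesis
      using P_le_1[OF i, of "T (dual i) \<theta>"] lk_bounds(1)[of k "T (dual i) \<theta>"] P_nonneg[OF dual_in[OF i], of \<theta>]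
      by (intro mult_left_mono) (auto simp: mult_left_le_one_le P_nonneg[OF i])
  qed simp
qed

text \<open>Near the ends \<open>lk\<close> is bounded by an average of its values over the middle
  region one stage earlier, so nothing can persist there.\<close>

lemma integral_lk_null: "(\<lambda>k. \<integral>\<theta>. lk k \<theta> \<partial>\<mu>) \<longlonglongrightarrow> 0"
proof (rule LIMSEQ_imp_Suc, rule tendsto_sandwich[OF _ _ tendsto_const])
  show "(\<lambda>k. (\<integral>\<theta>. mid k \<theta> \<partial>\<mu>) + (\<integral>\<theta>. mid (Suc k) \<theta> \<partial>\<mu>)) \<longlonglongrightarrow> 0"
    using tendsto_add[OF integral_mid_null LIMSEQ_Suc[OF integral_mid_null]] by simp
  show "\<forall>\<^sub>F k in sequentially. 0 \<le> (\<integral>\<theta>. lk (Suc k) \<theta> \<partial>\<mu>)"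
    using lk_bounds(1) by (intro always_eventually allI integral_nonneg_AE AE_I2)
  have "(\<integral>\<theta>. lk (Suc k) \<theta> \<partial>\<mu>) \<le> (\<integral>\<theta>. mid k \<theta> \<partial>\<mu>) + (\<integral>\<theta>. mid (Suc k) \<theta> \<partial>\<mu>)" for k
  proof -
    let ?m = "\<lambda>\<theta>. \<Sum>i\<in>{1..4}. P (dual i) \<theta> * mid k (T (dual i) \<theta>)"
    have im: "integrable \<mu> (mid (Suc k))" by (rule integrable_\<mu>_bounded[OF _ mid_bounds(3)]) measurable
    have Pm: "\<bar>P i \<theta> * mid k \<theta>'\<bar> \<le> K" if "i \<in> {1..4}" for i \<theta> \<theta>'
      using mult_mono[OF P_le_1[OF that, of \<theta>] mid_bounds(2)[of k \<theta>']] mid_bounds(1)[of k \<theta>'] P_nonneg[OF that, of \<theta>]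
      by (simp add: abs_mult)
    have i: "integrable \<mu> (\<lambda>\<theta>. P (dual i) \<theta> * mid k (T (dual i) \<theta>))" if "i \<in> {1..4}" for i
      by (rule integrable_\<mu>_bounded[OF _ Pm[OF dual_in[OF that]]]) measurable
    then have iM: "integrable \<mu> ?m" by (intro Bochner_Integration.integrable_sum)
    have mnn: "0 \<le> ?m \<theta>" for \<theta> using P_nonneg[OF dual_in] mid_bounds(1) by (intro sum_nonneg mult_nonneg_nonneg)
    have "(\<integral>\<theta>. lk (Suc k) \<theta> \<partial>\<mu>) \<le> (\<integral>\<theta>. ?m \<theta> + mid (Suc k) \<theta> \<partial>\<mu>)"
    proof (rule integral_mono_AE)
      show "integrable \<mu> (lk (Suc k))" using lk_bounds by (intro integrable_\<mu>_bounded[of _ K]) (auto simp: abs_le_iff intro: order_trans[OF _ lk_bounds(1)])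
      show "integrable \<mu> (\<lambda>\<theta>. ?m \<theta> + mid (Suc k) \<theta>)" using iM im by simp
      \<comment> \<open>At these two angles neither bound applies; they form a null set.\<close>
      have "AE \<theta> in \<mu>. \<theta> \<noteq> \<alpha> \<and> \<theta> \<noteq> pi - \<alpha>"
        unfolding \<mu>_def
        by (subst AE_density) (use AE_lborel_singleton[of \<alpha>] AE_lborel_singleton[of "pi - \<alpha>"] in \<open>auto elim!: eventually_elim2\<close>)
      with AE_\<mu> show "AE \<theta> in \<mu>. lk (Suc k) \<theta> \<le> ?m \<theta> + mid (Suc k) \<theta>"
      proof eventually_elim
        case (elim \<theta>)
        show ?case
        proof (cases "\<theta> < \<alpha> \<or> pi - \<alpha> < \<theta>")
          case True
          with lk_outside[of \<theta> k] elim show ?thesis using mid_bounds(1)[of "Suc k" \<theta>] by linarith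
        next
          case False
          then have "mid (Suc k) \<theta> = lk (Suc k) \<theta>" using elim by (simp add: mid_def)
          then show ?thesis using mnn[of \<theta>] by linarith
        qed
      qed
    qed
    also have "\<dots> = (\<integral>\<theta>. ?m \<theta> \<partial>\<mu>) + (\<integral>\<theta>. mid (Suc k) \<theta> \<partial>\<mu>)" using iM im by (rule Bochner_Integration.integral_add)
    also have "(\<integral>\<theta>. ?m \<theta> \<partial>\<mu>) = (\<Sum>i\<in>{1..4}. \<integral>\<theta>. P (dual i) \<theta> * mid k (T (dual i) \<theta>) \<partial>\<mu>)"
      using i by (rule Bochner_Integration.integral_sum)
    also have "\<dots> = (\<Sum>i\<in>{1..4}. \<integral>\<theta>. P i \<theta> * mid k \<theta> \<partial>\<mu>)"
      by (intro sum.cong refl integral_P_\<mu>[symmetric]) measurable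
    also have "\<dots> = (\<integral>\<theta>. (\<Sum>i\<in>{1..4}. P i \<theta> * mid k \<theta>) \<partial>\<mu>)"
      by (intro Bochner_Integration.integral_sum[symmetric] integrable_\<mu>_bounded[OF _ Pm]) measurable
    also have "\<dots> = (\<integral>\<theta>. mid k \<theta> \<partial>\<mu>)" by (simp only: sum_distrib_right[symmetric] P_sum' mult_1_left)
    finally show ?thesis .
  qed
  then show "\<forall>\<^sub>F k in sequentially. (\<integral>\<theta>. lk (Suc k) \<theta> \<partial>\<mu>) \<le> (\<integral>\<theta>. mid k \<theta> \<partial>\<mu>) + (\<integral>\<theta>. mid (Suc k) \<theta> \<partial>\<mu>)"
    by (intro always_eventually allI)
qed

lemma R_iterate_Lipschitz:
  assumes "\<And>x x' y. \<bar>\<Phi> (x, y) - \<Phi> (x', y)\<bar> \<le> K * \<bar>x - x'\<bar>"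
  shows "\<bar>(R ^^ k) \<Phi> (x, y) - (R ^^ k) \<Phi> (x', y)\<bar> \<le> lk k (snd y) * \<bar>x - x'\<bar>"
proof (induction k arbitrary: x x' y)
  case (Suc k)
  from R_Lipschitz[of "(R ^^ k) \<Phi>" "lk k", OF Suc] show ?case by (simp add: lk_simps)
qed (simp add: lk_simps assms)

end

section \<open>Correlations along the skew-product\<close>

lemma T_range:
  assumes "i \<in> {1..4}" "\<theta> \<in> {0..pi}" "P i \<theta> \<noteq> 0"
  shows "T i \<theta> \<in> {0..pi}"
  using assms \<alpha>
  by (cases rule: index_cases[OF assms(1)])
    (auto simp: feres_map_def feres_prob_def feres_p1_def feres_p2_def feres_p3_def feres_p4_def split: if_splits)

context
  fixes W :: "real \<times> real \<times> real \<Rightarrow> real" and Kw :: real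
  assumes W [measurable]: "W \<in> borel_measurable \<B>" and Kw: "\<And>z. \<bar>W z\<bar> \<le> Kw"
    and mean: "(\<integral>z. W z \<partial>\<xi>) = 0" and irr: "\<alpha> / pi \<notin> \<rat>"
begin

definition Wn :: "nat \<Rightarrow> real \<times> real \<times> real \<Rightarrow> real" where "Wn n z = W ((S ^^ n) z)"

lemma Wn_measurable [measurable]: "Wn n \<in> borel_measurable \<B>"
  unfolding Wn_def[abs_def] by measurable

lemma Wn_bound: "\<bar>Wn n z\<bar> \<le> Kw" by (simp add: Wn_def Kw)

lemma Kw_nonneg: "0 \<le> Kw" using Kw[of undefined] by linarith

definition fn :: "nat \<Rightarrow> real \<times> real \<Rightarrow> real" where "fn n y = (\<integral>x. Wn n (x, y) \<partial>unif 1)"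

lemma fn_measurable [measurable]: "fn n \<in> borel_measurable (borel \<Otimes>\<^sub>M borel)"
proof -
  interpret finite_measure "unif 1" by (rule finite_measure_unif) simp
  show ?thesis unfolding fn_def[abs_def] by measurable
qed

lemma fn_bound: "\<bar>fn n y\<bar> \<le> Kw"
  unfolding fn_def by (rule unif_bounded(2)[OF zero_less_one section_measurable[where g = "\<lambda>x. x"] Wn_bound]) measurable

text \<open>As the stretched fibre is uniform again, integrating out x gives the averaged dynamics.
  The range of angles matters: outside it the skew-product is the identity, and
  \<open>T_range\<close> keeps the possible images inside.\<close>

lemma fn_evol: "snd y \<in> {0..pi} \<Longrightarrow> fn n y = evol n (fn 0) y"
proof (induction n arbitrary: y)
  case (Suc n)
  have "fn (Suc n) y = (\<integral>x. Wn n (S (x, fst y, snd y)) * 1 \<partial>unif 1)"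
    by (simp add: fn_def Wn_def funpow_Suc_right del: funpow.simps)
  also have "\<dots> = (\<Sum>i\<in>{1..4}. P i (snd y) * (\<integral>x. Wn n (x, B (fst y, T i (snd y))) * 1 \<partial>unif 1))"
    by (rule integral_skew_fibre[where \<phi> = "\<lambda>_. 1" and D = 1, OF Wn_measurable _ Wn_bound _ Suc.prems]) auto
  also have "\<dots> = (\<Sum>i\<in>{1..4}. P i (snd y) * evol n (fn 0) (B (fst y, T i (snd y))))"
  proof (rule sum.cong[OF refl])
    fix i :: nat assume i: "i \<in> {1..4}"
    show "P i (snd y) * (\<integral>x. Wn n (x, B (fst y, T i (snd y))) * 1 \<partial>unif 1) = P i (snd y) * evol n (fn 0) (B (fst y, T i (snd y)))"
    proof (cases "P i (snd y) = 0")
      case False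
      then show ?thesis using Suc.IH[of "B (fst y, T i (snd y))"] T_range[OF i Suc.prems] by (simp add: fn_def[of n])
    qed simp
  qed
  finally show ?case by (simp add: Q_def)
qed simp

text \<open>Tests independent of x see only \<open>fn n\<close>, and \<open>evol_weak\<close>
  applies to \<open>fn 0\<close>, whose mean is that of W.\<close>

lemma Wn_section_null:
  assumes [measurable]: "\<psi> \<in> borel_measurable (borel \<Otimes>\<^sub>M borel)" and \<psi>: "\<And>y. \<bar>\<psi> y\<bar> \<le> (D :: real)"
  shows "(\<lambda>n. \<integral>z. Wn n z * \<psi> (snd z) \<partial>\<xi>) \<longlonglongrightarrow> 0"
proof -
  interpret feres_observable \<alpha> M r "fn 0" Kw
    by unfold_locales (auto intro: fn_bound)
  have "(\<integral>y. fn 0 y \<partial>\<nu>) = 0"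
    using Fubini_\<xi>(2)[OF W Kw] mean by (simp add: fn_def Wn_def)
  then have "(\<lambda>n. \<integral>y. evol n (fn 0) y * \<psi> y \<partial>\<nu>) \<longlonglongrightarrow> 0"
    using weakly_nullD[OF evol_weak[OF irr], of \<psi>] Fubini_\<nu>(1)[OF assms] by simp
  moreover have "(\<integral>z. Wn n z * \<psi> (snd z) \<partial>\<xi>) = (\<integral>y. evol n (fn 0) y * \<psi> y \<partial>\<nu>)" for n
  proof -
    have "\<bar>Wn n z * \<psi> (snd z)\<bar> \<le> Kw * D" for z
      unfolding abs_mult using Wn_bound[of n z] \<psi>[of "snd z"] by (intro mult_mono) auto
    then have "(\<integral>z. Wn n z * \<psi> (snd z) \<partial>\<xi>) = (\<integral>y. fn n y * \<psi> y \<partial>\<nu>)"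
      by (subst Fubini_\<xi>(2)[where K = "Kw * D"]) (auto simp: fn_def)
    also have "\<dots> = (\<integral>y. evol n (fn 0) y * \<psi> y \<partial>\<nu>)"
    proof (rule integral_cong_AE)
      show "AE y in \<nu>. fn n y * \<psi> y = evol n (fn 0) y * \<psi> y"
        using AE_\<nu> by eventually_elim (simp add: fn_evol)
    qed measurable
    finally show ?thesis .
  qed
  ultimately show ?thesis by simp
qed

text \<open>k iterates are moved onto the test as a power of \<open>R\<close>. By the decay of
  \<open>lk\<close> the new test is close in L1 to its value at x = 0, and the test frozen at x = 0
  is independent of x.\<close>

lemma Wn_Lipschitz_null:
  assumes \<Phi> [measurable]: "\<Phi> \<in> borel_measurable \<B>" and D: "\<And>z. \<bar>\<Phi> z\<bar> \<le> D" and K: "0 \<le> K"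
    and lip: "\<And>x x' y. \<bar>\<Phi> (x, y) - \<Phi> (x', y)\<bar> \<le> K * \<bar>x - x'\<bar>"
  shows "(\<lambda>n. \<integral>z. Wn n z * \<Phi> z \<partial>\<xi>) \<longlonglongrightarrow> 0"
proof (rule LIMSEQ_I)
  fix e :: real assume e: "0 < e"
  have lim: "(\<lambda>k. Kw * (\<integral>\<theta>. lk K k \<theta> \<partial>\<mu>)) \<longlonglongrightarrow> 0" by (intro tendsto_mult_right_zero integral_lk_null K)
  \<comment> \<open>k is fixed first; the error bound \<open>err\<close> below does not involve
    n.\<close>
  obtain k where k: "Kw * (\<integral>\<theta>. lk K k \<theta> \<partial>\<mu>) < e / 2"
  proof -
    assume *: "\<And>k. Kw * (\<integral>\<theta>. lk K k \<theta> \<partial>\<mu>) < e / 2 \<Longrightarrow> thesis"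
    obtain k where "\<forall>n\<ge>k. norm (Kw * (\<integral>\<theta>. lk K n \<theta> \<partial>\<mu>) - 0) < e / 2"
      using LIMSEQ_D[OF lim, of "e/2"] e by auto
    then show thesis using *[of k] by auto
  qed
  define \<Psi> where "\<Psi> = (R ^^ k) \<Phi>"
  have [measurable]: "\<Psi> \<in> borel_measurable \<B>" unfolding \<Psi>_def by measurable
  have \<Psi>: "\<bar>\<Psi> z\<bar> \<le> D" for z unfolding \<Psi>_def by (rule R_iterate_bound[OF D])
  have WD: "\<bar>Wn n z * a\<bar> \<le> Kw * D'" if "\<bar>a\<bar> \<le> D'" for n z a D'
    unfolding abs_mult using Wn_bound[of n z] that by (intro mult_mono) auto
  have d: "\<bar>\<Psi> z - \<Psi> (0, snd z)\<bar> \<le> 2 * D" for z using \<Psi>[of z] \<Psi>[of "(0, snd z)"] by linarith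
  have "(\<lambda>n. \<integral>z. Wn n z * \<Psi> (0, snd z) \<partial>\<xi>) \<longlonglongrightarrow> 0"
    by (rule Wn_section_null[OF _ \<Psi>]) measurable
  from LIMSEQ_D[OF this, of "e/2"] e obtain N where N: "\<And>n. N \<le> n \<Longrightarrow> \<bar>\<integral>z. Wn n z * \<Psi> (0, snd z) \<partial>\<xi>\<bar> < e / 2" by auto
  have err: "\<bar>\<integral>z. Wn n z * (\<Psi> z - \<Psi> (0, snd z)) \<partial>\<xi>\<bar> \<le> Kw * (\<integral>\<theta>. lk K k \<theta> \<partial>\<mu>)" for n
  proof -
    interpret U: finite_measure "unif 1" by (rule finite_measure_unif) simp
    have [measurable]: "lk K k \<in> borel_measurable borel" by (rule lk_measurable[OF K])
    let ?g = "\<lambda>z. \<bar>Wn n z * (\<Psi> z - \<Psi> (0, snd z))\<bar>"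
    have lkb: "\<bar>Kw * lk K k \<theta>\<bar> \<le> Kw * K" for \<theta>
      using lk_bounds[OF K, of k \<theta>] Kw_nonneg by (simp add: abs_mult mult_left_mono)
    have gb: "\<bar>?g z\<bar> \<le> Kw * (2 * D)" for z unfolding abs_abs by (rule WD[OF d])
    have "\<bar>\<integral>z. Wn n z * (\<Psi> z - \<Psi> (0, snd z)) \<partial>\<xi>\<bar> \<le> (\<integral>z. ?g z \<partial>\<xi>)" by (rule integral_abs_bound)
    also have "\<dots> = (\<integral>y. \<integral>x. ?g (x, y) \<partial>unif 1 \<partial>\<nu>)" by (rule Fubini_\<xi>(2)[OF _ gb]) measurable
    also have "\<dots> \<le> (\<integral>y. Kw * lk K k (snd y) \<partial>\<nu>)"
    proof (rule integral_mono)
      have "\<bar>\<integral>x. ?g (x, y) \<partial>unif 1\<bar> \<le> Kw * (2 * D)" for y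
        by (rule unif_bounded(2)[OF zero_less_one section_measurable[where F = ?g and g = "\<lambda>x. x"] gb]) measurable
      then show "integrable \<nu> (\<lambda>y. \<integral>x. ?g (x, y) \<partial>unif 1)"
        by (intro Fubini_\<nu>(1)[of _ "Kw * (2 * D)"]) measurable
      show "integrable \<nu> (\<lambda>y. Kw * lk K k (snd y))"
        by (intro Fubini_\<nu>(1)[OF _ lkb]) measurable
      fix y
      have "(\<integral>x. ?g (x, y) \<partial>unif 1) \<le> (\<integral>x. Kw * lk K k (snd y) \<partial>unif 1)"
      proof (rule integral_mono_AE)
        show "integrable (unif 1) (\<lambda>x. ?g (x, y))"
          by (rule unif_bounded(1)[OF zero_less_one section_measurable[where F = ?g and g = "\<lambda>x. x"] gb]) measurable
        show "AE x in unif 1. ?g (x, y) \<le> Kw * lk K k (snd y)"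
        proof (subst AE_uniform_measure)
          show "AE x in lborel. x \<in> {0..1} \<longrightarrow> ?g (x, y) \<le> Kw * lk K k (snd y)"
          proof (intro AE_I2 impI)
            fix x :: real assume x: "x \<in> {0..1}"
            have "\<bar>\<Psi> (x, y) - \<Psi> (0, y)\<bar> \<le> lk K k (snd y) * \<bar>x - 0\<bar>"
              unfolding \<Psi>_def by (rule R_iterate_Lipschitz[OF K lip])
            also have "\<dots> \<le> lk K k (snd y)" using x lk_bounds[OF K, of k "snd y"] by (simp add: mult_left_le)
            finally have "\<bar>\<Psi> (x, y) - \<Psi> (0, y)\<bar> \<le> lk K k (snd y)" .
            then show "?g (x, y) \<le> Kw * lk K k (snd y)" using WD[of _ "lk K k (snd y)" n "(x, y)"] by simp
          qed
        qed auto
      qed simp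
      then show "(\<integral>x. ?g (x, y) \<partial>unif 1) \<le> Kw * lk K k (snd y)" using measure_unif_UNIV[of 1] by simp
    qed
    also have "\<dots> = (\<integral>\<theta>. \<integral>s. Kw * lk K k \<theta> \<partial>unif L \<partial>\<mu>)"
      by (subst Fubini_\<nu>(3)[OF _ lkb]) auto
    also have "\<dots> = Kw * (\<integral>\<theta>. lk K k \<theta> \<partial>\<mu>)" using measure_unif_UNIV[OF L_pos] by simp
    finally show ?thesis .
  qed
  show "\<exists>N. \<forall>n\<ge>N. norm ((\<integral>z. Wn n z * \<Phi> z \<partial>\<xi>) - 0) < e"
  proof (intro exI allI impI)
    fix m assume m: "N + k \<le> m"
    define n where "n = m - k"
    have n: "N \<le> n" "m = n + k" using m by (auto simp: n_def)
    have "(\<integral>z. Wn m z * \<Phi> z \<partial>\<xi>) = (\<integral>z. Wn n ((S ^^ k) z) * \<Phi> z \<partial>\<xi>)"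
      by (simp add: Wn_def n(2) funpow_add)
    also have "\<dots> = (\<integral>z. Wn n z * \<Psi> z \<partial>\<xi>)"
      unfolding \<Psi>_def by (rule integral_skew_product_iterate[OF Wn_measurable \<Phi> Wn_bound D])
    also have "\<dots> = (\<integral>z. Wn n z * \<Psi> (0, snd z) + Wn n z * (\<Psi> z - \<Psi> (0, snd z)) \<partial>\<xi>)"
      by (simp add: right_diff_distrib)
    also have "\<dots> = (\<integral>z. Wn n z * \<Psi> (0, snd z) \<partial>\<xi>) + (\<integral>z. Wn n z * (\<Psi> z - \<Psi> (0, snd z)) \<partial>\<xi>)"
      by (intro Bochner_Integration.integral_add Fubini_\<xi>(1)[OF _ WD[OF \<Psi>]] Fubini_\<xi>(1)[OF _ WD[OF d]]) measurable
    finally show "norm ((\<integral>z. Wn m z * \<Phi> z \<partial>\<xi>) - 0) < e"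
      using N[OF n(1)] err[of n] k by simp
  qed
qed

theorem Wn_weakly_null: "weakly_null \<xi> Wn"
proof (rule weakly_null_generator[OF finite_\<xi>, where C = Kw and G = "{a \<times> E | a E. a \<in> range (\<lambda>b::real. {..b}) \<and> E \<in> sets \<nu>}"])
  let ?G = "{a \<times> E | a E. a \<in> range (\<lambda>b::real. {..b}) \<and> E \<in> sets \<nu>}"
  have box: "(\<lambda>n. \<integral>z. Wn n z * indicator ({..b} \<times> E) z \<partial>\<xi>) \<longlonglongrightarrow> 0" if "E \<in> sets \<nu>" for b E
  proof -
    have [measurable]: "E \<in> sets (borel \<Otimes>\<^sub>M borel)" using that by (simp add: sets_\<nu>)
    \<comment> \<open>For i > 0 a ramp that equals 1 up to b and vanishes beyond b + 1 / i. It is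
      Lipschitz with constant i and decreases to the indicator of \<open>{..b}\<close>.\<close>
    let ?r = "\<lambda>i x. max 0 (min 1 (real i * (b - x) + 1))"
    let ?s = "\<lambda>i z. ?r i (fst z) * indicator E (snd z)"
    have r: "0 \<le> ?r i x" "?r i x \<le> 1" for i x by auto
    have s: "\<bar>?s i z\<bar> \<le> 1" for i z by (auto simp: indicator_def)
    show ?thesis
    proof (rule weak_limit_in_L1[where s = ?s and g = "\<lambda>_. 1" and C = Kw])
      show "integrable \<xi> (?s i)" for i by (rule Fubini_\<xi>(1)[OF _ s]) measurable
      show "integrable \<xi> (indicator ({..b} \<times> E) :: _ \<Rightarrow> real)" by (rule Fubini_\<xi>(1)[of _ 1]) auto
      show "integrable \<xi> (\<lambda>_. 1 :: real)" by (rule Fubini_\<xi>(1)[of _ 1]) auto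
      show "(\<lambda>n. \<integral>z. Wn n z * ?s i z \<partial>\<xi>) \<longlonglongrightarrow> 0" for i
      proof (rule Wn_Lipschitz_null[OF _ s, where K = "real i"])
        fix x x' :: real and y
        have "\<bar>?r i x - ?r i x'\<bar> \<le> \<bar>(real i * (b - x) + 1) - (real i * (b - x') + 1)\<bar>" by linarith
        also have "(real i * (b - x) + 1) - (real i * (b - x') + 1) = real i * (x' - x)" by (simp add: algebra_simps)
        finally show "\<bar>?s i (x, y) - ?s i (x', y)\<bar> \<le> real i * \<bar>x - x'\<bar>"
          by (simp add: indicator_def abs_mult abs_minus_commute)
      qed measurable
      fix z :: "real \<times> real \<times> real"
      have "(\<lambda>i. ?r i x) \<longlonglongrightarrow> indicator {..b} x" for x :: real
      proof (cases "x \<le> b")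
        case True
        then have "?r i x = 1" for i by (simp add: min_def)
        then show ?thesis using True by simp
      next
        case False
        obtain k :: nat where k: "1 / (x - b) < real k" using reals_Archimedean2 by blast
        have "?r i x = 0" if "k \<le> i" for i
        proof -
          have "1 < real k * (x - b)" using k False by (simp add: divide_less_eq)
          also have "\<dots> \<le> real i * (x - b)" using that False by (intro mult_right_mono) auto
          finally show ?thesis by (simp add: algebra_simps)
        qed
        then have "\<forall>\<^sub>F i in sequentially. ?r i x = 0" by (auto simp: eventually_sequentially)
        then show ?thesis using False by (simp add: tendsto_eventually)
      qed
      from tendsto_mult_right[OF this, of "fst z" "indicator E (snd z)"]
      show "(\<lambda>i. ?s i z) \<longlonglongrightarrow> indicator ({..b} \<times> E) z"
        by (simp add: mult.commute[of "indicator E (snd z)"] indicator_times)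
      show "\<bar>?s i z\<bar> \<le> 1" for i by (rule s)
    qed (auto simp: Wn_bound)
  qed
  then show "(\<lambda>n. \<integral>z. Wn n z * indicator E z \<partial>\<xi>) \<longlonglongrightarrow> 0" if "E \<in> ?G" for E using that by auto
  show "Int_stable ?G"
  proof (rule Int_stableI)
    fix A A' assume "A \<in> ?G" "A' \<in> ?G"
    then obtain b E b' E' where *: "A = {..b} \<times> E" "A' = {..b'} \<times> E'" "E \<in> sets \<nu>" "E' \<in> sets \<nu>" by auto
    then have "A \<inter> A' = {..min b b'} \<times> (E \<inter> E')" by auto
    then show "A \<inter> A' \<in> ?G" using * by blast
  qed
  show "?G \<subseteq> Pow (space \<xi>)" by simp
  have UNIV: "(\<Union>b::nat. {..real b}) = UNIV" using real_arch_simple by auto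
  have "sets \<xi> = sets (sigma (space (unif 1) \<times> space \<nu>) ?G)"
    unfolding \<xi>_def
    by (rule sets_pair_eq[where Ca = "range (\<lambda>b::nat. {..real b})" and Cb = "{UNIV}"])
      (use UNIV sets.top[of \<nu>] in \<open>auto simp: borel_eq_atMost sets.sigma_sets_eq[of \<nu>, simplified]\<close>)
  then show "sets \<xi> = sigma_sets (space \<xi>) ?G" by (simp add: sets_measure_of)
  show "(\<lambda>n. \<integral>z. Wn n z \<partial>\<xi>) \<longlonglongrightarrow> 0" using Wn_section_null[of "\<lambda>_. 1" 1] by simp
qed (auto simp: Wn_bound)

end

end

section \<open>Mixing\<close>

lemma measurable_id_interval: "(\<lambda>x. x) \<in> interval_measure a \<rightarrow>\<^sub>M borel"
  and measurable_id_angle: "(\<lambda>x. x) \<in> angle_measure \<rightarrow>\<^sub>M borel"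
  unfolding interval_measure_def angle_measure_def
  by (simp_all add: measurable_restrict_space1 cong: measurable_cong_sets)

lemma distr_interval_measure:
  assumes "0 < a" shows "distr (interval_measure a) borel (\<lambda>x. x) = unif a"
proof (rule measure_eqI)
  fix A assume "A \<in> sets (distr (interval_measure a) borel (\<lambda>x. x))"
  then have A: "A \<in> sets borel" by simp
  have sp: "space (interval_measure a) = {0..a}" by (simp add: interval_measure_def space_restrict_space)
  have "emeasure (distr (interval_measure a) borel (\<lambda>x. x)) A = emeasure (interval_measure a) (A \<inter> {0..a})"
    using A by (subst emeasure_distr[OF measurable_id_interval]) (simp_all add: sp vimage_def Int_def)
  also have "\<dots> = emeasure lborel ({0..a} \<inter> A) / emeasure lborel {0..a}"
  proof -
    have "{0..a} \<inter> (A \<inter> {0..a}) = {0..a} \<inter> A" by auto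
    then show ?thesis
      unfolding interval_measure_def using A
      by (subst emeasure_uniform_measure) (simp_all add: sets_restrict_space_iff emeasure_restrict_space)
  qed
  also have "\<dots> = emeasure (unif a) A"
    using A by (subst emeasure_uniform_measure) auto
  finally show "emeasure (distr (interval_measure a) borel (\<lambda>x. x)) A = emeasure (unif a) A" .
qed simp

lemma distr_angle_measure: "distr angle_measure borel (\<lambda>x. x) = \<mu>"
proof (rule measure_eqI)
  fix A assume "A \<in> sets (distr angle_measure borel (\<lambda>x. x))"
  then have A [measurable]: "A \<in> sets borel" by simp
  have sp: "space angle_measure = {0..pi}" by (simp add: angle_measure_def space_restrict_space)
  have m: "(\<lambda>\<theta>. ennreal (sin \<theta> / 2)) \<in> borel_measurable (restrict_space lborel {0..pi})"
    by (intro measurable_restrict_space1) measurable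
  have "emeasure (distr angle_measure borel (\<lambda>x. x)) A = emeasure angle_measure (A \<inter> {0..pi})"
    using A by (subst emeasure_distr[OF measurable_id_angle]) (simp_all add: sp vimage_def Int_def)
  also have "\<dots> = (\<integral>\<^sup>+\<theta>. ennreal (sin \<theta> / 2) * indicator (A \<inter> {0..pi}) \<theta> \<partial>restrict_space lborel {0..pi})"
    unfolding angle_measure_def using A by (intro emeasure_density m) (auto simp: sets_restrict_space_iff)
  also have "\<dots> = (\<integral>\<^sup>+\<theta>. ennreal (sin \<theta> / 2) * indicator (A \<inter> {0..pi}) \<theta> * indicator {0..pi} \<theta> \<partial>lborel)"
    by (rule nn_integral_restrict_space) simp
  also have "\<dots> = (\<integral>\<^sup>+\<theta>. ennreal (indicator {0..pi} \<theta> * sin \<theta> / 2) * indicator A \<theta> \<partial>lborel)"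
    by (intro nn_integral_cong) (auto simp: indicator_def)
  also have "\<dots> = emeasure \<mu> A" unfolding \<mu>_def by (rule emeasure_density[symmetric]) measurable
  finally show "emeasure (distr angle_measure borel (\<lambda>x. x)) A = emeasure \<mu> A" .
qed simp

context feres_billiard
begin

abbreviation box :: "(real \<times> real \<times> real) set" where "box \<equiv> {0..1} \<times> {0..L} \<times> {0..pi}"

lemma space_skew_measure: "space (skew_measure M r) = box"
  by (simp add: skew_measure_def interval_measure_def angle_measure_def space_pair_measure space_restrict_space)

lemma measurable_id_skew: "(\<lambda>z. z) \<in> skew_measure M r \<rightarrow>\<^sub>M \<B>"
proof -
  have "(\<lambda>z. (fst z, fst (snd z), snd (snd z))) \<in> skew_measure M r \<rightarrow>\<^sub>M \<B>"
    unfolding skew_measure_def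
    by (intro measurable_Pair measurable_compose[OF measurable_fst measurable_id_interval]
        measurable_compose[OF measurable_compose[OF measurable_snd measurable_fst] measurable_id_interval]
        measurable_compose[OF measurable_compose[OF measurable_snd measurable_snd] measurable_id_angle])
  then show ?thesis by simp
qed

lemma sets_skew_measure: "A \<in> sets (skew_measure M r) \<longleftrightarrow> A \<in> sets \<B> \<and> A \<subseteq> box"
proof safe
  assume A: "A \<in> sets \<B>" "A \<subseteq> box"
  have "(\<lambda>z. z) -` A \<inter> space (skew_measure M r) \<in> sets (skew_measure M r)"
    using measurable_id_skew A(1) by (rule measurable_sets)
  then show "A \<in> sets (skew_measure M r)" using A(2) by (simp add: space_skew_measure Int_absorb2)
next
  assume A: "A \<in> sets (skew_measure M r)"
  then have sub: "A \<subseteq> box" using sets.sets_into_space space_skew_measure by blast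
  then show "z \<in> {0..1}" "s \<in> {0..L}" "t \<in> {0..pi}" if "(z, s, t) \<in> A" for z s t using that by auto
  \<comment> \<open>Clamping is a measurable retraction of the whole space onto the box; the
    preimage of A, cut with the box, is A itself.\<close>
  define cl :: "real \<Rightarrow> real \<Rightarrow> real" where "cl a x = max 0 (min a x)" for a x
  have cl: "cl a \<in> borel \<rightarrow>\<^sub>M restrict_space lborel {0..a}" if "0 \<le> a" for a
    unfolding cl_def[abs_def] using that by (intro measurable_restrict_space2) auto
  have "(\<lambda>z. (cl 1 (fst z), cl L (fst (snd z)), cl pi (snd (snd z)))) \<in> \<B> \<rightarrow>\<^sub>M skew_measure M r"
    unfolding skew_measure_def interval_measure_def angle_measure_def
    using L_pos by (intro measurable_Pair)
     (simp_all add: cong: measurable_cong_sets, (intro measurable_compose[OF _ cl]; simp)+)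
  from measurable_sets[OF this A]
  have "(\<lambda>z. (cl 1 (fst z), cl L (fst (snd z)), cl pi (snd (snd z)))) -` A \<inter> box \<in> sets \<B>" by (simp add: space_pair_measure)
  also have "(\<lambda>z. (cl 1 (fst z), cl L (fst (snd z)), cl pi (snd (snd z)))) -` A \<inter> box = A"
    using sub by (auto simp: cl_def)
  finally show "A \<in> sets \<B>" .
qed

lemma distr_skew_measure: "distr (skew_measure M r) \<B> (\<lambda>z. z) = \<xi>"
proof -
  have sf: "sigma_finite_measure \<mu>" "sigma_finite_measure \<nu>"
    using finite_measure_\<mu> finite_\<nu> by (simp_all add: finite_measure.axioms)
  have "distr (interval_measure L \<Otimes>\<^sub>M angle_measure) (borel \<Otimes>\<^sub>M borel) (\<lambda>(s, \<theta>). (s, \<theta>)) = \<nu>"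
    unfolding \<nu>_def distr_interval_measure[OF L_pos, symmetric] distr_angle_measure[symmetric]
    by (intro pair_measure_distr[symmetric] measurable_id_interval measurable_id_angle) (simp add: distr_angle_measure sf)
  then have *: "distr (interval_measure L \<Otimes>\<^sub>M angle_measure) (borel \<Otimes>\<^sub>M borel) (\<lambda>y. y) = \<nu>" by (simp add: id_def)
  have "(\<lambda>z. (fst z, snd z)) \<in> interval_measure L \<Otimes>\<^sub>M angle_measure \<rightarrow>\<^sub>M borel \<Otimes>\<^sub>M borel"
    by (intro measurable_Pair measurable_compose[OF measurable_fst measurable_id_interval]
        measurable_compose[OF measurable_snd measurable_id_angle])
  then have m: "(\<lambda>y. y) \<in> interval_measure L \<Otimes>\<^sub>M angle_measure \<rightarrow>\<^sub>M borel \<Otimes>\<^sub>M borel" by simp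
  have "distr (interval_measure 1 \<Otimes>\<^sub>M (interval_measure L \<Otimes>\<^sub>M angle_measure)) \<B> (\<lambda>(x, y). (x, y)) = \<xi>"
    unfolding \<xi>_def distr_interval_measure[OF zero_less_one, symmetric] *[symmetric]
    by (intro pair_measure_distr[symmetric] measurable_id_interval m) (simp add: * sf)
  then show ?thesis by (simp add: skew_measure_def id_def)
qed

lemma measure_skew:
  assumes "E \<in> sets \<B>" "E \<subseteq> box"
  shows "measure (skew_measure M r) E = (\<integral>z. indicator E z \<partial>\<xi>)"
proof -
  have "measure \<xi> E = measure (skew_measure M r) ((\<lambda>z. z) -` E \<inter> space (skew_measure M r))"
    unfolding distr_skew_measure[symmetric] by (rule measure_distr[OF measurable_id_skew assms(1)])
  then have "measure \<xi> E = measure (skew_measure M r) E"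
    using assms(2) by (simp add: space_skew_measure Int_absorb2)
  then show ?thesis by simp
qed

lemma measure_\<xi>_UNIV: "(\<integral>z. 1 \<partial>\<xi>) = (1 :: real)"
  using Fubini_\<xi>(2)[of "\<lambda>_. 1" 1] measure_unif_UNIV[of 1] measure_\<nu>_UNIV by simp

lemma irrational_imp_mixing:
  assumes irr: "\<alpha> / pi \<notin> \<rat>" shows "random_billiard_mixing M r \<alpha>"
  unfolding random_billiard_mixing_def strongly_mixing_def
proof (intro ballI)
  fix A E assume "A \<in> sets (skew_measure M r)" "E \<in> sets (skew_measure M r)"
  then have A [measurable]: "A \<in> sets \<B>" "A \<subseteq> box" and E [measurable]: "E \<in> sets \<B>" "E \<subseteq> box"
    by (simp_all add: sets_skew_measure)
  define m where "m = measure (skew_measure M r) A"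
  \<comment> \<open>Centred, as \<open>Wn_weakly_null\<close> requires; testing on E then leaves m
    times the measure of E as the limit.\<close>
  define W where "W z = indicator A z - m" for z
  have [measurable]: "W \<in> borel_measurable \<B>" unfolding W_def[abs_def] by measurable
  have int: "integrable \<xi> (\<lambda>z. indicator B z :: real)" if "B \<in> sets \<B>" for B
    using that by (intro Fubini_\<xi>(1)[of _ 1]) auto
  have i1: "integrable \<xi> (\<lambda>_. m)" by (intro Fubini_\<xi>(1)[of _ "\<bar>m\<bar>"]) auto
  have W: "\<bar>W z\<bar> \<le> 1 + \<bar>m\<bar>" for z by (auto simp: W_def indicator_def)
  have mean: "(\<integral>z. W z \<partial>\<xi>) = 0"
    using int[OF A(1)] i1 measure_\<xi>_UNIV measure_skew[OF A] unfolding W_def by (simp add: m_def)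
  have "weakly_null \<xi> (Wn W)" by (rule Wn_weakly_null[OF _ W mean irr]) measurable
  from weakly_nullD[OF this int[OF E(1)]]
  have lim: "(\<lambda>n. (\<integral>z. W ((S ^^ n) z) * indicator E z \<partial>\<xi>) + m * measure (skew_measure M r) E) \<longlonglongrightarrow> m * measure (skew_measure M r) E"
    unfolding Wn_def[OF \<open>W \<in> borel_measurable \<B>\<close> W mean irr] using tendsto_add[OF _ tendsto_const] by fastforce
  have "measure (skew_measure M r) ((S ^^ n) -` A \<inter> E) = (\<integral>z. W ((S ^^ n) z) * indicator E z \<partial>\<xi>) + m * measure (skew_measure M r) E" for n
  proof -
    have SA: "(S ^^ n) -` A \<in> sets \<B>"
      using measurable_sets[OF Sn_measurable A(1), of n] by (simp add: space_pair_measure)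
    then have SAE: "(S ^^ n) -` A \<inter> E \<in> sets \<B>" by simp
    have "measure (skew_measure M r) ((S ^^ n) -` A \<inter> E) = (\<integral>z. indicator ((S ^^ n) -` A \<inter> E) z \<partial>\<xi>)"
      using E by (intro measure_skew[OF SAE]) auto
    also have "\<dots> = (\<integral>z. W ((S ^^ n) z) * indicator E z + m * indicator E z \<partial>\<xi>)"
      by (intro Bochner_Integration.integral_cong) (auto simp: W_def indicator_def)
    also have "\<dots> = (\<integral>z. W ((S ^^ n) z) * indicator E z \<partial>\<xi>) + (\<integral>z. m * indicator E z \<partial>\<xi>)"
    proof (rule Bochner_Integration.integral_add)
      show "integrable \<xi> (\<lambda>z. W ((S ^^ n) z) * indicator E z)"
      proof (rule Fubini_\<xi>(1))
        show "\<bar>W ((S ^^ n) z) * indicator E z\<bar> \<le> 1 + \<bar>m\<bar>" for z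
          using W[of "(S ^^ n) z"] by (simp add: indicator_def)
      qed measurable
      show "integrable \<xi> (\<lambda>z. m * indicator E z)" using int[OF E(1)] by simp
    qed
    also have "(\<integral>z. m * indicator E z \<partial>\<xi>) = m * measure (skew_measure M r) E"
      using measure_skew[OF E] by simp
    finally show ?thesis .
  qed
  with lim show "(\<lambda>n. measure (skew_measure M r) ((S ^^ n) -` A \<inter> E)) \<longlonglongrightarrow> measure (skew_measure M r) A * measure (skew_measure M r) E"
    by (simp add: m_def)
qed

end

section \<open>Rational ratios: an invariant function of the angle\<close>

lemma emeasure_\<mu>_Icc:
  assumes "0 \<le> a" "a \<le> b" "b \<le> pi"
  shows "emeasure \<mu> {a..b} = ennreal ((cos a - cos b) / 2)"
proof -
  have "emeasure \<mu> {a..b} = (\<integral>\<^sup>+\<theta>. ennreal (sin \<theta> / 2) * indicator {a..b} \<theta> \<partial>lborel)"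
    unfolding \<mu>_def using assms by (subst emeasure_density) (auto intro!: nn_integral_cong simp: indicator_def)
  also have "\<dots> = ennreal ((- cos b / 2) - (- cos a / 2))"
    using assms by (intro nn_integral_FTC_Icc) (auto intro!: derivative_eq_intros sin_ge_zero)
  finally show ?thesis by (simp add: diff_divide_distrib)
qed

context feres_billiard
begin

lemma measure_skew_box:
  assumes "0 \<le> a" "a < b" "b \<le> pi"
  shows "{0..1} \<times> {0..L} \<times> {a..b} \<in> sets (skew_measure M r)" "0 < measure (skew_measure M r) ({0..1} \<times> {0..L} \<times> {a..b})"
proof -
  interpret \<mu>: finite_measure \<mu> by (rule finite_measure_\<mu>)
  interpret \<nu>: finite_measure \<nu> by (rule finite_\<nu>)
  interpret \<xi>: finite_measure \<xi> by (rule finite_\<xi>)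
  let ?E = "{0..1} \<times> {0..L} \<times> {a..b}"
  have E: "?E \<in> sets \<B>" "?E \<subseteq> box" using assms by auto
  then show "?E \<in> sets (skew_measure M r)" by (simp add: sets_skew_measure)
  have u: "emeasure (unif p) {0..p} = 1" if "0 < p" for p
    using that by (intro emeasure_uniform_measure_1) auto
  have "cos b < cos a" using assms by (intro cos_monotone_0_pi) auto
  then have "0 < emeasure \<mu> {a..b}" using assms by (simp add: emeasure_\<mu>_Icc)
  also have "emeasure \<mu> {a..b} = emeasure \<xi> ?E"
  proof -
    have "emeasure \<nu> ({0..L} \<times> {a..b}) = emeasure (unif L) {0..L} * emeasure \<mu> {a..b}"
      unfolding \<nu>_def by (rule \<mu>.emeasure_pair_measure_Times) simp_all
    moreover have "emeasure \<xi> ?E = emeasure (unif 1) {0..1} * emeasure \<nu> ({0..L} \<times> {a..b})"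
      unfolding \<xi>_def by (rule \<nu>.emeasure_pair_measure_Times) (simp_all add: sets_\<nu>)
    ultimately show ?thesis by (simp only: u[OF L_pos] u[OF zero_less_one] mult_1_left)
  qed
  finally have "0 < measure \<xi> ?E" by (simp add: \<xi>.emeasure_eq_measure)
  then show "0 < measure (skew_measure M r) ?E" using measure_skew[OF E] by simp
qed

text \<open>If n \<alpha> = a \<pi>, the shifts change n \<theta> by multiples of 2 \<pi>, and the
  reflections do so after a change of sign, which cos ignores. Two sets of positive measure
  separated by the sign of the invariant function never meet under iteration.\<close>

lemma mixing_imp_irrational:
  assumes mix: "random_billiard_mixing M r \<alpha>" shows "\<alpha> / pi \<notin> \<rat>"
proof
  assume "\<alpha> / pi \<in> \<rat>"
  then obtain a :: int and n :: nat where n: "n \<noteq> 0" "\<alpha> / pi = of_int a / of_nat n"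
    by (auto simp: Rats_eq_int_div_nat)
  then have na: "of_nat n * \<alpha> = of_int a * pi" by (simp add: field_simps)
  define g where "g z = cos (of_nat n * snd (snd z))" for z :: "real \<times> real \<times> real"
  have per: "cos (x + 2 * pi * of_int k) = cos x" for x k
    using sin_cos_eq_iff[of "x + 2 * pi * of_int k" x] by auto
  have cT: "cos (of_nat n * T i \<theta>) = cos (of_nat n * \<theta>)" if "i \<in> {1..4}" for i \<theta>
    using that
  proof (cases rule: index_cases)
    case 1
    then have "of_nat n * T i \<theta> = of_nat n * \<theta> + 2 * (of_nat n * \<alpha>)" by (simp add: feres_map_def algebra_simps)
    also have "\<dots> = of_nat n * \<theta> + 2 * pi * of_int a" unfolding na by simp
    finally show ?thesis by (simp only: per)
  next
    case 2
    then have "of_nat n * T i \<theta> = - (of_nat n * \<theta>) + 2 * pi * of_nat n - 4 * (of_nat n * \<alpha>)" by (simp add: feres_map_def algebra_simps)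
    also have "\<dots> = - (of_nat n * \<theta>) + 2 * pi * of_int (int n - 2 * a)" unfolding na by (simp add: algebra_simps)
    finally show ?thesis by (simp only: per cos_minus)
  next
    case 3
    then have "of_nat n * T i \<theta> = of_nat n * \<theta> - 2 * (of_nat n * \<alpha>)" by (simp add: feres_map_def algebra_simps)
    also have "\<dots> = of_nat n * \<theta> + 2 * pi * of_int (- a)" unfolding na by simp
    finally show ?thesis by (simp only: per)
  next
    case 4
    then have "of_nat n * T i \<theta> = - (of_nat n * \<theta>) + 4 * (of_nat n * \<alpha>)" by (simp add: feres_map_def algebra_simps)
    also have "\<dots> = - (of_nat n * \<theta>) + 2 * pi * of_int (2 * a)" unfolding na by simp
    finally show ?thesis by (simp only: per cos_minus)
  qed
  \<comment> \<open>Invariance holds at every point, also where the skew-product is extended by the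
    identity.\<close>
  have gS: "g (S z) = g z" for z
    using cT[of 1] cT[of 2] cT[of 3] cT[of 4] by (cases z) (auto simp: g_def skew_product_cases)
  have gSk: "g ((S ^^ k) z) = g z" for k z by (induction k) (simp_all add: gS)
  \<comment> \<open>The bound \<pi> / (3 n) keeps n \<theta> strictly below \<pi> / 2, so the cosine
    is positive on \<open>?A\<close>; on \<open>?E\<close> the angle n \<theta> runs from \<pi> / 2
    to \<pi>.\<close>
  let ?A = "{0..1 :: real} \<times> {0..L} \<times> {0..pi / (3 * real n)}" and ?E = "{0..1 :: real} \<times> {0..L} \<times> {pi / (2 * real n)..pi / real n}"
  have n1: "1 \<le> real n" using n(1) by simp
  have A: "?A \<in> sets (skew_measure M r)" "0 < measure (skew_measure M r) ?A"
    using n1 by (auto intro!: measure_skew_box simp: divide_le_eq mult_le_cancel_left1)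
  have E: "?E \<in> sets (skew_measure M r)" "0 < measure (skew_measure M r) ?E"
    using n1 by (auto intro!: measure_skew_box simp: divide_le_eq mult_le_cancel_left1 divide_strict_left_mono)
  have gA: "0 < g z" if "z \<in> ?A" for z
  proof -
    have "0 \<le> real n * snd (snd z)" "real n * snd (snd z) \<le> pi / 3" using that n1 by (auto simp: field_simps)
    then have "- (pi / 2) < real n * snd (snd z)" "real n * snd (snd z) < pi / 2" using pi_gt_zero by linarith+
    then show ?thesis unfolding g_def by (rule cos_gt_zero_pi)
  qed
  have gE: "g z \<le> 0" if "z \<in> ?E" for z
  proof -
    have "pi / 2 \<le> real n * snd (snd z)" "real n * snd (snd z) \<le> pi" using that n1 by (auto simp: field_simps)
    then have "cos (real n * snd (snd z)) \<le> cos (pi / 2)" by (intro cos_monotone_0_pi_le) auto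
    then show ?thesis by (simp add: g_def)
  qed
  have empty: "(S ^^ k) -` ?A \<inter> ?E = {}" for k
  proof (rule equals0I, elim IntE vimageE)
    fix z assume "z \<in> ?E"
    with gE have "g z \<le> 0" .
    moreover fix y assume "(S ^^ k) z = y" "y \<in> ?A"
    then have "0 < g ((S ^^ k) z)" using gA by (simp only:)
    ultimately show False by (simp only: gSk)
  qed
  have "(\<lambda>k. measure (skew_measure M r) ((S ^^ k) -` ?A \<inter> ?E))
      \<longlonglongrightarrow> measure (skew_measure M r) ?A * measure (skew_measure M r) ?E"
    by (rule bspec[OF bspec[OF mix[unfolded random_billiard_mixing_def strongly_mixing_def] A(1)] E(1)])
  then have "(\<lambda>k. 0) \<longlonglongrightarrow> measure (skew_measure M r) ?A * measure (skew_measure M r) ?E"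
    unfolding empty measure_empty .
  then show False using A(2) E(2) by (simp add: LIMSEQ_const_iff)
qed

end

theorem mainTheorem1:
  fixes M :: surface and r\<^sub>0 \<alpha> :: real
  assumes "0 < r\<^sub>0" and "M = Spherical \<Longrightarrow> r\<^sub>0 < pi / 2"
    and "0 < \<alpha>" and "\<alpha> < pi / 6"
  shows "random_billiard_mixing M r\<^sub>0 \<alpha> \<longleftrightarrow> \<alpha> / pi \<notin> \<rat>"
proof -
  interpret feres_billiard \<alpha> M r\<^sub>0 by unfold_locales (use assms in auto)
  show ?thesis using irrational_imp_mixing mixing_imp_irrational by blast
qed

end
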